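(* Let $T$ be a countable complete $NIP$ theory with monster model $\mathcal U$, $M$ a countable model of $T$, $p(x)$ a global type finitely satisfiable in $M$, and $\mu(x)$ a global Keisler measure finitely satisfiable in $M$. Then: (i) There is a sequence $(a_n)$ in $M$ with $\lim_n tp(a_n/\mathcal U)=p$. (ii) There is a sequence $(\bar a_n)$ of finite tuples from $M$ with $\lim_n Av(\bar a_n)=\mu$. (iii) For such sequences and every formula $\theta(x,y)$, the function on $S_{\tilde\theta}(M)$ given by $q\mapsto\lim_n\theta(a_n,b)$ ($b\models q$) is $DBSC$, and the function $q\mapsto\lim_n Av(\bar a_n)(\theta(x,b))$ ($b\models q$) is Baire-1/2. (iv) The space of global types finitely satisfiable in $M$, and the space of global Keisler measures finitely satisfiable in $M$, are Rosenthal compacta.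
   Context: $T$ is $NIP$ if no formula $\theta(x,y)$ has the independence property. Global types are complete types over $\mathcal U$, with the Stone topology; a global Keisler measure is a finitely additive probability measure on $L(\mathcal U)$-formulas in $x$, with the topology of convergence on each formula. Finite satisfiability in $M$: each formula in the type (resp. of positive measure) is realized in $M$. For a tuple $\bar a=(a_1,\dots,a_n)$, $Av(\bar a)(\theta(x))=|\{i:\models\theta(a_i)\}|/n$. $\tilde\theta(y,x)=\theta(x,y)$ and $S_{\tilde\theta}(M)$ is the (compact metrizable) Stone space of complete $\tilde\theta$-types over $M$; $\theta(a,b)\in\{0,1\}$ is the truth value. On a compact metric space, a function is $DBSC$ if it is the pointwise limit of continuous $f_n$ ($f_0=0$) with $\sum_n|f_{n+1}-f_n|\le C$ everywhere for some constant $C$, and Baire-1/2 if it is a uniform limit of $DBSC$ functions. A Rosenthal compactum is a compact space homeomorphic to a pointwise-compact set of Baire class 1 functions on a Polish space. *)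

theory Defs
  imports "HOL-Analysis.Analysis"
begin

unbundle cardinal_syntax

section \<open>First-order logic with equality\<close>

record ('f, 'r) lang =
  Funs :: "'f set"
  Rels :: "'r set"
  fun_arity :: "'f \<Rightarrow> nat"
  rel_arity :: "'r \<Rightarrow> nat"

definition countable_lang :: "('f, 'r) lang \<Rightarrow> bool" where
  "countable_lang L \<longleftrightarrow> countable (Funs L) \<and> countable (Rels L)"

datatype 'f fo_term = Var nat | App 'f "'f fo_term list"

datatype ('f, 'r) fo_form =
    Eq "'f fo_term" "'f fo_term"
  | Rel 'r "'f fo_term list"
  | Neg "('f, 'r) fo_form"
  | Conj "('f, 'r) fo_form" "('f, 'r) fo_form"
  | Ex nat "('f, 'r) fo_form"

fun wf_term :: "('f, 'r) lang \<Rightarrow> 'f fo_term \<Rightarrow> bool" where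
  "wf_term L (Var i) = True"
| "wf_term L (App f ts) = (f \<in> Funs L \<and> length ts = fun_arity L f \<and> (\<forall>t\<in>set ts. wf_term L t))"

fun wf_form :: "('f, 'r) lang \<Rightarrow> ('f, 'r) fo_form \<Rightarrow> bool" where
  "wf_form L (Eq t u) = (wf_term L t \<and> wf_term L u)"
| "wf_form L (Rel r ts) = (r \<in> Rels L \<and> length ts = rel_arity L r \<and> (\<forall>t\<in>set ts. wf_term L t))"
| "wf_form L (Neg \<phi>) = wf_form L \<phi>"
| "wf_form L (Conj \<phi> \<psi>) = (wf_form L \<phi> \<and> wf_form L \<psi>)"
| "wf_form L (Ex i \<phi>) = wf_form L \<phi>"

fun term_vars :: "'f fo_term \<Rightarrow> nat set" where
  "term_vars (Var i) = {i}"
| "term_vars (App f ts) = (\<Union>t\<in>set ts. term_vars t)"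

fun free_vars :: "('f, 'r) fo_form \<Rightarrow> nat set" where
  "free_vars (Eq t u) = term_vars t \<union> term_vars u"
| "free_vars (Rel r ts) = (\<Union>t\<in>set ts. term_vars t)"
| "free_vars (Neg \<phi>) = free_vars \<phi>"
| "free_vars (Conj \<phi> \<psi>) = free_vars \<phi> \<union> free_vars \<psi>"
| "free_vars (Ex i \<phi>) = free_vars \<phi> - {i}"

definition forms :: "('f, 'r) lang \<Rightarrow> nat \<Rightarrow> ('f, 'r) fo_form set" where
  "forms L n = {\<phi>. wf_form L \<phi> \<and> free_vars \<phi> \<subseteq> {..<n}}"

definition tuples :: "'a set \<Rightarrow> nat \<Rightarrow> 'a list set" where
  "tuples A n = {as. set as \<subseteq> A \<and> length as = n}"

record ('f, 'r, 'a) fo_struct =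
  univ :: "'a set"
  fun_int :: "'f \<Rightarrow> 'a list \<Rightarrow> 'a"
  rel_int :: "'r \<Rightarrow> 'a list \<Rightarrow> bool"

definition lang_struct :: "('f, 'r) lang \<Rightarrow> ('f, 'r, 'a) fo_struct \<Rightarrow> bool" where
  "lang_struct L S \<longleftrightarrow> univ S \<noteq> {} \<and>
     (\<forall>f\<in>Funs L. \<forall>as\<in>tuples (univ S) (fun_arity L f). fun_int S f as \<in> univ S)"

fun term_val :: "('f, 'r, 'a) fo_struct \<Rightarrow> (nat \<Rightarrow> 'a) \<Rightarrow> 'f fo_term \<Rightarrow> 'a" where
  "term_val S s (Var i) = s i"
| "term_val S s (App f ts) = fun_int S f (map (term_val S s) ts)"

fun sat :: "('f, 'r, 'a) fo_struct \<Rightarrow> (nat \<Rightarrow> 'a) \<Rightarrow> ('f, 'r) fo_form \<Rightarrow> bool" where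
  "sat S s (Eq t u) = (term_val S s t = term_val S s u)"
| "sat S s (Rel r ts) = rel_int S r (map (term_val S s) ts)"
| "sat S s (Neg \<phi>) = (\<not> sat S s \<phi>)"
| "sat S s (Conj \<phi> \<psi>) = (sat S s \<phi> \<and> sat S s \<psi>)"
| "sat S s (Ex i \<phi>) = (\<exists>a\<in>univ S. sat S (s(i := a)) \<phi>)"

text \<open>Truth of \<open>\<phi>(as)\<close> for \<open>\<phi>\<close> in \<open>forms L (length as)\<close>: the variable \<open>i\<close> stands for the
  entry \<open>as ! i\<close>, and the values of \<open>(!) as\<close> beyond the length of \<open>as\<close> are irrelevant.
  A formula \<open>\<theta>(x,y)\<close> with \<open>x\<close> a tuple of \<open>k\<close> and \<open>y\<close> a tuple of \<open>m\<close> variables is an element of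
  \<open>forms L (k + m)\<close>, and \<open>\<theta>(a,b)\<close> is \<open>holds S \<theta> (a @ b)\<close>.\<close>

definition holds :: "('f, 'r, 'a) fo_struct \<Rightarrow> ('f, 'r) fo_form \<Rightarrow> 'a list \<Rightarrow> bool" where
  "holds S \<phi> as \<longleftrightarrow> sat S ((!) as) \<phi>"

section \<open>Theories, elementary submodels, monster models\<close>

definition is_theory :: "('f, 'r) lang \<Rightarrow> ('f, 'r) fo_form set \<Rightarrow> bool" where
  "is_theory L T \<longleftrightarrow> T \<subseteq> forms L 0"

definition model_of ::
  "('f, 'r) lang \<Rightarrow> ('f, 'r) fo_form set \<Rightarrow> ('f, 'r, 'a) fo_struct \<Rightarrow> bool" where
  "model_of L T S \<longleftrightarrow> lang_struct L S \<and> (\<forall>\<phi>\<in>T. holds S \<phi> [])"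

text \<open>Since HOL does not quantify over types, consistency and semantic consequence are tested on
  models whose universe is a set of natural numbers. For a countable language this is no
  restriction, by the downward Loewenheim-Skolem theorem.\<close>

definition entails :: "('f, 'r) lang \<Rightarrow> ('f, 'r) fo_form set \<Rightarrow> ('f, 'r) fo_form \<Rightarrow> bool" where
  "entails L T \<phi> \<longleftrightarrow>
     (\<forall>N :: ('f, 'r, nat) fo_struct. model_of L T N \<longrightarrow> holds N \<phi> [])"

definition complete_theory :: "('f, 'r) lang \<Rightarrow> ('f, 'r) fo_form set \<Rightarrow> bool" where
  "complete_theory L T \<longleftrightarrow> is_theory L T \<and>
     (\<exists>N :: ('f, 'r, nat) fo_struct. model_of L T N) \<and>
     (\<forall>\<phi>\<in>forms L 0. entails L T \<phi> \<or> entails L T (Neg \<phi>))"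

definition elementary_submodel ::
  "('f, 'r) lang \<Rightarrow> ('f, 'r, 'a) fo_struct \<Rightarrow> ('f, 'r, 'a) fo_struct \<Rightarrow> bool" where
  "elementary_submodel L M N \<longleftrightarrow> lang_struct L M \<and> lang_struct L N \<and> univ M \<subseteq> univ N \<and>
     (\<forall>n. \<forall>\<phi>\<in>forms L n. \<forall>as\<in>tuples (univ M) n. holds M \<phi> as \<longleftrightarrow> holds N \<phi> as)"

text \<open>An \<open>L(A)\<close>-formula \<open>\<theta>(x,b)\<close> in a tuple \<open>x\<close> of \<open>k\<close> variables is represented by the pair
  \<open>(\<theta>, b)\<close> of an \<open>L\<close>-formula and a tuple \<open>b\<close> of parameters from \<open>A\<close>.\<close>

definition pforms ::
  "('f, 'r) lang \<Rightarrow> 'a set \<Rightarrow> nat \<Rightarrow> (('f, 'r) fo_form \<times> 'a list) set" where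
  "pforms L A k = {(\<theta>, b). set b \<subseteq> A \<and> \<theta> \<in> forms L (k + length b)}"

definition solutions ::
  "('f, 'r, 'a) fo_struct \<Rightarrow> nat \<Rightarrow> ('f, 'r) fo_form \<times> 'a list \<Rightarrow> 'a list set" where
  "solutions S k = (\<lambda>(\<theta>, b). {a \<in> tuples (univ S) k. holds S \<theta> (a @ b)})"

definition consistent ::
  "('f, 'r, 'a) fo_struct \<Rightarrow> nat \<Rightarrow> (('f, 'r) fo_form \<times> 'a list) set \<Rightarrow> bool" where
  "consistent S k \<Gamma> \<longleftrightarrow>
     (\<forall>F. finite F \<and> F \<subseteq> \<Gamma> \<longrightarrow> (\<exists>a\<in>tuples (univ S) k. \<forall>\<phi>\<in>F. a \<in> solutions S k \<phi>))"

definition saturated ::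
  "'k rel \<Rightarrow> ('f, 'r) lang \<Rightarrow> ('f, 'r, 'a) fo_struct \<Rightarrow> bool" where
  "saturated \<kappa> L S \<longleftrightarrow>
     (\<forall>A k \<Gamma>. A \<subseteq> univ S \<and> |A| <o \<kappa> \<and> \<Gamma> \<subseteq> pforms L A k \<and> consistent S k \<Gamma> \<longrightarrow>
        (\<exists>a\<in>tuples (univ S) k. \<forall>\<phi>\<in>\<Gamma>. a \<in> solutions S k \<phi>))"

definition elementary_map ::
  "('f, 'r) lang \<Rightarrow> ('f, 'r, 'a) fo_struct \<Rightarrow> 'a set \<Rightarrow> ('a \<Rightarrow> 'a) \<Rightarrow> bool" where
  "elementary_map L S A g \<longleftrightarrow> A \<subseteq> univ S \<and> g ` A \<subseteq> univ S \<and>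
     (\<forall>n. \<forall>\<phi>\<in>forms L n. \<forall>as\<in>tuples A n. holds S \<phi> as \<longleftrightarrow> holds S \<phi> (map g as))"

definition automorphism ::
  "('f, 'r) lang \<Rightarrow> ('f, 'r, 'a) fo_struct \<Rightarrow> ('a \<Rightarrow> 'a) \<Rightarrow> bool" where
  "automorphism L S \<sigma> \<longleftrightarrow> bij_betw \<sigma> (univ S) (univ S) \<and>
     (\<forall>f\<in>Funs L. \<forall>as\<in>tuples (univ S) (fun_arity L f).
        \<sigma> (fun_int S f as) = fun_int S f (map \<sigma> as)) \<and>
     (\<forall>r\<in>Rels L. \<forall>as\<in>tuples (univ S) (rel_arity L r).
        rel_int S r as \<longleftrightarrow> rel_int S r (map \<sigma> as))"

definition strongly_homogeneous ::
  "'k rel \<Rightarrow> ('f, 'r) lang \<Rightarrow> ('f, 'r, 'a) fo_struct \<Rightarrow> bool" where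
  "strongly_homogeneous \<kappa> L S \<longleftrightarrow>
     (\<forall>A g. |A| <o \<kappa> \<and> elementary_map L S A g \<longrightarrow>
        (\<exists>\<sigma>. automorphism L S \<sigma> \<and> (\<forall>a\<in>A. \<sigma> a = g a)))"

text \<open>The cardinal \<open>\<kappa>\<close> bounds the small sets. Over a countable language, and with only countable
  submodels considered, ``sufficiently large'' means uncountable.\<close>

definition monster_model ::
  "'k rel \<Rightarrow> ('f, 'r) lang \<Rightarrow> ('f, 'r) fo_form set \<Rightarrow> ('f, 'r, 'a) fo_struct \<Rightarrow> bool" where
  "monster_model \<kappa> L T U \<longleftrightarrow> Card_order \<kappa> \<and> natLeq <o \<kappa> \<and>
     model_of L T U \<and> saturated \<kappa> L U \<and> strongly_homogeneous \<kappa> L U"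

text \<open>As usual for a complete theory, the independence property is evaluated in its monster
  model \<open>U\<close>.\<close>

definition has_IP ::
  "('f, 'r, 'a) fo_struct \<Rightarrow> nat \<Rightarrow> nat \<Rightarrow> ('f, 'r) fo_form \<Rightarrow> bool" where
  "has_IP U k m \<theta> \<longleftrightarrow>
     (\<exists>(a :: nat \<Rightarrow> 'a list) (b :: nat set \<Rightarrow> 'a list).
        (\<forall>i. a i \<in> tuples (univ U) k) \<and> (\<forall>I. b I \<in> tuples (univ U) m) \<and>
        (\<forall>i I. holds U \<theta> (a i @ b I) \<longleftrightarrow> i \<in> I))"

definition NIP :: "('f, 'r) lang \<Rightarrow> ('f, 'r, 'a) fo_struct \<Rightarrow> bool" where
  "NIP L U \<longleftrightarrow> (\<forall>k m. \<forall>\<theta>\<in>forms L (k + m). \<not> has_IP U k m \<theta>)"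

section \<open>Global types\<close>

definition global_types ::
  "('f, 'r) lang \<Rightarrow> ('f, 'r, 'a) fo_struct \<Rightarrow> nat \<Rightarrow> (('f, 'r) fo_form \<times> 'a list) set set" where
  "global_types L U k =
     {p. p \<subseteq> pforms L (univ U) k \<and> consistent U k p \<and>
         (\<forall>(\<theta>, b)\<in>pforms L (univ U) k. (\<theta>, b) \<in> p \<or> (Neg \<theta>, b) \<in> p)}"

definition global_type_topology ::
  "('f, 'r) lang \<Rightarrow> ('f, 'r, 'a) fo_struct \<Rightarrow> nat \<Rightarrow> (('f, 'r) fo_form \<times> 'a list) set topology"
  where
  "global_type_topology L U k =
     topology_generated_by {{p \<in> global_types L U k. \<phi> \<in> p} |\<phi>. \<phi> \<in> pforms L (univ U) k}"

definition global_tp ::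
  "('f, 'r) lang \<Rightarrow> ('f, 'r, 'a) fo_struct \<Rightarrow> 'a list \<Rightarrow> (('f, 'r) fo_form \<times> 'a list) set" where
  "global_tp L U a = {(\<theta>, b) \<in> pforms L (univ U) (length a). holds U \<theta> (a @ b)}"

definition type_fin_sat ::
  "('f, 'r, 'a) fo_struct \<Rightarrow> 'a set \<Rightarrow> nat \<Rightarrow> (('f, 'r) fo_form \<times> 'a list) set \<Rightarrow> bool" where
  "type_fin_sat U A k p \<longleftrightarrow> (\<forall>\<phi>\<in>p. \<exists>a\<in>tuples A k. a \<in> solutions U k \<phi>)"

section \<open>Global Keisler measures\<close>

text \<open>Finite additivity is stated for all formulas defining a disjoint union; in particular
  equivalent formulas get the same measure.\<close>

definition keisler_measures ::
  "('f, 'r) lang \<Rightarrow> ('f, 'r, 'a) fo_struct \<Rightarrow> nat \<Rightarrow> (('f, 'r) fo_form \<times> 'a list \<Rightarrow> real) set" where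
  "keisler_measures L U k =
     {\<mu> \<in> extensional (pforms L (univ U) k).
        (\<forall>\<phi>\<in>pforms L (univ U) k. 0 \<le> \<mu> \<phi>) \<and>
        (\<forall>\<phi>\<in>pforms L (univ U) k. solutions U k \<phi> = tuples (univ U) k \<longrightarrow> \<mu> \<phi> = 1) \<and>
        (\<forall>\<phi>\<in>pforms L (univ U) k. \<forall>\<psi>\<in>pforms L (univ U) k. \<forall>\<rho>\<in>pforms L (univ U) k.
           solutions U k \<phi> \<inter> solutions U k \<psi> = {} \<and>
           solutions U k \<rho> = solutions U k \<phi> \<union> solutions U k \<psi> \<longrightarrow>
           \<mu> \<rho> = \<mu> \<phi> + \<mu> \<psi>)}"

definition keisler_topology ::
  "('f, 'r) lang \<Rightarrow> ('f, 'r, 'a) fo_struct \<Rightarrow> nat \<Rightarrow> (('f, 'r) fo_form \<times> 'a list \<Rightarrow> real) topology"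
  where
  "keisler_topology L U k =
     subtopology (product_topology (\<lambda>_. euclideanreal) (pforms L (univ U) k))
       (keisler_measures L U k)"

text \<open>The argument \<open>as\<close> is a finite tuple \<open>(a\<^sub>1, \<dots>, a\<^sub>n)\<close> of \<open>k\<close>-tuples.\<close>

definition Av ::
  "('f, 'r) lang \<Rightarrow> ('f, 'r, 'a) fo_struct \<Rightarrow> nat \<Rightarrow> 'a list list \<Rightarrow>
     ('f, 'r) fo_form \<times> 'a list \<Rightarrow> real" where
  "Av L U k as = (\<lambda>\<phi>\<in>pforms L (univ U) k.
     real (card {i. i < length as \<and> as ! i \<in> solutions U k \<phi>}) / real (length as))"

definition measure_fin_sat ::
  "('f, 'r) lang \<Rightarrow> ('f, 'r, 'a) fo_struct \<Rightarrow> 'a set \<Rightarrow> nat \<Rightarrow>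
     (('f, 'r) fo_form \<times> 'a list \<Rightarrow> real) \<Rightarrow> bool" where
  "measure_fin_sat L U A k \<mu> \<longleftrightarrow>
     (\<forall>\<phi>\<in>pforms L (univ U) k. 0 < \<mu> \<phi> \<longrightarrow> (\<exists>a\<in>tuples A k. a \<in> solutions U k \<phi>))"

section \<open>Local types\<close>

text \<open>Let \<open>\<theta>(x,y)\<close> have \<open>k + m\<close> variables and \<open>\<theta>\<^sup>\<sim>(y,x) = \<theta>(x,y)\<close>. A \<open>\<theta>\<^sup>\<sim>\<close>-type over \<open>A\<close>
  is a set of formulas \<open>\<theta>(a,y)\<close> and \<open>\<not>\<theta>(a,y)\<close> in the variable \<open>y\<close>, with \<open>a\<close> a \<open>k\<close>-tuple from \<open>A\<close>;
  they are represented by \<open>(a, True)\<close> and \<open>(a, False)\<close> respectively.\<close>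

definition realizes ::
  "('f, 'r, 'a) fo_struct \<Rightarrow> nat \<Rightarrow> ('f, 'r) fo_form \<Rightarrow> 'a list \<Rightarrow> ('a list \<times> bool) set \<Rightarrow> bool"
  where
  "realizes U m \<theta> b q \<longleftrightarrow> b \<in> tuples (univ U) m \<and> (\<forall>(a, v)\<in>q. holds U \<theta> (a @ b) \<longleftrightarrow> v)"

definition local_types ::
  "('f, 'r, 'a) fo_struct \<Rightarrow> 'a set \<Rightarrow> nat \<Rightarrow> nat \<Rightarrow> ('f, 'r) fo_form \<Rightarrow>
     ('a list \<times> bool) set set" where
  "local_types U A k m \<theta> =
     {q. q \<subseteq> tuples A k \<times> UNIV \<and>
         (\<forall>F. finite F \<and> F \<subseteq> q \<longrightarrow> (\<exists>b. realizes U m \<theta> b F)) \<and>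
         (\<forall>a\<in>tuples A k. (a, True) \<in> q \<or> (a, False) \<in> q)}"

definition local_type_topology ::
  "('f, 'r, 'a) fo_struct \<Rightarrow> 'a set \<Rightarrow> nat \<Rightarrow> nat \<Rightarrow> ('f, 'r) fo_form \<Rightarrow>
     ('a list \<times> bool) set topology" where
  "local_type_topology U A k m \<theta> =
     topology_generated_by {{q \<in> local_types U A k m \<theta>. (a, v) \<in> q} |a v. a \<in> tuples A k}"

text \<open>\<open>F\<close> is the function \<open>q \<mapsto> lim\<^sub>n g n b\<close>, for any \<open>b\<close> realizing \<open>q\<close>, on the local types; this
  includes that the limit exists and does not depend on the choice of \<open>b\<close>.\<close>

definition limit_function ::
  "('f, 'r, 'a) fo_struct \<Rightarrow> 'a set \<Rightarrow> nat \<Rightarrow> nat \<Rightarrow> ('f, 'r) fo_form \<Rightarrow>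
     (nat \<Rightarrow> 'a list \<Rightarrow> real) \<Rightarrow> (('a list \<times> bool) set \<Rightarrow> real) \<Rightarrow> bool" where
  "limit_function U A k m \<theta> g F \<longleftrightarrow>
     (\<forall>q\<in>local_types U A k m \<theta>.
        (\<exists>b. realizes U m \<theta> b q) \<and>
        (\<forall>b. realizes U m \<theta> b q \<longrightarrow> (\<lambda>n. g n b) \<longlonglongrightarrow> F q))"

section \<open>Classes of functions and Rosenthal compacta\<close>

definition DBSC :: "'x topology \<Rightarrow> ('x \<Rightarrow> real) \<Rightarrow> bool" where
  "DBSC X f \<longleftrightarrow>
     (\<exists>(g :: nat \<Rightarrow> 'x \<Rightarrow> real) C.
        (\<forall>n. continuous_map X euclideanreal (g n)) \<and>
        (\<forall>x\<in>topspace X. g 0 x = 0 \<and> (\<lambda>n. g n x) \<longlonglongrightarrow> f x \<and>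
           summable (\<lambda>n. \<bar>g (Suc n) x - g n x\<bar>) \<and>
           (\<Sum>n. \<bar>g (Suc n) x - g n x\<bar>) \<le> C))"

definition Baire_half :: "'x topology \<Rightarrow> ('x \<Rightarrow> real) \<Rightarrow> bool" where
  "Baire_half X f \<longleftrightarrow>
     (\<exists>g :: nat \<Rightarrow> 'x \<Rightarrow> real. (\<forall>n. DBSC X (g n)) \<and> uniform_limit (topspace X) g f sequentially)"

definition Baire_one :: "'x topology \<Rightarrow> ('x \<Rightarrow> real) set" where
  "Baire_one X =
     {f \<in> extensional (topspace X).
        \<exists>g :: nat \<Rightarrow> 'x \<Rightarrow> real. (\<forall>n. continuous_map X euclideanreal (g n)) \<and>
          (\<forall>x\<in>topspace X. (\<lambda>n. g n x) \<longlonglongrightarrow> f x)}"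

definition Polish :: "'x topology \<Rightarrow> bool" where
  "Polish X \<longleftrightarrow> completely_metrizable_space X \<and> separable_space X"

text \<open>Every Polish space has at most continuum many points, so up to homeomorphism it is a topology
  on a subset of the type \<^typ>\<open>nat \<Rightarrow> real\<close>. The topology \<open>P\<close> is arbitrary, not necessarily the
  one induced by the product topology.\<close>

definition Rosenthal_compactum :: "'x topology \<Rightarrow> bool" where
  "Rosenthal_compactum X \<longleftrightarrow> compact_space X \<and>
     (\<exists>(P :: (nat \<Rightarrow> real) topology) K.
        Polish P \<and> K \<subseteq> Baire_one P \<and>
        compactin (product_topology (\<lambda>_. euclideanreal) (topspace P)) K \<and>
        X homeomorphic_space
          subtopology (product_topology (\<lambda>_. euclideanreal) (topspace P)) K)"

end

theory Submission
  imports "HOL-Library.Ramsey" "HOL-Real_Asymp.Real_Asymp" Defs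
begin

text \<open>Extend the type or measure from definable sets to an ultrafilter \<open>D\<close> on the countable set of
  finite tuples of points of \<open>M\<close> (singletons for a type), and choose a sequence in it that is eventually
  in each of countably many \<open>D\<close>-large sets, namely those that express that patterns of the truth
  values \<open>\<theta>(x\<^sub>1, b), \<dots>, \<theta>(x\<^sub>n, b)\<close> occur for \<open>D\<close>-almost all \<open>(x\<^sub>1, \<dots>, x\<^sub>n)\<close>. If the sequence did not
  converge to the measure on some \<open>\<theta>(x, b)\<close>, then mixing \<open>D\<close>-generic points with members of the
  sequence would realize every pattern, so \<open>\<theta>\<close> would be shattered by averages with a fixed gap; by the
  Sauer-Shelah lemma and an exponential moment bound this contradicts NIP. The same bound
  and Ramsey's theorem give a subsequence whose oscillation is bounded uniformly in \<open>b\<close>, hence DBSC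
  approximations of the limit. Finally, types and measures are determined by their values on the codes of the
  pairs \<open>(\<theta>, b)\<close>, which form a closed subset of \<open>nat \<Rightarrow> real\<close>.\<close>

section \<open>Ultrafilters\<close>

text \<open>Convergence must hold for all parameters \<open>b\<close> of a possibly uncountable
  model, while a sequence can be made generic for only countably many conditions; the space of types
  need not be first countable, so approximability by points of \<open>M\<close> alone yields a net
  and not a sequence. The way out is that the conditions mention formulas only, with
  \<open>b\<close> quantified existentially, and NIP recovers the statement about each single
  \<open>b\<close>. The ultrafilter stands in for integration, and its iterates take the place of
  product measures. Types are treated as 0-1 valued measures sampled by single points, so one
  argument covers both cases. Passing from formulas to averages replaces truth values by two
  thresholds \<open>r < s\<close>, hence the gaps throughout. NIP, as defined here, forbids an
  infinite configuration, whereas the bounds are finite; saturation bridges this. The approximants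
  obtained have a fixed positive error, which vanishes only when the limit is 0-1 valued; this is
  why types give DBSC functions and measures uniform limits of such.\<close>

definition ultra :: "'a filter \<Rightarrow> bool" where
  "ultra D \<longleftrightarrow> D \<noteq> bot \<and> (\<forall>P. eventually P D \<or> eventually (\<lambda>x. \<not> P x) D)"

lemma ultra_not: "ultra D \<Longrightarrow> eventually (\<lambda>x. \<not> P x) D \<longleftrightarrow> \<not> eventually P D"
  unfolding ultra_def
  using eventually_conj[of P D "\<lambda>x. \<not> P x"] by (auto simp: trivial_limit_def)

text \<open>Zorn's lemma for the reversed order, so that maximal means finest. The infimum of a
  chain is proper because finite infima of its members are again members.\<close>

lemma ultrafilter_exists:
  assumes "F \<noteq> bot"
  obtains D where "D \<le> F" "ultra D"
proof -
  define A where "A = {G. G \<noteq> bot \<and> G \<le> F}"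
  define P where "P = (\<lambda>x y :: 'a filter. y \<le> x)"
  have "\<exists>m\<in>A. \<forall>a\<in>A. P m a \<longrightarrow> a = m"
  proof (rule predicate_Zorn)
    show "partial_order_on A (relation_of P A)"
      unfolding P_def by (rule partial_order_on_relation_ofI) auto
  next
    fix C assume C: "C \<in> Chains (relation_of P A)"
    then have CA: "C \<subseteq> A" and comp: "\<And>x y. x \<in> C \<Longrightarrow> y \<in> C \<Longrightarrow> x \<le> y \<or> y \<le> x"
      by (auto simp: Chains_def relation_of_def P_def)
    show "\<exists>u\<in>A. \<forall>a\<in>C. P a u"
    proof (cases "C = {}")
      case True
      then show ?thesis using assms by (auto simp: A_def)
    next
      case False
      have fin: "Inf X \<in> X" if "finite X" "X \<noteq> {}" "X \<subseteq> C" for X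
        using that
      proof (induction rule: finite_ne_induct)
        case (insert x X)
        then have "Inf X \<in> C" "x \<in> C" by auto
        then have "inf x (Inf X) = x \<or> inf x (Inf X) = Inf X"
          using comp[of x "Inf X"] by (auto simp: inf.absorb1 inf.absorb2)
        then show ?case using insert by auto
      qed auto
      have "Inf C \<noteq> bot"
      proof (rule Inf_filter_not_bot)
        fix X assume X: "X \<subseteq> C" "finite X"
        show "Inf X \<noteq> bot"
        proof (cases "X = {}")
          case True
          then have "F \<le> Inf X" by simp
          then show ?thesis using assms by (auto simp: bot_unique)
        next
          case False
          then show ?thesis using fin[OF X(2) _ X(1)] X CA by (auto simp: A_def)
        qed
      qed
      moreover have "Inf C \<le> F"
        using False CA by (auto simp: A_def intro: Inf_lower2)
      ultimately show ?thesis
        by (auto simp: A_def P_def intro!: bexI[of _ "Inf C"] Inf_lower)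
    qed
  qed
  then obtain D where D: "D \<noteq> bot" "D \<le> F"
    and max: "\<And>G. G \<noteq> bot \<Longrightarrow> G \<le> F \<Longrightarrow> G \<le> D \<Longrightarrow> G = D"
    by (auto simp: A_def P_def)
  \<comment> \<open>Restricting \<open>D\<close> to \<open>P\<close> either destroys it, so that the
    complement is large, or leaves a proper finer filter, which by maximality is \<open>D\<close>
    itself.\<close>
  have "eventually P D \<or> eventually (\<lambda>x. \<not> P x) D" for P
  proof (cases "inf D (principal {x. P x}) = bot")
    case True
    then have "eventually (\<lambda>_. False) (inf D (principal {x. P x}))" by simp
    then show ?thesis by (simp add: eventually_inf_principal)
  next
    case False
    then have "inf D (principal {x. P x}) = D"
      using D by (intro max) (auto intro: le_infI1)
    moreover have "eventually P (inf D (principal {x. P x}))" by (simp add: eventually_inf_principal)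
    ultimately show ?thesis by simp
  qed
  then show ?thesis using D that by (auto simp: ultra_def)
qed

section \<open>Patterns and generic sequences\<close>

text \<open>Since \<open>b\<close> is quantified inside, a pattern is a condition on the sample
  alone; with rational thresholds and finite \<open>E\<close> only countably many such conditions
  arise from one \<open>f\<close>.\<close>

definition pattern ::
  "('b \<Rightarrow> 'y \<Rightarrow> real) \<Rightarrow> 'b set \<Rightarrow> real \<Rightarrow> real \<Rightarrow> nat set \<Rightarrow> 'y list \<Rightarrow> bool" where
  "pattern f B r s E ys \<longleftrightarrow>
     (\<exists>b\<in>B. \<forall>i<length ys. if i \<in> E then s < f b (ys ! i) else f b (ys ! i) < r)"

definition fat_shattered ::
  "('b \<Rightarrow> 'y \<Rightarrow> real) \<Rightarrow> 'b set \<Rightarrow> real \<Rightarrow> real \<Rightarrow> 'y list \<Rightarrow> bool" where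
  "fat_shattered f B r s ys \<longleftrightarrow> (\<forall>E. pattern f B r s E ys)"

text \<open>Finite fat-shattering dimension at each gap, where one pair of thresholds serves all
  points of the list.\<close>

definition fat_bounded :: "('b \<Rightarrow> 'y \<Rightarrow> real) \<Rightarrow> 'b set \<Rightarrow> 'y set \<Rightarrow> bool" where
  "fat_bounded f B Y \<longleftrightarrow>
     (\<forall>r s. r < s \<longrightarrow> (\<exists>K. \<forall>ys. set ys \<subseteq> Y \<and> length ys = K \<longrightarrow> \<not> fat_shattered f B r s ys))"

lemma pattern_Int: "pattern f B r s (E \<inter> {..<length ys}) ys = pattern f B r s E ys"
  unfolding pattern_def by (auto intro!: bex_cong)

text \<open>The \<open>n\<close>-fold Fubini power of \<open>D\<close>: for almost all first
  entries, for almost all second entries, and so on.\<close>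

fun iterated :: "nat \<Rightarrow> 'y filter \<Rightarrow> ('y list \<Rightarrow> bool) \<Rightarrow> bool" where
  "iterated 0 D R = R []"
| "iterated (Suc n) D R = eventually (\<lambda>y. iterated n D (\<lambda>ys. R (y # ys))) D"

lemma iterated_not: "ultra D \<Longrightarrow> iterated n D (\<lambda>ys. \<not> R ys) \<longleftrightarrow> \<not> iterated n D R"
  by (induction n arbitrary: R) (auto simp: ultra_not)

lemma iterated_conj: "iterated n D R \<Longrightarrow> iterated n D Q \<Longrightarrow> iterated n D (\<lambda>ys. R ys \<and> Q ys)"
proof (induction n arbitrary: R Q)
  case (Suc n)
  show ?case
    using Suc.prems unfolding iterated.simps
    by (rule eventually_elim2) (rule Suc.IH)
qed auto

lemma iterated_True: "iterated n D (\<lambda>ys. True)"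
  by (induction n) auto

lemma iterated_ball:
  assumes "finite I" "\<And>i. i \<in> I \<Longrightarrow> iterated n D (R i)"
  shows "iterated n D (\<lambda>ys. \<forall>i\<in>I. R i ys)"
  using assms
proof (induction I rule: finite_induct)
  case (insert x F)
  then show ?case using iterated_conj[of n D "R x" "\<lambda>ys. \<forall>i\<in>F. R i ys"] by simp
qed (simp add: iterated_True)

lemma iterated_witness:
  assumes "D \<noteq> bot" "eventually (\<lambda>y. y \<in> Y) D" "iterated n D R"
  shows "\<exists>ys. set ys \<subseteq> Y \<and> length ys = n \<and> R ys"
  using assms(3)
proof (induction n arbitrary: R)
  case (Suc n)
  then have "eventually (\<lambda>y. y \<in> Y \<and> iterated n D (\<lambda>ys. R (y # ys))) D"
    using assms(2) by (auto intro: eventually_conj)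
  from eventually_happens'[OF assms(1) this]
  obtain y where "y \<in> Y" "iterated n D (\<lambda>ys. R (y # ys))" by blast
  then obtain ys where "set ys \<subseteq> Y" "length ys = n" "R (y # ys)" using Suc.IH by blast
  then show ?case using \<open>y \<in> Y\<close> by (intro exI[of _ "y # ys"]) auto
qed auto

lemma generic_sequence_for_countable:
  assumes "D \<noteq> bot" "eventually (\<lambda>y. y \<in> Y) D" "countable W"
    and W: "\<And>P. P \<in> W \<Longrightarrow> eventually P D"
  obtains y :: "nat \<Rightarrow> 'y" where "\<And>n. y n \<in> Y" "\<And>P. P \<in> W \<Longrightarrow> eventually (\<lambda>n. P (y n)) sequentially"
proof -
  \<comment> \<open>The trivial condition keeps the set nonempty, so that
    \<open>from_nat_into\<close> enumerates it. The \<open>n\<close>-th point will satisfy the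
    conditions numbered up to \<open>n\<close>.\<close>
  define W' where "W' = insert (\<lambda>_. True) W"
  have W': "countable W'" "W' \<noteq> {}" "\<And>P. P \<in> W' \<Longrightarrow> eventually P D"
    using assms by (auto simp: W'_def)
  define P where "P = from_nat_into W'"
  have P: "P n \<in> W'" for n using from_nat_into[OF W'(2)] by (simp add: P_def)
  have "eventually (\<lambda>y. y \<in> Y \<and> (\<forall>i\<in>{..n}. P i y)) D" for n
    using assms(2) W'(3)[OF P] by (intro eventually_conj eventually_ball_finite) auto
  from eventually_happens'[OF assms(1) this]
  have "\<exists>y. y \<in> Y \<and> (\<forall>i\<in>{..n}. P i y)" for n .
  then obtain y where y: "\<And>n. y n \<in> Y" "\<And>n i. i \<le> n \<Longrightarrow> P i (y n)" by (metis atMost_iff)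
  show ?thesis
  proof
    fix Q assume "Q \<in> W"
    then obtain i where "Q = P i"
      using from_nat_into_surj[OF W'(1), of Q] unfolding P_def W'_def by auto
    then show "eventually (\<lambda>n. Q (y n)) sequentially"
      using y(2) by (auto simp: eventually_sequentially)
  qed (rule y)
qed

text \<open>A pattern that prescribes one of two alternatives at each place can be realized by choosing
  each point either \<open>D\<close>-generically or far out in the sequence \<open>y\<close>; as \<open>y\<close> is itself
  \<open>D\<close>-generic for the relevant relations, the pattern then holds at \<open>D\<close>-almost all tuples.\<close>

lemma mixed_pattern:
  fixes y :: "nat \<Rightarrow> 'y"
  assumes D: "ultra D" "eventually (\<lambda>x. x \<in> Y) D" and y: "\<And>n. y n \<in> Y"
    and generic: "\<And>ys i. set ys \<subseteq> Y \<Longrightarrow> i < n \<Longrightarrow> length ys = i \<Longrightarrow>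
        eventually (\<lambda>x. iterated (n - Suc i) D (\<lambda>zs. \<not> R (ys @ x # zs))) D \<Longrightarrow>
        eventually (\<lambda>j. iterated (n - Suc i) D (\<lambda>zs. \<not> R (ys @ y j # zs))) sequentially"
    and R: "\<And>ys. length ys = n \<Longrightarrow> (\<And>i. i < n \<Longrightarrow> P (i \<in> E) (ys ! i)) \<Longrightarrow> R ys"
    and alt: "\<And>v. eventually (P v) D \<or> frequently (\<lambda>j. P v (y j)) sequentially"
  shows "iterated n D R"
proof (rule ccontr)
  assume "\<not> iterated n D R"
  then have *: "iterated n D (\<lambda>ys. \<not> R ys)" using iterated_not[OF D(1)] by blast
  \<comment> \<open>Invariant: the points chosen so far follow \<open>E\<close>, while
    \<open>R\<close> still fails for almost all continuations. At \<open>i = n\<close> nothing is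
    left to choose, and this is absurd.\<close>
  have "\<exists>ys. set ys \<subseteq> Y \<and> length ys = i \<and> (\<forall>l<i. P (l \<in> E) (ys ! l)) \<and>
         iterated (n - i) D (\<lambda>zs. \<not> R (ys @ zs))" if "i \<le> n" for i
    using that
  proof (induction i)
    case 0
    then show ?case using * by auto
  next
    case (Suc i)
    then obtain ys where ys: "set ys \<subseteq> Y" "length ys = i" "\<forall>l<i. P (l \<in> E) (ys ! l)"
      "iterated (n - i) D (\<lambda>zs. \<not> R (ys @ zs))" by auto
    have ni: "n - i = Suc (n - Suc i)" using Suc.prems by auto
    have ev: "eventually (\<lambda>x. iterated (n - Suc i) D (\<lambda>zs. \<not> R (ys @ x # zs))) D"
      using ys(4) unfolding ni by simp
    have "\<exists>x\<in>Y. P (i \<in> E) x \<and> iterated (n - Suc i) D (\<lambda>zs. \<not> R (ys @ x # zs))"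
      using alt[of "i \<in> E"]
    proof
      assume "eventually (P (i \<in> E)) D"
      then have "eventually (\<lambda>x. x \<in> Y \<and> P (i \<in> E) x \<and>
          iterated (n - Suc i) D (\<lambda>zs. \<not> R (ys @ x # zs))) D"
        using ev D(2) by (auto intro!: eventually_conj)
      from eventually_happens'[OF _ this] show ?thesis
        using D(1) unfolding ultra_def by blast
    next
      assume "frequently (\<lambda>j. P (i \<in> E) (y j)) sequentially"
      from frequently_eventually_frequently[OF this generic[OF ys(1) _ ys(2) ev]] Suc.prems
      have "frequently (\<lambda>j. P (i \<in> E) (y j) \<and>
         iterated (n - Suc i) D (\<lambda>zs. \<not> R (ys @ y j # zs))) sequentially" by simp
      then show ?thesis using y by (auto dest!: frequently_ex)
    qed
    then obtain x where x: "x \<in> Y" "P (i \<in> E) x"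
      "iterated (n - Suc i) D (\<lambda>zs. \<not> R (ys @ x # zs))" by blast
    have "\<forall>l<Suc i. P (l \<in> E) ((ys @ [x]) ! l)"
      using ys x by (auto simp: nth_append less_Suc_eq)
    then show ?case
      using ys x by (intro exI[of _ "ys @ [x]"]) auto
  qed
  from this[of n] R show False by auto
qed

text \<open>If \<open>f j b\<close> were infinitely often on the wrong side of a gap next to its
  limit, \<open>D\<close> would supply one side of the gap and \<open>y\<close> the other. Then no
  pattern can fail almost surely, and some sample realizes all of them at once, against
  \<open>fat_bounded\<close>.\<close>

lemma generic_sequence:
  fixes f :: "'j \<Rightarrow> 'b \<Rightarrow> 'y \<Rightarrow> real"
  assumes D: "ultra D" "eventually (\<lambda>y. y \<in> Y) D" and Y: "countable Y" and J: "countable J"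
    and fat: "\<And>j. j \<in> J \<Longrightarrow> fat_bounded (f j) (B j) Y"
    and lim: "\<And>j b. j \<in> J \<Longrightarrow> b \<in> B j \<Longrightarrow> (f j b \<longlongrightarrow> l j b) D"
  obtains y :: "nat \<Rightarrow> 'y" where "\<And>n. y n \<in> Y"
    "\<And>j b. j \<in> J \<Longrightarrow> b \<in> B j \<Longrightarrow> (\<lambda>n. f j b (y n)) \<longlonglongrightarrow> l j b"
proof -
  \<comment> \<open>Fixed initial entries \<open>ys\<close>, one free place \<open>x\<close>, and
    \<open>n\<close> generic later entries; all components of the index come from countable
    sets.\<close>
  define W where "W = (\<lambda>(j, r, s, E, ys, n) x.
     iterated n D (\<lambda>zs. \<not> pattern (f j) (B j) r s E (ys @ x # zs)))"
  define I where "I = J \<times> (\<rat> :: real set) \<times> (\<rat> :: real set) \<times> Collect (finite :: nat set \<Rightarrow> bool) \<times> lists Y \<times> (UNIV :: nat set)"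
  have "countable I"
    unfolding I_def using Y J by (intro countable_SIGMA countable_lists countable_rat
      countable_Collect_finite countableI_type)
  then have "countable {P \<in> W ` I. eventually P D}"
    by (rule countable_subset[rotated, OF countable_image]) auto
  from generic_sequence_for_countable[OF _ D(2) this]
  obtain y :: "nat \<Rightarrow> 'y" where y: "\<And>n. y n \<in> Y"
    and gen: "\<And>P. P \<in> W ` I \<Longrightarrow> eventually P D \<Longrightarrow> eventually (\<lambda>n. P (y n)) sequentially"
    using D(1) unfolding ultra_def mem_Collect_eq by metis
  have key: False
    if j: "j \<in> J" "b \<in> B j" and rs: "r < s" "r \<in> \<rat>" "s \<in> \<rat>"
      and alt: "\<And>v. eventually (\<lambda>x. if v then s < f j b x else f j b x < r) D \<or>
            frequently (\<lambda>i. if v then s < f j b (y i) else f j b (y i) < r) sequentially"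
    for j b r s
  proof -
    obtain K where K: "\<And>ys. set ys \<subseteq> Y \<Longrightarrow> length ys = K \<Longrightarrow> \<not> fat_shattered (f j) (B j) r s ys"
      using fat[OF j(1)] rs(1) unfolding fat_bounded_def by blast
    have "iterated K D (pattern (f j) (B j) r s E)" if E: "finite E" for E
    proof (rule mixed_pattern[where P = "\<lambda>v x. if v then s < f j b x else f j b x < r" and E = E])
      show "ultra D" "eventually (\<lambda>x. x \<in> Y) D" "\<And>n. y n \<in> Y" by (fact D y)+
      fix ys i
      assume ys: "set ys \<subseteq> Y"
        and ev: "eventually (\<lambda>x. iterated (K - Suc i) D
            (\<lambda>zs. \<not> pattern (f j) (B j) r s E (ys @ x # zs))) D"
      have "(j, r, s, E, ys, K - Suc i) \<in> I"
        using j rs E ys by (auto simp: I_def)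
      then have "W (j, r, s, E, ys, K - Suc i) \<in> W ` I" by (rule imageI)
      from gen[OF this] ev
      show "eventually (\<lambda>n. iterated (K - Suc i) D
            (\<lambda>zs. \<not> pattern (f j) (B j) r s E (ys @ y n # zs))) sequentially"
        by (simp add: W_def)
    next
      fix ys :: "'y list"
      assume "length ys = K"
        "\<And>i. i < K \<Longrightarrow> if i \<in> E then s < f j b (ys ! i) else f j b (ys ! i) < r"
      then show "pattern (f j) (B j) r s E ys" using j(2) unfolding pattern_def by blast
    qed (fact alt)
    \<comment> \<open>On \<open>K\<close> places there are only finitely many patterns, so a single
      sample realizes them all, each with its own \<open>b\<close>.\<close>
    then have "iterated K D (\<lambda>ys. \<forall>E\<in>Pow {..<K}. pattern (f j) (B j) r s E ys)"
      by (intro iterated_ball) (auto intro: finite_subset)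
    from iterated_witness[OF _ D(2) this]
    obtain ys where ys: "set ys \<subseteq> Y" "length ys = K"
      "\<forall>E\<in>Pow {..<K}. pattern (f j) (B j) r s E ys"
      using D(1) unfolding ultra_def by blast
    have "fat_shattered (f j) (B j) r s ys"
      unfolding fat_shattered_def
    proof
      fix E
      have "pattern (f j) (B j) r s (E \<inter> {..<length ys}) ys" using ys by auto
      then show "pattern (f j) (B j) r s E ys" unfolding pattern_Int .
    qed
    with K ys show False by blast
  qed
  show ?thesis
  proof (rule that[OF y])
    fix j b assume j: "j \<in> J" "b \<in> B j"
    note l = order_tendstoD[OF lim[OF j]]
    show "(\<lambda>n. f j b (y n)) \<longlonglongrightarrow> l j b"
    proof (rule order_tendstoI)
      \<comment> \<open>Almost all points give values above \<open>s\<close>, and the failing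
        members of the sequence give values below \<open>r\<close>; in the second case the two roles
        are exchanged.\<close>
      fix a assume "a < l j b"
      then obtain s where s: "s \<in> \<rat>" "a < s" "s < l j b" using Rats_dense_in_real by blast
      then obtain r where r: "r \<in> \<rat>" "a < r" "r < s" using Rats_dense_in_real by blast
      show "eventually (\<lambda>n. a < f j b (y n)) sequentially"
      proof (rule ccontr)
        assume "\<not> eventually (\<lambda>n. a < f j b (y n)) sequentially"
        then have "frequently (\<lambda>n. \<not> a < f j b (y n)) sequentially"
          by (simp add: not_eventually)
        then have "frequently (\<lambda>n. f j b (y n) < r) sequentially"
          by (rule frequently_elim1) (use r in auto)
        with l(1)[OF s(3)] show False
          by (intro key[OF j r(3) r(1) s(1)], case_tac v) simp_all
      qed
    next
      fix a assume "l j b < a"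
      then obtain r where r: "r \<in> \<rat>" "l j b < r" "r < a" using Rats_dense_in_real by blast
      then obtain s where s: "s \<in> \<rat>" "r < s" "s < a" using Rats_dense_in_real by blast
      show "eventually (\<lambda>n. f j b (y n) < a) sequentially"
      proof (rule ccontr)
        assume "\<not> eventually (\<lambda>n. f j b (y n) < a) sequentially"
        then have "frequently (\<lambda>n. \<not> f j b (y n) < a) sequentially"
          by (simp add: not_eventually)
        then have "frequently (\<lambda>n. s < f j b (y n)) sequentially"
          by (rule frequently_elim1) (use s in auto)
        with l(2)[OF r(2)] show False
          by (intro key[OF j s(2) r(1) s(1)], case_tac v) simp_all
      qed
    qed
  qed
qed

section \<open>Vapnik-Chervonenkis bounds\<close>

definition shattered_set :: "'a set set \<Rightarrow> 'a set \<Rightarrow> bool" where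
  "shattered_set T B \<longleftrightarrow> (\<forall>E\<subseteq>B. \<exists>S\<in>T. S \<inter> B = E)"

lemma shattered_set_mono: "shattered_set T B \<Longrightarrow> C \<subseteq> B \<Longrightarrow> shattered_set T C"
  unfolding shattered_set_def
proof (intro allI impI)
  fix E assume *: "\<forall>E\<subseteq>B. \<exists>S\<in>T. S \<inter> B = E" "C \<subseteq> B" "E \<subseteq> C"
  then obtain S where "S \<in> T" "S \<inter> B = E" by (meson order_trans)
  then show "\<exists>S\<in>T. S \<inter> C = E" using *(2,3) by blast
qed

text \<open>Pajor's form of the Sauer-Shelah lemma: comparing a family with the sets that it
  shatters makes the induction on the ground set work without binomial sums.\<close>

lemma card_le_shattered:
  assumes "finite A" "T \<subseteq> Pow A"
  shows "card T \<le> card {B. B \<subseteq> A \<and> shattered_set T B}"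
  using assms
proof (induction A arbitrary: T rule: finite_induct)
  case empty
  then have "T = {} \<or> T = {{}}" by auto
  then show ?case
  proof
    assume "T = {{}}"
    then have "{B. B \<subseteq> {} \<and> shattered_set T B} = {{}}" by (auto simp: shattered_set_def)
    then show ?thesis using \<open>T = {{}}\<close> by simp
  qed simp
next
  case (insert x A)
  \<comment> \<open>\<open>T0\<close> collects the traces on \<open>A\<close>, and \<open>T1\<close>
    those that belong to \<open>T\<close> both with and without \<open>x\<close>, so their sizes add
    up to that of \<open>T\<close>. A set shattered by \<open>T1\<close> remains shattered by
    \<open>T\<close> after adding \<open>x\<close>.\<close>
  define T0 where "T0 = (\<lambda>S. S - {x}) ` T"
  define T1 where "T1 = {S. S \<subseteq> A \<and> S \<in> T \<and> insert x S \<in> T}"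
  define Sh where "Sh T = {B. B \<subseteq> A \<and> shattered_set T B}" for T
  have fin: "finite T0" "finite T1"
    using insert.prems insert.hyps by (auto simp: T0_def T1_def intro: finite_subset[of _ "Pow A"]
      finite_subset[of _ "Pow (insert x A)"])
  have finT: "finite T" using insert.prems insert.hyps by (auto intro: finite_subset[of _ "Pow (insert x A)"])
  have T0: "T0 \<subseteq> Pow A" unfolding T0_def using insert.prems by blast
  have T1: "T1 \<subseteq> Pow A" unfolding T1_def by blast
  have "card T = card ({S\<in>T. x \<notin> S} \<union> {S\<in>T. x \<in> S})" by (rule arg_cong[where f = card]) auto
  also have "\<dots> = card {S\<in>T. x \<notin> S} + card {S\<in>T. x \<in> S}"
    using finT by (intro card_Un_disjoint) auto
  also have "card {S\<in>T. x \<in> S} = card ((\<lambda>S. S - {x}) ` {S\<in>T. x \<in> S})"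
    by (rule card_image[symmetric]) (auto simp: inj_on_def)
  also have "card {S\<in>T. x \<notin> S} + card ((\<lambda>S. S - {x}) ` {S\<in>T. x \<in> S}) =
      card ({S\<in>T. x \<notin> S} \<union> (\<lambda>S. S - {x}) ` {S\<in>T. x \<in> S}) +
      card ({S\<in>T. x \<notin> S} \<inter> (\<lambda>S. S - {x}) ` {S\<in>T. x \<in> S})"
    using finT by (intro card_Un_Int) auto
  also have "{S\<in>T. x \<notin> S} \<union> (\<lambda>S. S - {x}) ` {S\<in>T. x \<in> S} = T0"
  proof -
    have "S \<in> T0" if "S \<in> T" "x \<notin> S" for S
      unfolding T0_def using that by (intro image_eqI[of _ _ S]) auto
    moreover have "S - {x} \<in> {S\<in>T. x \<notin> S} \<union> (\<lambda>S. S - {x}) ` {S\<in>T. x \<in> S}" if "S \<in> T" for S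
      using that by (cases "x \<in> S") auto
    ultimately show ?thesis unfolding T0_def by blast
  qed
  also have "{S\<in>T. x \<notin> S} \<inter> (\<lambda>S. S - {x}) ` {S\<in>T. x \<in> S} = T1"
  proof -
    have "S - {x} \<in> T1" if "S \<in> T" "S - {x} \<in> T" "x \<in> S" for S
    proof -
      have "insert x (S - {x}) = S" using that by auto
      then show ?thesis using that insert.prems by (auto simp: T1_def)
    qed
    then have "{S\<in>T. x \<notin> S} \<inter> (\<lambda>S. S - {x}) ` {S\<in>T. x \<in> S} \<subseteq> T1" by auto
    moreover have "S \<in> (\<lambda>S. S - {x}) ` {S\<in>T. x \<in> S}" "S \<in> T" "x \<notin> S" if "S \<in> T1" for S
      using that insert.hyps(2) unfolding T1_def
      by (auto intro!: image_eqI[of _ _ "insert x S"])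
    then have "T1 \<subseteq> {S\<in>T. x \<notin> S} \<inter> (\<lambda>S. S - {x}) ` {S\<in>T. x \<in> S}"
      unfolding subset_iff by simp
    ultimately show ?thesis by (rule subset_antisym)
  qed
  finally have eq: "card T = card T0 + card T1" .
  have le0: "card T0 \<le> card (Sh T0)"
    unfolding Sh_def by (rule insert.IH[OF T0])
  have le1: "card T1 \<le> card (Sh T1)"
    unfolding Sh_def by (rule insert.IH[OF T1])
  have "card (Sh T1) = card (insert x ` Sh T1)"
    using insert.hyps by (intro card_image[symmetric]) (auto simp: inj_on_def Sh_def)
  then have "card (Sh T0) + card (Sh T1) = card (Sh T0) + card (insert x ` Sh T1)" by simp
  also have "\<dots> = card (Sh T0 \<union> insert x ` Sh T1)"
    using insert.hyps by (intro card_Un_disjoint[symmetric]) (auto simp: Sh_def)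
  also have "\<dots> \<le> card {B. B \<subseteq> insert x A \<and> shattered_set T B}"
  proof (intro card_mono)
    show "finite {B. B \<subseteq> insert x A \<and> shattered_set T B}" using insert.hyps by simp
    have "shattered_set T B" if B: "B \<subseteq> A" "shattered_set T0 B" for B
      unfolding shattered_set_def
    proof (intro allI impI)
      fix E assume "E \<subseteq> B"
      then obtain S where S: "S \<in> T" "(S - {x}) \<inter> B = E"
        using B(2) by (auto simp: shattered_set_def T0_def)
      then have "S \<inter> B = E" using B(1) insert.hyps by auto
      with S show "\<exists>S\<in>T. S \<inter> B = E" by blast
    qed
    moreover have "shattered_set T (insert x B)" if B: "B \<subseteq> A" "shattered_set T1 B" for B
      unfolding shattered_set_def
    proof (intro allI impI)
      fix E assume "E \<subseteq> insert x B"
      then have "E - {x} \<subseteq> B" by auto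
      then obtain S where S: "S \<in> T1" "S \<inter> B = E - {x}"
        using B(2) unfolding shattered_set_def by blast
      show "\<exists>S\<in>T. S \<inter> insert x B = E"
      proof (cases "x \<in> E")
        case True
        then show ?thesis using S B(1) insert.hyps
          by (intro bexI[of _ "insert x S"]) (auto simp: T1_def)
      next
        case False
        then show ?thesis using S B(1) insert.hyps
          by (intro bexI[of _ S]) (auto simp: T1_def)
      qed
    qed
    ultimately show "Sh T0 \<union> insert x ` Sh T1 \<subseteq> {B. B \<subseteq> insert x A \<and> shattered_set T B}"
      by (auto simp: Sh_def)
  qed
  finally show ?case using eq le0 le1 by linarith
qed

lemma card_small_subsets:
  "card {B. B \<subseteq> {..<K} \<and> card B < d} \<le> (K + 1) ^ d"
proof -
  have "{B. B \<subseteq> {..<K} \<and> card B < d} \<subseteq>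
      (\<lambda>xs. set xs - {K}) ` {xs. set xs \<subseteq> {..K} \<and> length xs = d}"
  proof
    fix B assume "B \<in> {B. B \<subseteq> {..<K} \<and> card B < d}"
    then have B: "B \<subseteq> {..<K}" "card B < d" "finite B" by (auto intro: finite_subset)
    \<comment> \<open>The symbol \<open>K\<close> pads the listing of \<open>B\<close> to length
      \<open>d\<close>. As \<open>card B < d\<close> it really occurs, and it is removed again by
      the map.\<close>
    define xs where "xs = sorted_list_of_set B @ replicate (d - card B) K"
    have "length xs = d" "set xs = insert K B" using B by (auto simp: xs_def)
    then show "B \<in> (\<lambda>xs. set xs - {K}) ` {xs. set xs \<subseteq> {..K} \<and> length xs = d}"
      using B(1) by (intro image_eqI[of _ _ xs]) auto
  qed
  then have "card {B. B \<subseteq> {..<K} \<and> card B < d} \<le>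
      card ((\<lambda>xs. set xs - {K}) ` {xs. set xs \<subseteq> {..K} \<and> length xs = d})"
    by (intro card_mono finite_imageI finite_lists_length_eq) auto
  also have "\<dots> \<le> card {xs. set xs \<subseteq> {..K} \<and> length xs = d}"
    by (intro card_image_le finite_lists_length_eq) auto
  also have "\<dots> = (K + 1) ^ d" by (subst card_lists_length_eq) auto
  finally show ?thesis .
qed

lemma sauer_shelah:
  assumes "T \<subseteq> Pow {..<K}" "\<And>B. B \<subseteq> {..<K} \<Longrightarrow> card B = d \<Longrightarrow> \<not> shattered_set T B"
  shows "card T \<le> (K + 1) ^ d"
proof -
  have "card T \<le> card {B. B \<subseteq> {..<K} \<and> shattered_set T B}"
    using assms by (intro card_le_shattered) auto
  also have "\<dots> \<le> card {B. B \<subseteq> {..<K} \<and> card B < d}"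
  proof (intro card_mono subsetI)
    fix B assume "B \<in> {B. B \<subseteq> {..<K} \<and> shattered_set T B}"
    then have B: "B \<subseteq> {..<K}" "shattered_set T B" by auto
    then have "finite B" by (auto intro: finite_subset)
    have "card B < d"
    proof (rule ccontr)
      assume "\<not> card B < d"
      then obtain C where "C \<subseteq> B" "card C = d" by (meson not_less obtain_subset_with_card_n)
      with assms(2)[of C] shattered_set_mono[OF B(2)] B(1) show False by auto
    qed
    then show "B \<in> {B. B \<subseteq> {..<K} \<and> card B < d}" using B by auto
  qed auto
  also have "\<dots> \<le> (K + 1) ^ d" by (rule card_small_subsets)
  finally show ?thesis .
qed

text \<open>VC dimension below \<open>d\<close>; a list shattered in this sense has distinct
  entries.\<close>

definition vc_bounded :: "('a \<Rightarrow> 'b \<Rightarrow> bool) \<Rightarrow> 'b set \<Rightarrow> 'a set \<Rightarrow> nat \<Rightarrow> bool" where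
  "vc_bounded H B X d \<longleftrightarrow>
     \<not> (\<exists>xs. set xs \<subseteq> X \<and> length xs = d \<and> (\<forall>E. \<exists>b\<in>B. \<forall>i<d. H (xs ! i) b \<longleftrightarrow> i \<in> E))"

definition avg :: "'a list \<Rightarrow> ('a \<Rightarrow> bool) \<Rightarrow> real" where
  "avg ys P = real (length (filter P ys)) / real (length ys)"

lemma avg_nonneg: "0 \<le> avg ys P" and avg_le_1: "avg ys P \<le> 1"
  by (auto simp: avg_def divide_le_eq)

lemma avg_sum: "avg ys P = (\<Sum>l<length ys. of_bool (P (ys ! l))) / real (length ys)"
proof -
  have "real (length (filter P ys)) = (\<Sum>l<length ys. of_bool (P (ys ! l)))"
    by (simp add: length_filter_conv_card of_bool_def sum.If_cases Int_def)
  then show ?thesis by (simp add: avg_def)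
qed

text \<open>Sauer-Shelah for sets of indices instead of points, because the points
  \<open>x i\<close> may coincide.\<close>

lemma vc_bounded_traces:
  assumes vc: "vc_bounded H B X d" and x: "\<And>i. i < K \<Longrightarrow> x i \<in> X"
    and T: "T \<subseteq> (\<lambda>b. {i. i < K \<and> H (x i) b}) ` B"
  shows "card T \<le> (K + 1) ^ d"
proof (rule sauer_shelah)
  show "T \<subseteq> Pow {..<K}" using T by auto
  fix C assume C: "C \<subseteq> {..<K}" "card C = d"
  have finC: "finite C" using C by (auto intro: finite_subset)
  show "\<not> shattered_set T C"
  proof
    assume sh: "shattered_set T C"
    define cs where "cs = sorted_list_of_set C"
    have cs: "set cs = C" "length cs = d" "distinct cs" using C finC by (auto simp: cs_def)
    have "\<exists>b\<in>B. \<forall>i<d. H (map x cs ! i) b \<longleftrightarrow> i \<in> E" for E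
    proof -
      have "(!) cs ` (E \<inter> {..<d}) \<subseteq> C" using cs by (auto simp: set_conv_nth)
      then obtain S where "S \<in> T" "S \<inter> C = (!) cs ` (E \<inter> {..<d})"
        using sh unfolding shattered_set_def by blast
      then obtain b where b: "b \<in> B" "{i. i < K \<and> H (x i) b} \<inter> C = (!) cs ` (E \<inter> {..<d})"
        using T by blast
      have "H (map x cs ! i) b \<longleftrightarrow> i \<in> E" if i: "i < d" for i
      proof -
        have "cs ! i \<in> C" using cs i by (auto simp: set_conv_nth)
        moreover have "cs ! i < K" using \<open>cs ! i \<in> C\<close> C by auto
        ultimately have "H (x (cs ! i)) b \<longleftrightarrow> cs ! i \<in> (!) cs ` (E \<inter> {..<d})"
          using b(2) by blast
        also have "\<dots> \<longleftrightarrow> i \<in> E"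
          using cs i by (auto simp: nth_eq_iff_index_eq)
        finally show ?thesis using cs i by simp
      qed
      with b(1) show ?thesis by blast
    qed
    moreover have "set (map x cs) \<subseteq> X" using cs C x by auto
    ultimately show False using vc cs unfolding vc_bounded_def by (metis length_map)
  qed
qed

text \<open>The exponential moment of a Rademacher sum, with the expectation written as a sum over
  all sign choices \<open>E\<close>. It factors over the places, and
  \<open>exp v + exp (- v)\<close> is at most \<open>2 * exp (v^2)\<close> for \<open>v\<close>
  between 0 and 1.\<close>

lemma sum_Pow_exp_sign:
  fixes u :: real
  assumes "\<tau> \<subseteq> {..<K}" "0 \<le> u" "u \<le> 1"
  shows "(\<Sum>E\<in>Pow {..<K}. exp (u * (\<Sum>i\<in>\<tau>. if i \<in> E then 1 else - 1))) \<le> 2 ^ K * exp (real K * u\<^sup>2)"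
proof -
  \<comment> \<open>Places outside \<open>\<tau>\<close> get exponent 0, so that all
    \<open>K\<close> places contribute a factor, namely 2 there.\<close>
  define v where "v i = (if i \<in> \<tau> then u else 0)" for i
  have v: "0 \<le> v i" "v i \<le> u" for i using assms by (auto simp: v_def)
  have "exp (u * (\<Sum>i\<in>\<tau>. if i \<in> E then 1 else - 1)) =
      (\<Prod>i\<in>E. exp (v i)) * (\<Prod>i\<in>{..<K} - E. exp (- v i))" if "E \<in> Pow {..<K}" for E
  proof -
    have E: "E \<subseteq> {..<K}" "finite E" using that by (auto intro: finite_subset)
    have "u * (\<Sum>i\<in>\<tau>. if i \<in> E then 1 else - 1) = (\<Sum>i\<in>\<tau>. if i \<in> E then v i else - v i)"
      by (auto simp: sum_distrib_left v_def intro!: sum.cong)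
    also have "\<dots> = (\<Sum>i<K. if i \<in> E then v i else - v i)"
      using assms(1) by (intro sum.mono_neutral_left) (auto simp: v_def)
    also have "\<dots> = (\<Sum>i\<in>E. v i) + (\<Sum>i\<in>{..<K} - E. - v i)"
      using E by (subst sum.subset_diff[OF E(1)]) auto
    finally show ?thesis using E by (simp add: exp_add exp_sum exp_minus)
  qed
  then have "(\<Sum>E\<in>Pow {..<K}. exp (u * (\<Sum>i\<in>\<tau>. if i \<in> E then 1 else - 1))) =
      (\<Sum>E\<in>Pow {..<K}. (\<Prod>i\<in>E. exp (v i)) * (\<Prod>i\<in>{..<K} - E. exp (- v i)))"
    by (intro sum.cong) auto
  also have "\<dots> = (\<Prod>i<K. exp (v i) + exp (- v i))"
    by (subst prod_add) auto
  also have "\<dots> \<le> (\<Prod>i<K. 2 * exp (u\<^sup>2))"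
  proof (intro prod_mono conjI)
    fix i
    have "exp (v i) \<le> 1 + v i + (v i)\<^sup>2" using v[of i] assms by (intro exp_bound) auto
    moreover have "exp (- v i) \<le> 1 - v i + (v i)\<^sup>2"
    proof -
      \<comment> \<open>With \<open>v\<close> for \<open>v i\<close>, the product is
        \<open>1 + v^3\<close>.\<close>
      have "1 \<le> (1 - v i + (v i)\<^sup>2) * (1 + v i)"
        using v[of i] by (simp add: algebra_simps power2_eq_square power3_eq_cube)
      also have "\<dots> \<le> (1 - v i + (v i)\<^sup>2) * exp (v i)"
        using exp_ge_add_one_self[of "v i"] v[of i] assms by (intro mult_left_mono) auto
      finally show ?thesis by (simp add: exp_minus divide_simps mult.commute)
    qed
    moreover have "1 + (v i)\<^sup>2 \<le> exp ((v i)\<^sup>2)" by (rule exp_ge_add_one_self)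
    moreover have "exp ((v i)\<^sup>2) \<le> exp (u\<^sup>2)" using v[of i] by (auto intro: power_mono)
    ultimately show "exp (v i) + exp (- v i) \<le> 2 * exp (u\<^sup>2)" by linarith
  qed (auto intro: add_nonneg_nonneg)
  also have "\<dots> = 2 ^ K * exp (real K * u\<^sup>2)"
    by (simp add: power_mult_distrib exp_of_nat_mult)
  finally show ?thesis .
qed

text \<open>If averages over the lists \<open>ys i\<close> are shattered with gap \<open>s - r\<close>, one point can be chosen
  from each list so that membership in the witness of the pattern \<open>E\<close> still correlates with \<open>E\<close>.
  By an exponential moment bound on Rademacher sums this forces exponentially many traces on the
  chosen points.\<close>

lemma fat_shattered_many_traces:
  assumes sh: "\<And>E. E \<subseteq> {..<K} \<Longrightarrow>
      b E \<in> B \<and> (\<forall>i<K. if i \<in> E then s < avg (ys i) (\<lambda>a. H a (b E)) else avg (ys i) (\<lambda>a. H a (b E)) < r)"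
    and ne: "\<And>i. i < K \<Longrightarrow> ys i \<noteq> []"
    and rs: "r < s" "s - r \<le> 1"
  obtains x where "\<And>i. i < K \<Longrightarrow> x i \<in> set (ys i)"
    "exp (real K * (s - r)\<^sup>2 / 16) \<le> real (card ((\<lambda>E. {i. i < K \<and> H (x i) (b E)}) ` Pow {..<K}))"
proof -
  define \<sigma> where "\<sigma> E i = (if i \<in> E then 1 else - 1 :: real)" for E and i :: nat
  define g where "g i a = (\<Sum>E\<in>Pow {..<K}. \<sigma> E i * of_bool (H a (b E)))" for i a
  \<comment> \<open>The sum over all \<open>E\<close> of the lower bounds \<open>s\<close> (for
    \<open>i \<in> E\<close>) and \<open>- r\<close> (otherwise) given by shattering. Some point of
    each list does at least as well as the average of the list.\<close>
  define c where "c = (s - r) * 2 ^ K / 2"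
  have "\<exists>a\<in>set (ys i). c \<le> g i a" if i: "i < K" for i
  proof (rule ccontr)
    assume "\<not> ?thesis"
    then have less: "\<And>a. a \<in> set (ys i) \<Longrightarrow> g i a < c" by auto
    define n where "n = length (ys i)"
    have n: "0 < n" using ne[OF i] by (simp add: n_def)
    have "(\<Sum>l<n. g i (ys i ! l)) < (\<Sum>l<n. c)"
      using n less by (intro sum_strict_mono) (auto simp: n_def)
    then have "(\<Sum>l<n. g i (ys i ! l)) / n < c" using n by (simp add: divide_simps mult.commute)
    also have "(\<Sum>l<n. g i (ys i ! l)) =
        (\<Sum>E\<in>Pow {..<K}. \<sigma> E i * (\<Sum>l<n. of_bool (H (ys i ! l) (b E))))"
      unfolding g_def by (subst sum.swap) (simp only: sum_distrib_left)
    also have "\<dots> / n = (\<Sum>E\<in>Pow {..<K}. \<sigma> E i * avg (ys i) (\<lambda>a. H a (b E)))"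
      unfolding avg_sum n_def by (subst sum_divide_distrib) (simp only: times_divide_eq_right)
    finally have 1: "(\<Sum>E\<in>Pow {..<K}. \<sigma> E i * avg (ys i) (\<lambda>a. H a (b E))) < c" .
    have "(\<Sum>E\<in>Pow {..<K}. \<sigma> E i * avg (ys i) (\<lambda>a. H a (b E))) \<ge>
        (\<Sum>E\<in>Pow {..<K}. if i \<in> E then s else - r)"
    proof (rule sum_mono)
      fix E assume "E \<in> Pow {..<K}"
      then show "(if i \<in> E then s else - r) \<le> \<sigma> E i * avg (ys i) (\<lambda>a. H a (b E))"
        using sh[of E] i by (auto simp: \<sigma>_def dest!: spec[of _ i])
    qed
    moreover have "(\<Sum>E\<in>Pow {..<K}. if i \<in> E then s else - r) = c"
    proof -
      define A where "A = {..<K} - {i}"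
      have A: "{..<K} = insert i A" "i \<notin> A" "finite A" "card A = K - 1" using i by (auto simp: A_def)
      have "(\<Sum>E\<in>Pow {..<K}. if i \<in> E then s else - r) =
         (\<Sum>E\<in>Pow A. if i \<in> E then s else - r) + (\<Sum>E\<in>insert i ` Pow A. if i \<in> E then s else - r)"
        unfolding A(1) Pow_insert using A by (intro sum.union_disjoint) auto
      also have "(\<Sum>E\<in>Pow A. if i \<in> E then s else - r) = (\<Sum>E\<in>Pow A. - r)"
        using A by (intro sum.cong) auto
      also have "(\<Sum>E\<in>insert i ` Pow A. if i \<in> E then s else - r) = (\<Sum>E\<in>insert i ` Pow A. s)"
        by (intro sum.cong) auto
      also have "card (insert i ` Pow A) = card (Pow A)"
        using A by (intro card_image) (auto simp: inj_on_def)
      then have "(\<Sum>E\<in>Pow A. - r) + (\<Sum>E\<in>insert i ` Pow A. s) = 2 ^ (K - 1) * (s - r)"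
        using A by (simp add: card_Pow algebra_simps)
      also have "\<dots> = c" using i by (cases K) (auto simp: c_def)
      finally show ?thesis .
    qed
    ultimately show False using 1 by linarith
  qed
  then obtain x where x: "\<And>i. i < K \<Longrightarrow> x i \<in> set (ys i)" "\<And>i. i < K \<Longrightarrow> c \<le> g i (x i)" by metis
  define \<tau> where "\<tau> E = {i. i < K \<and> H (x i) (b E)}" for E
  define T where "T = \<tau> ` Pow {..<K}"
  define z where "z E = (\<Sum>i\<in>\<tau> E. \<sigma> E i)" for E
  \<comment> \<open>This \<open>u\<close> maximizes \<open>u * (K * (s - r) / 2) - K * u^2\<close>;
    the maximum \<open>K * (s - r)^2 / 16\<close> is the exponent of the conclusion.\<close>
  define u where "u = (s - r) / 4"
  define m where "m = u * (real K * (s - r) / 2)"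
  have z: "(\<Sum>E\<in>Pow {..<K}. z E) = (\<Sum>i<K. g i (x i))"
  proof -
    have "z E = (\<Sum>i<K. \<sigma> E i * of_bool (H (x i) (b E)))" for E
      unfolding z_def \<tau>_def
      by (rule sum.mono_neutral_cong_left) auto
    then show ?thesis unfolding g_def by (subst sum.swap) (rule sum.cong[OF refl])
  qed
  have "real K * c \<le> (\<Sum>E\<in>Pow {..<K}. z E)"
    unfolding z using sum_mono[of "{..<K}" "\<lambda>_. c" "\<lambda>i. g i (x i)"] x(2) by simp
  then have m: "2 ^ K * m \<le> (\<Sum>E\<in>Pow {..<K}. u * z E)"
  proof -
    assume "real K * c \<le> (\<Sum>E\<in>Pow {..<K}. z E)"
    then have "u * (real K * c) \<le> u * (\<Sum>E\<in>Pow {..<K}. z E)"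
      using rs by (intro mult_left_mono) (auto simp: u_def)
    then show ?thesis by (simp add: sum_distrib_left m_def c_def field_simps)
  qed
  \<comment> \<open>Jensen's inequality for \<open>exp\<close> through the tangent at
    \<open>m\<close>, a lower bound for the mean of \<open>u * z E\<close>.\<close>
  have "2 ^ K * exp m = (\<Sum>E\<in>Pow {..<K}. exp m)" by (simp add: card_Pow)
  also have "\<dots> \<le> (\<Sum>E\<in>Pow {..<K}. exp m * (1 + (u * z E - m)))"
  proof -
    have "0 \<le> exp m * ((\<Sum>E\<in>Pow {..<K}. u * z E) - 2 ^ K * m)" using m by simp
    then show ?thesis
      by (simp add: sum_distrib_left[symmetric] sum.distrib sum_subtractf card_Pow algebra_simps)
  qed
  also have "\<dots> \<le> (\<Sum>E\<in>Pow {..<K}. exp (u * z E))"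
  proof (rule sum_mono)
    fix E
    have "exp m * (1 + (u * z E - m)) \<le> exp m * exp (u * z E - m)"
      by (intro mult_left_mono exp_ge_add_one_self) auto
    then show "exp m * (1 + (u * z E - m)) \<le> exp (u * z E)" by (simp flip: exp_add)
  qed
  \<comment> \<open>The trace \<open>\<tau> E\<close> varies with \<open>E\<close>. Summing over all
    traces in \<open>T\<close> decouples the two, so that the moment bound applies, and brings in
    the factor \<open>card T\<close> that is to be estimated.\<close>
  also have "\<dots> \<le> (\<Sum>E\<in>Pow {..<K}. \<Sum>t\<in>T. exp (u * (\<Sum>i\<in>t. \<sigma> E i)))"
  proof (rule sum_mono)
    fix E assume "E \<in> Pow {..<K}"
    then have "\<tau> E \<in> T" by (auto simp: T_def)
    then show "exp (u * z E) \<le> (\<Sum>t\<in>T. exp (u * (\<Sum>i\<in>t. \<sigma> E i)))"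
      unfolding z_def by (intro member_le_sum) (auto simp: T_def)
  qed
  also have "\<dots> = (\<Sum>t\<in>T. \<Sum>E\<in>Pow {..<K}. exp (u * (\<Sum>i\<in>t. \<sigma> E i)))"
    by (rule sum.swap)
  also have "\<dots> \<le> (\<Sum>t\<in>T. 2 ^ K * exp (real K * u\<^sup>2))"
    unfolding \<sigma>_def using rs by (intro sum_mono sum_Pow_exp_sign) (auto simp: T_def \<tau>_def u_def)
  also have "\<dots> = 2 ^ K * (real (card T) * exp (real K * u\<^sup>2))" by simp
  finally have "exp m \<le> real (card T) * exp (real K * u\<^sup>2)" by simp
  then have "exp (m - real K * u\<^sup>2) \<le> real (card T)"
    by (simp add: exp_diff divide_le_eq)
  also have "m - real K * u\<^sup>2 = real K * (s - r)\<^sup>2 / 16"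
    by (simp add: m_def u_def power2_eq_square field_simps)
  finally show ?thesis
    using that[of x] x(1) by (simp add: T_def \<tau>_def)
qed

lemma poly_less_exp:
  fixes c :: real
  assumes "0 < c"
  shows "eventually (\<lambda>K :: nat. real ((K + 1) ^ d) < exp (real K * c)) sequentially"
proof -
  \<comment> \<open>Using \<open>K + 1\<close> in the exponent as well matches the polynomial and
    costs only the factor \<open>exp c\<close>, which the target \<open>c ^ d / exp c\<close>
    absorbs.\<close>
  have "filterlim (\<lambda>K :: nat. c * real (K + 1)) at_top sequentially"
    using assms by real_asymp
  from filterlim_compose[OF tendsto_power_div_exp_0 this]
  have "((\<lambda>K :: nat. (c * real (K + 1)) ^ d / exp (c * real (K + 1))) \<longlongrightarrow> 0) sequentially" .
  moreover have "0 < c ^ d / exp c" using assms by simp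
  ultimately have "eventually (\<lambda>K. (c * real (K + 1)) ^ d / exp (c * real (K + 1)) < c ^ d / exp c) sequentially"
    by (rule order_tendstoD(2))
  then show ?thesis
  proof (rule eventually_mono)
    fix K
    assume "(c * real (K + 1)) ^ d / exp (c * real (K + 1)) < c ^ d / exp c"
    then have "c ^ d * (real (K + 1) ^ d * exp c) < c ^ d * exp (c * real (K + 1))"
      by (simp add: divide_simps power_mult_distrib mult_ac)
    then have "real (K + 1) ^ d * exp c < exp (c * real (K + 1))"
      using assms by (simp add: mult_less_cancel_left_pos)
    also have "\<dots> = exp (real K * c) * exp c" by (simp add: exp_add[symmetric] algebra_simps)
    finally show "real ((K + 1) ^ d) < exp (real K * c)" by simp
  qed
qed

text \<open>A shattered list of \<open>K\<close> samples yields points with exponentially many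
  traces in \<open>K\<close>, but bounded VC dimension allows only polynomially many. The lengths of
  the samples do not enter.\<close>

lemma vc_bounded_imp_fat_bounded_avg:
  assumes vc: "vc_bounded H B X d"
  shows "fat_bounded (\<lambda>b ys. avg ys (\<lambda>a. H a b)) B {ys. ys \<noteq> [] \<and> set ys \<subseteq> X}"
  unfolding fat_bounded_def
proof (intro allI impI)
  fix r s :: real assume rs: "r < s"
  have "0 < (s - r)\<^sup>2 / 16" using rs by simp
  then obtain K0 where K0: "\<And>K. K \<ge> K0 \<Longrightarrow> real ((K + 1) ^ d) < exp (real K * ((s - r)\<^sup>2 / 16))"
    using poly_less_exp[of "(s - r)\<^sup>2 / 16" d] by (auto simp: eventually_sequentially)
  \<comment> \<open>As \<open>K\<close> is positive, the patterns \<open>{0}\<close> and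
    \<open>{}\<close> at place 0 force both thresholds to lie strictly between 0 and 1.\<close>
  define K where "K = Suc K0"
  have "\<not> fat_shattered (\<lambda>b ys. avg ys (\<lambda>a. H a b)) B r s ys"
    if ys: "set ys \<subseteq> {ys. ys \<noteq> [] \<and> set ys \<subseteq> X}" "length ys = K" for ys
  proof
    assume sh: "fat_shattered (\<lambda>b ys. avg ys (\<lambda>a. H a b)) B r s ys"
    then obtain b where b: "\<And>E. b E \<in> B" "\<And>E i. i < K \<Longrightarrow>
       if i \<in> E then s < avg (ys ! i) (\<lambda>a. H a (b E)) else avg (ys ! i) (\<lambda>a. H a (b E)) < r"
      unfolding fat_shattered_def pattern_def ys(2) by metis
    have "s < 1" using b(2)[of 0 "{0}"] avg_le_1[of "ys ! 0" "\<lambda>a. H a (b {0})"]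
      by (simp add: K_def)
    moreover have "0 < r" using b(2)[of 0 "{}"] avg_nonneg[of "ys ! 0" "\<lambda>a. H a (b {})"]
      by (simp add: K_def)
    ultimately have "s - r \<le> 1" by linarith
    have ysi: "ys ! i \<noteq> []" "set (ys ! i) \<subseteq> X" if "i < K" for i
      using ys that by (auto simp: set_conv_nth)
    have bE: "b E \<in> B \<and> (\<forall>i<K. if i \<in> E then s < avg (ys ! i) (\<lambda>a. H a (b E))
        else avg (ys ! i) (\<lambda>a. H a (b E)) < r)" if "E \<subseteq> {..<K}" for E
      using b by blast
    obtain x where x: "\<And>i. i < K \<Longrightarrow> x i \<in> set (ys ! i)"
      "exp (real K * (s - r)\<^sup>2 / 16) \<le> real (card ((\<lambda>E. {i. i < K \<and> H (x i) (b E)}) ` Pow {..<K}))"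
      using fat_shattered_many_traces[OF bE ysi(1) rs \<open>s - r \<le> 1\<close>, of thesis] that by blast
    have "card ((\<lambda>E. {i. i < K \<and> H (x i) (b E)}) ` Pow {..<K}) \<le> (K + 1) ^ d"
      using b(1) by (intro vc_bounded_traces[OF vc, where x = x] subsetD[OF ysi(2) x(1)]) auto
    then have "exp (real K * (s - r)\<^sup>2 / 16) \<le> real ((K + 1) ^ d)"
      using x(2) by (meson of_nat_le_iff order_trans)
    with K0[of K] show False by (simp add: K_def)
  qed
  then show "\<exists>K. \<forall>ys. set ys \<subseteq> {ys. ys \<noteq> [] \<and> set ys \<subseteq> X} \<and> length ys = K \<longrightarrow>
      \<not> fat_shattered (\<lambda>b ys. avg ys (\<lambda>a. H a b)) B r s ys" by blast
qed

section \<open>Oscillation\<close>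

text \<open>The length of the greedy match of the pattern \<open>E\<close> is a potential that counts crossings of
  \<open>[r, s]\<close>: every crossing increases it, whatever the next symbol of \<open>E\<close> is, and it stays below \<open>K\<close>
  if \<open>f\<close> omits \<open>E\<close> on all increasing sequences of \<open>K\<close> places.\<close>

primrec matched :: "nat set \<Rightarrow> (nat \<Rightarrow> real) \<Rightarrow> real \<Rightarrow> real \<Rightarrow> nat \<Rightarrow> nat" where
  "matched E f r s 0 = 0"
| "matched E f r s (Suc n) =
     (if (if matched E f r s n \<in> E then s < f n else f n < r)
      then Suc (matched E f r s n) else matched E f r s n)"

lemma mono_matched: "m \<le> n \<Longrightarrow> matched E f r s m \<le> matched E f r s n"
  by (rule lift_Suc_mono_le) auto

lemma matched_crossing:
  assumes "t < t'" and "f t < r \<and> s < f t' \<or> s < f t \<and> f t' < r" and "r < s"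
  shows "matched E f r s t < matched E f r s (Suc t')"
proof (rule ccontr)
  assume "\<not> ?thesis"
  then have *: "matched E f r s (Suc t') \<le> matched E f r s t" by simp
  \<comment> \<open>Without an increase the same symbol of \<open>E\<close> is awaited at
    \<open>t\<close> and at \<open>t'\<close>, and one of the two values matches it.\<close>
  have 1: "matched E f r s n = matched E f r s t" if "t \<le> n" "n \<le> Suc t'" for n
    using mono_matched[OF that(1), of E f r s] mono_matched[OF that(2), of E f r s] * by simp
  have "matched E f r s (Suc t) = matched E f r s t" "matched E f r s t' = matched E f r s t"
    "matched E f r s (Suc t') = matched E f r s t"
    using assms(1) by (intro 1; simp)+
  then show False using assms(2,3) by (simp split: if_splits)
qed

lemma matched_times:
  "\<exists>ts. sorted_wrt (<) ts \<and> set ts \<subseteq> {..<n} \<and> length ts = matched E f r s n \<and>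
     (\<forall>i<length ts. if i \<in> E then s < f (ts ! i) else f (ts ! i) < r)"
proof (induction n)
  case 0
  show ?case by (intro exI[of _ "[]"]) simp
next
  case (Suc n)
  then obtain ts where ts: "sorted_wrt (<) ts" "set ts \<subseteq> {..<n}" "length ts = matched E f r s n"
     "\<forall>i<length ts. if i \<in> E then s < f (ts ! i) else f (ts ! i) < r" by blast
  show ?case
  proof (cases "if matched E f r s n \<in> E then s < f n else f n < r")
    case True
    have "\<forall>i<length (ts @ [n]). if i \<in> E then s < f ((ts @ [n]) ! i) else f ((ts @ [n]) ! i) < r"
      using ts(3,4) True by (auto simp: nth_append less_Suc_eq)
    then show ?thesis
      using ts True by (intro exI[of _ "ts @ [n]"]) (auto simp: sorted_wrt_append)
  next
    case False
    then show ?thesis using ts by (intro exI[of _ ts]) auto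
  qed
qed

lemma matched_less:
  assumes "\<And>ts. sorted_wrt (<) ts \<Longrightarrow> length ts = K \<Longrightarrow>
     \<exists>i<K. \<not> (if i \<in> E then s < f (ts ! i) else f (ts ! i) < r)"
  shows "matched E f r s n < K"
proof (rule ccontr)
  assume n: "\<not> ?thesis"
  obtain ts where ts: "sorted_wrt (<) ts" "length ts = matched E f r s n"
     "\<forall>i<length ts. if i \<in> E then s < f (ts ! i) else f (ts ! i) < r"
    using matched_times[of n E f r s] by blast
  have "sorted_wrt (<) (take K ts)" "length (take K ts) = K"
    using ts n by (auto simp: sorted_wrt_take)
  then obtain i where "i < K" "\<not> (if i \<in> E then s < f (take K ts ! i) else f (take K ts ! i) < r)"
    using assms by blast
  moreover from this(1) have "if i \<in> E then s < f (ts ! i) else f (ts ! i) < r"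
    using ts n by auto
  ultimately show False using \<open>i < K\<close> by (simp only: nth_take split: if_splits)
qed

text \<open>Hysteresis: \<open>track\<close> stays \<open>\<eta>\<close>-close to \<open>f\<close> but moves only when it has to, so that bounded
  oscillation of \<open>f\<close> gives bounded variation. For \<open>{0, 1}\<close>-valued \<open>f\<close> and \<open>\<eta> \<le> 1\<close> it is just \<open>f\<close> with a delay.\<close>

primrec track :: "real \<Rightarrow> (nat \<Rightarrow> real) \<Rightarrow> nat \<Rightarrow> real" where
  "track \<eta> f 0 = 0"
| "track \<eta> f (Suc n) = (if \<eta> \<le> \<bar>f n - track \<eta> f n\<bar> then f n else track \<eta> f n)"

text \<open>The delay pays off here: the value at \<open>n\<close> sees \<open>f\<close> only below
  \<open>n\<close>, which later makes it continuous in the type.\<close>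

lemma track_cong: "(\<And>i. i < n \<Longrightarrow> f i = g i) \<Longrightarrow> track \<eta> f n = track \<eta> g n"
  by (induction n) auto

lemma track_values: "track \<eta> f n \<in> insert 0 (range f)"
  by (induction n) auto

lemma track_close: "0 < \<eta> \<Longrightarrow> \<bar>f n - track \<eta> f (Suc n)\<bar> \<le> \<eta>"
  by auto

definition jumps :: "real \<Rightarrow> (nat \<Rightarrow> real) \<Rightarrow> nat set" where
  "jumps \<eta> f = {n. track \<eta> f (Suc n) \<noteq> track \<eta> f n}"

lemma track_const:
  assumes "m \<le> n" "\<And>i. m \<le> i \<Longrightarrow> i < n \<Longrightarrow> i \<notin> jumps \<eta> f"
  shows "track \<eta> f n = track \<eta> f m"
  using assms
proof (induction n rule: dec_induct)
  case (step n)
  then have "track \<eta> f (Suc n) = track \<eta> f n" by (force simp: jumps_def)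
  then show ?case using step by auto
qed simp

text \<open>Between two jumps \<open>track\<close> rests at the value \<open>f t\<close> taken at
  the first one, and it leaves that value only for a change of at least
  \<open>\<eta>\<close>.\<close>

lemma consecutive_jumps:
  assumes "t \<in> jumps \<eta> f" "t' \<in> jumps \<eta> f" "t < t'" "\<And>i. t < i \<Longrightarrow> i < t' \<Longrightarrow> i \<notin> jumps \<eta> f"
  shows "\<eta> \<le> \<bar>f t' - f t\<bar>"
proof -
  have "track \<eta> f t' = track \<eta> f (Suc t)"
    using assms by (intro track_const) auto
  also have "\<dots> = f t" using assms(1) by (auto simp: jumps_def split: if_splits)
  finally show ?thesis using assms(2) by (auto simp: jumps_def split: if_splits)
qed

text \<open>The first grid point beyond \<open>u\<close> starts a full cell; a length of three cells
  leaves room for strict inequalities at both ends.\<close>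

lemma crossed_cell:
  fixes u v :: real and N :: nat
  assumes "0 \<le> u" "v \<le> 1" "3 / N \<le> v - u" "0 < N"
  obtains j where "j < N" "u < j / N" "(j + 1) / N < v"
proof -
  define j where "j = Suc (nat \<lfloor>u * N\<rfloor>)"
  have "real (nat \<lfloor>u * N\<rfloor>) = of_int \<lfloor>u * N\<rfloor>" using assms by simp
  then have "real (nat \<lfloor>u * N\<rfloor>) \<le> u * N" "u * N < real (nat \<lfloor>u * N\<rfloor>) + 1"
    by linarith+
  then have j: "u * N < j" "j \<le> u * N + 1" unfolding j_def by linarith+
  have "3 \<le> (v - u) * N" using assms by (simp add: divide_simps)
  moreover have "v * N \<le> N" using assms mult_right_mono[of v 1 "real N"] by simp
  ultimately have "j + 1 < v * N" "real j < real N" using j by (auto simp: algebra_simps)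
  then show ?thesis using that[of j] j assms by (simp add: divide_simps)
qed

text \<open>Two consecutive jumps cross a cell of the grid of width \<open>1 / N\<close> and so
  raise the total potential of all cells. Jumps are counted in disjoint pairs, whence the factor
  2.\<close>

lemma card_jumps_le:
  assumes f: "\<And>n. 0 \<le> f n" "\<And>n. f n \<le> 1" and N: "0 < N" "3 / real N \<le> \<eta>"
    and K: "\<And>j ts. j < N \<Longrightarrow> sorted_wrt (<) ts \<Longrightarrow> length ts = K \<Longrightarrow>
       \<exists>i<K. \<not> (if i \<in> E j then (real j + 1) / N < f (ts ! i) else f (ts ! i) < real j / N)"
  shows "finite (jumps \<eta> f)" "card (jumps \<eta> f) \<le> 2 * (N * K) + 2"
proof -
  define \<Phi> where "\<Phi> n = (\<Sum>j<N. matched (E j) f (real j / N) ((real j + 1) / N) n)" for n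
  have mono: "\<Phi> m \<le> \<Phi> n" if "m \<le> n" for m n
    unfolding \<Phi>_def by (intro sum_mono mono_matched that)
  have step: "\<Phi> t < \<Phi> (Suc t')"
    if "t \<in> jumps \<eta> f" "t' \<in> jumps \<eta> f" "t < t'" "\<And>i. t < i \<Longrightarrow> i < t' \<Longrightarrow> i \<notin> jumps \<eta> f" for t t'
  proof -
    have "\<eta> \<le> \<bar>f t' - f t\<bar>" using that by (rule consecutive_jumps)
    then consider "3 / real N \<le> f t' - f t" | "3 / real N \<le> f t - f t'" using N by linarith
    then obtain j where j: "j < N"
      "f t < real j / N \<and> (real j + 1) / N < f t' \<or> (real j + 1) / N < f t \<and> f t' < real j / N"
    proof cases
      case 1
      then show ?thesis using crossed_cell[OF f(1) f(2) 1 N(1)] that by blast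
    next
      case 2
      then show ?thesis using crossed_cell[OF f(1) f(2) 2 N(1)] that by blast
    qed
    have "real j / N < (real j + 1) / N" using N by (simp add: divide_simps)
    note crossing = matched_crossing[OF that(3) j(2) this, of "E j"]
    show ?thesis unfolding \<Phi>_def
    proof (rule sum_strict_mono_ex1)
      show "\<forall>i\<in>{..<N}. matched (E i) f (real i / N) ((real i + 1) / N) t
          \<le> matched (E i) f (real i / N) ((real i + 1) / N) (Suc t')"
        using that(3) by (intro ballI mono_matched) simp
      show "\<exists>i\<in>{..<N}. matched (E i) f (real i / N) ((real i + 1) / N) t
          < matched (E i) f (real i / N) ((real i + 1) / N) (Suc t')"
        using j(1) crossing by blast
    qed simp
  qed
  have \<Phi>_le: "\<Phi> n \<le> N * K" for n
  proof -
    have "matched (E j) f (real j / N) ((real j + 1) / N) n \<le> K" if "j < N" for j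
      using matched_less[OF K[OF that], of n] by simp
    then have "\<Phi> n \<le> (\<Sum>j<N. K)" unfolding \<Phi>_def by (intro sum_mono) auto
    then show ?thesis by simp
  qed
  \<comment> \<open>The last two jumps are removed together: the crossing between them is charged to
    the growth of \<open>\<Phi>\<close> from \<open>t\<close> to \<open>n\<close>, and induction
    handles the jumps before \<open>t\<close>. The summand 2 covers the case of fewer than two
    jumps.\<close>
  have bound: "card (jumps \<eta> f \<inter> {..<n}) \<le> 2 * \<Phi> n + 2" for n
  proof (induction n rule: less_induct)
    case (less n)
    define J where "J = jumps \<eta> f \<inter> {..<n}"
    have finJ: "finite J" by (simp add: J_def)
    show ?case
    proof (cases "2 \<le> card J")
      case True
      define t' where "t' = Max J"
      have "J \<noteq> {}" using True by auto
      then have t': "t' \<in> J" "\<And>i. i \<in> J \<Longrightarrow> i \<le> t'" using finJ by (auto simp: t'_def)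
      define t where "t = Max (J - {t'})"
      have "card (J - {t'}) = card J - 1" using t'(1) by simp
      then have "card (J - {t'}) \<noteq> 0" using True by linarith
      then have ne: "J - {t'} \<noteq> {}" by (metis card.empty)
      have t: "t \<in> J - {t'}" unfolding t_def using finJ ne by (intro Max_in) auto
      have t_ge: "i \<le> t" if "i \<in> J" "i \<noteq> t'" for i
        unfolding t_def using finJ that by (intro Max_ge) auto
      have tt': "t < t'" using t t'(2)[of t] by auto
      have "t' < n" using t'(1) by (auto simp: J_def)
      have sub: "J \<subseteq> insert t' (insert t (jumps \<eta> f \<inter> {..<t}))"
      proof
        fix i assume i: "i \<in> J"
        then show "i \<in> insert t' (insert t (jumps \<eta> f \<inter> {..<t}))"
          using t_ge[of i] by (cases "i = t'"; cases "i = t") (auto simp: J_def)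
      qed
      have "\<Phi> t < \<Phi> (Suc t')"
      proof (rule step)
        fix i assume "t < i" "i < t'"
        then show "i \<notin> jumps \<eta> f" using t_ge[of i] \<open>t' < n\<close> by (auto simp: J_def)
      qed (use t t' tt' in \<open>auto simp: J_def\<close>)
      also have "\<dots> \<le> \<Phi> n" using \<open>t' < n\<close> by (intro mono) auto
      finally have "\<Phi> t < \<Phi> n" .
      moreover have "card J \<le> card (insert t' (insert t (jumps \<eta> f \<inter> {..<t})))"
        using sub by (intro card_mono) auto
      moreover have "\<dots> \<le> card (jumps \<eta> f \<inter> {..<t}) + 2"
        by (simp add: card_insert_if)
      moreover have "card (jumps \<eta> f \<inter> {..<t}) \<le> 2 * \<Phi> t + 2"
        using tt' \<open>t' < n\<close> by (intro less) auto
      ultimately show ?thesis unfolding J_def by linarith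
    qed (simp add: J_def)
  qed
  have bd: "card C \<le> 2 * (N * K) + 2" if C: "finite C" "C \<subseteq> jumps \<eta> f" for C
  proof -
    obtain n where n: "C \<subseteq> {..<n}" using C(1) unfolding finite_nat_iff_bounded by blast
    then have "card C \<le> card (jumps \<eta> f \<inter> {..<n})" using that by (intro card_mono) auto
    also have "\<dots> \<le> 2 * \<Phi> n + 2" by (rule bound)
    also have "\<dots> \<le> 2 * (N * K) + 2" using \<Phi>_le[of n] by simp
    finally show ?thesis .
  qed
  show fin: "finite (jumps \<eta> f)"
  proof (rule ccontr)
    assume "infinite (jumps \<eta> f)"
    then obtain C where "C \<subseteq> jumps \<eta> f" "finite C" "card C = 2 * (N * K) + 3"
      using infinite_arbitrarily_large by blast
    with bd[of C] show False by simp
  qed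
  show "card (jumps \<eta> f) \<le> 2 * (N * K) + 2" by (rule bd[OF fin]) simp
qed

text \<open>Finitely many jumps make \<open>track\<close> eventually constant, and each has size at
  most 1 because all values lie between 0 and 1. That \<open>l\<close> is 0 or a value of
  \<open>f\<close> keeps it 0-1 valued for 0-1 valued \<open>f\<close>.\<close>

lemma track_convergence:
  assumes f: "\<And>n. 0 \<le> f n" "\<And>n. f n \<le> 1" and \<eta>: "0 < \<eta>"
    and fin: "finite (jumps \<eta> f)" and card: "card (jumps \<eta> f) \<le> c"
  obtains l where "(\<lambda>n. track \<eta> f n) \<longlonglongrightarrow> l" "l \<in> insert 0 (range f)"
    "summable (\<lambda>n. \<bar>track \<eta> f (Suc n) - track \<eta> f n\<bar>)"
    "(\<Sum>n. \<bar>track \<eta> f (Suc n) - track \<eta> f n\<bar>) \<le> real c"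
    "\<And>L. f \<longlonglongrightarrow> L \<Longrightarrow> \<bar>L - l\<bar> \<le> \<eta>"
proof -
  obtain m where m: "jumps \<eta> f \<subseteq> {..<m}" using fin unfolding finite_nat_iff_bounded by blast
  define l where "l = track \<eta> f m"
  have l: "track \<eta> f n = l" if "m \<le> n" for n
    unfolding l_def using m that by (intro track_const) auto
  have lim: "(\<lambda>n. track \<eta> f n) \<longlonglongrightarrow> l"
    by (rule tendsto_eventually) (auto simp: eventually_sequentially intro!: exI[of _ m] l)
  have range: "0 \<le> track \<eta> f n \<and> track \<eta> f n \<le> 1" for n
    using track_values[of \<eta> f n] f by auto
  have zero: "\<bar>track \<eta> f (Suc n) - track \<eta> f n\<bar> = 0" if "n \<notin> jumps \<eta> f" for n
    using that by (simp add: jumps_def del: track.simps)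
  have "(\<Sum>n. \<bar>track \<eta> f (Suc n) - track \<eta> f n\<bar>) =
      (\<Sum>n\<in>jumps \<eta> f. \<bar>track \<eta> f (Suc n) - track \<eta> f n\<bar>)"
    using fin zero by (rule suminf_finite)
  also have "\<dots> \<le> (\<Sum>n\<in>jumps \<eta> f. 1)"
  proof (rule sum_mono)
    fix n
    show "\<bar>track \<eta> f (Suc n) - track \<eta> f n\<bar> \<le> 1"
      using range[of n] range[of "Suc n"] by linarith
  qed
  also have "\<dots> \<le> real c" using card by simp
  finally have sum: "(\<Sum>n. \<bar>track \<eta> f (Suc n) - track \<eta> f n\<bar>) \<le> real c" .
  have close: "\<bar>L - l\<bar> \<le> \<eta>" if "f \<longlonglongrightarrow> L" for L
  proof (rule tendsto_upperbound)
    show "(\<lambda>n. \<bar>f n - track \<eta> f (Suc n)\<bar>) \<longlonglongrightarrow> \<bar>L - l\<bar>"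
      using that lim LIMSEQ_Suc[OF lim] by (intro tendsto_intros)
    show "eventually (\<lambda>n. \<bar>f n - track \<eta> f (Suc n)\<bar> \<le> \<eta>) sequentially"
      using track_close[OF \<eta>] by (intro always_eventually allI)
  qed simp
  show ?thesis
  proof (rule that[OF lim _ _ sum close])
    show "l \<in> insert 0 (range f)" unfolding l_def by (rule track_values)
    show "summable (\<lambda>n. \<bar>track \<eta> f (Suc n) - track \<eta> f n\<bar>)"
      using fin zero by (rule summable_finite)
  qed
qed

section \<open>Subsequences omitting patterns\<close>

lemma ramsey_finite_colours:
  assumes "finite C" "\<And>X. card X = r \<Longrightarrow> col X \<in> C"
  obtains Y c where "infinite (Y :: nat set)" "\<And>X. X \<subseteq> Y \<Longrightarrow> finite X \<Longrightarrow> card X = r \<Longrightarrow> col X = c"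
proof -
  obtain g where g: "inj_on g C" "g ` C = {i. i < card C}"
    using finite_imp_nat_seg_image_inj_on[OF assms(1)] ex_bij_betw_finite_nat[OF assms(1)]
    by (metis atLeast0LessThan bij_betw_def lessThan_def)
  have "\<forall>X. X \<subseteq> (UNIV :: nat set) \<and> finite X \<and> card X = r \<longrightarrow> (g \<circ> col) X < card C"
    using assms(2) g(2) by auto
  from Ramsey[OF infinite_UNIV_nat this]
  obtain Y t where Y: "infinite Y" "\<And>X. X \<subseteq> Y \<Longrightarrow> finite X \<Longrightarrow> card X = r \<Longrightarrow> g (col X) = t"
    by auto
  have "col X = inv_into C g t" if "X \<subseteq> Y" "finite X" "card X = r" for X
    using Y(2)[OF that] assms(2)[OF that(3)] g(1) by (metis inv_into_f_f)
  with Y(1) show ?thesis by (rule that)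
qed

text \<open>Each \<open>K\<close>-tuple omits some pattern, but which one may vary. Ramsey's theorem
  makes the set of realized patterns constant along a subsequence, so that one pattern per cell is
  omitted everywhere, uniformly in \<open>b\<close>.\<close>

lemma subsequence_omitting_patterns:
  fixes f :: "'b \<Rightarrow> 'y \<Rightarrow> real" and y :: "nat \<Rightarrow> 'y"
  assumes fat: "fat_bounded f B Y" and y: "\<And>n. y n \<in> Y"
    and cells: "\<And>j. j < N \<Longrightarrow> r j < s j"
  shows "\<exists>(h :: nat \<Rightarrow> nat) E K. strict_mono h \<and>
    (\<forall>b\<in>B. \<forall>j<N. \<forall>ts. sorted_wrt (<) ts \<longrightarrow> length ts = K \<longrightarrow>
       (\<exists>i<K. \<not> (if i \<in> E j then s j < f b (y (h (ts ! i))) else f b (y (h (ts ! i))) < r (j :: nat))))"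
proof -
  have "\<exists>K. \<forall>ys. set ys \<subseteq> Y \<and> length ys = K \<longrightarrow> \<not> fat_shattered f B (r j) (s j) ys" if "j < N" for j
    using fat cells[OF that] unfolding fat_bounded_def by blast
  then obtain k where k: "\<And>j ys. j < N \<Longrightarrow> set ys \<subseteq> Y \<Longrightarrow> length ys = k j \<Longrightarrow>
      \<not> fat_shattered f B (r j) (s j) ys" by metis
  \<comment> \<open>Long enough for all cells at once, since initial segments of shattered lists are
    shattered.\<close>
  define K where "K = (\<Sum>j<N. k j)"
  have K: "\<not> fat_shattered f B (r j) (s j) ys" if "j < N" "set ys \<subseteq> Y" "length ys = K" for j ys
  proof
    assume sh: "fat_shattered f B (r j) (s j) ys"
    have "k j \<le> K" unfolding K_def using that(1) by (intro member_le_sum) auto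
    then have "length (take (k j) ys) = k j" "set (take (k j) ys) \<subseteq> Y"
      using that set_take_subset[of "k j" ys] by auto
    moreover have "fat_shattered f B (r j) (s j) (take (k j) ys)"
      using sh unfolding fat_shattered_def pattern_def
      by (elim all_forward bexE) (auto intro!: bexI)
    ultimately show False using k[OF that(1)] by blast
  qed
  define pat where "pat j E X \<longleftrightarrow> pattern f B (r j) (s j) E (map y (sorted_list_of_set X))" for j E X
  \<comment> \<open>Restricting \<open>E\<close> to subsets of \<open>{..<K}\<close> loses nothing
    and leaves finitely many colours.\<close>
  define col where "col X = {(j, E). j < N \<and> E \<subseteq> {..<K} \<and> pat j E X}" for X
  have "finite (Pow ({..<N} \<times> Pow {..<K}))" by simp
  from ramsey_finite_colours[OF this, of K col]
  obtain Z c where Z: "infinite Z" "\<And>X. X \<subseteq> Z \<Longrightarrow> finite X \<Longrightarrow> card X = K \<Longrightarrow> col X = c"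
    by (auto simp: col_def subset_iff split: prod.splits)
  obtain X0 where X0: "X0 \<subseteq> Z" "finite X0" "card X0 = K"
    using infinite_arbitrarily_large[OF Z(1)] by blast
  have "\<exists>E. (j, E) \<notin> c \<and> E \<subseteq> {..<K}" if j: "j < N" for j
  proof (rule ccontr)
    assume "\<not> ?thesis"
    then have all: "\<And>E. E \<subseteq> {..<K} \<Longrightarrow> (j, E) \<in> c" by blast
    define ys where "ys = map y (sorted_list_of_set X0)"
    have ys: "length ys = K" "set ys \<subseteq> Y" using X0 y by (auto simp: ys_def)
    have "fat_shattered f B (r j) (s j) ys"
      unfolding fat_shattered_def
    proof
      fix E
      have "(j, E \<inter> {..<K}) \<in> col X0" using all[of "E \<inter> {..<K}"] Z(2)[OF X0] by auto
      then have "pattern f B (r j) (s j) (E \<inter> {..<length ys}) ys"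
        unfolding ys(1) by (simp add: col_def pat_def ys_def)
      then show "pattern f B (r j) (s j) E ys" unfolding pattern_Int .
    qed
    with K[OF j ys(2,1)] show False by blast
  qed
  then obtain E where E: "\<And>j. j < N \<Longrightarrow> (j, E j) \<notin> c \<and> E j \<subseteq> {..<K}" by metis
  define h where "h = enumerate Z"
  have h: "strict_mono h" "\<And>n. h n \<in> Z"
    using Z(1) by (auto simp: h_def strict_mono_enumerate enumerate_in_set)
  show ?thesis
  proof (rule exI[of _ h], rule exI[of _ E], rule exI[of _ K], intro conjI ballI allI impI)
    show "strict_mono h" by (rule h(1))
    fix b j and ts :: "nat list"
    assume b: "b \<in> B" and j: "j < N" and ts: "sorted_wrt (<) ts" "length ts = K"
    define X where "X = h ` set ts"
    have "sorted_wrt (<) (map h ts)"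
      using ts(1) h(1) by (auto simp: sorted_wrt_map strict_mono_def elim: sorted_wrt_mono_rel[rotated])
    then have srt: "sorted (map h ts)" "distinct (map h ts)" by (auto simp: strict_sorted_iff)
    have X: "X \<subseteq> Z" "finite X" "sorted_list_of_set X = map h ts"
      using h(2) sorted_list_of_set.idem_if_sorted_distinct[OF srt] by (auto simp: X_def)
    have "card X = K" using srt(2) ts(2) by (metis X_def distinct_card length_map set_map)
    then have "(j, E j) \<notin> col X" using Z(2)[OF X(1,2)] E[OF j] by simp
    then have "\<not> pat j (E j) X" using E[OF j] j by (simp add: col_def)
    then obtain i where i: "i < length (map y (map h ts))"
      "\<not> (if i \<in> E j then s j < f b (map y (map h ts) ! i) else f b (map y (map h ts) ! i) < r j)"
      using b unfolding pat_def X(3) pattern_def by blast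
    moreover have "map y (map h ts) ! i = y (h (ts ! i))" using i by simp
    ultimately show "\<exists>i<K. \<not> (if i \<in> E j then s j < f b (y (h (ts ! i))) else f b (y (h (ts ! i))) < r j)"
      using ts(2) i by (intro exI[of _ i]) (simp only: length_map simp_thms)
  qed
qed

section \<open>Definable relations\<close>

lemma finite_term_vars: "finite (term_vars t)"
  by (induction t) auto

lemma finite_free_vars: "finite (free_vars \<phi>)"
  by (induction \<phi>) (auto simp: finite_term_vars)

lemma term_val_cong: "(\<And>i. i \<in> term_vars t \<Longrightarrow> s i = s' i) \<Longrightarrow> term_val S s t = term_val S s' t"
proof (induction t)
  case (App f ts)
  then have "map (term_val S s) ts = map (term_val S s') ts" by (intro map_cong) auto
  then show ?case by (simp only: term_val.simps)
qed auto

lemma sat_cong: "(\<And>i. i \<in> free_vars \<phi> \<Longrightarrow> s i = s' i) \<Longrightarrow> sat S s \<phi> = sat S s' \<phi>"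
proof (induction \<phi> arbitrary: s s')
  case (Eq t u)
  then have "term_val S s t = term_val S s' t" "term_val S s u = term_val S s' u"
    by (auto intro!: term_val_cong)
  then show ?case by simp
next
  case (Rel r ts)
  then have "map (term_val S s) ts = map (term_val S s') ts"
    by (intro map_cong refl term_val_cong) auto
  then show ?case by (simp only: sat.simps)
next
  case (Neg \<phi>)
  have "sat S s \<phi> = sat S s' \<phi>" by (rule Neg.IH) (use Neg.prems in simp)
  then show ?case by simp
next
  case (Conj \<phi> \<psi>)
  have "sat S s \<phi> = sat S s' \<phi>" by (rule Conj.IH(1)) (use Conj.prems in simp)
  moreover have "sat S s \<psi> = sat S s' \<psi>" by (rule Conj.IH(2)) (use Conj.prems in simp)
  ultimately show ?case by simp
next
  case (Ex i \<phi>)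
  have "sat S (s(i := a)) \<phi> = sat S (s'(i := a)) \<phi>" for a
    by (rule Ex.IH) (use Ex.prems in auto)
  then show ?case by simp
qed

section \<open>Renaming of variables\<close>

primrec ren_term :: "(nat \<Rightarrow> nat) \<Rightarrow> 'f fo_term \<Rightarrow> 'f fo_term" where
  "ren_term \<rho> (Var i) = Var (\<rho> i)"
| "ren_term \<rho> (App f ts) = App f (map (ren_term \<rho>) ts)"

text \<open>Lies above all images of free variables, so that renaming a bound variable to it causes
  no capture; \<open>insert 0\<close> provides a maximum when there are none.\<close>

definition fresh :: "(nat \<Rightarrow> nat) \<Rightarrow> ('f, 'r) fo_form \<Rightarrow> nat" where
  "fresh \<rho> \<phi> = Suc (Max (insert 0 (\<rho> ` free_vars \<phi>)))"

primrec ren :: "(nat \<Rightarrow> nat) \<Rightarrow> ('f, 'r) fo_form \<Rightarrow> ('f, 'r) fo_form" where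
  "ren \<rho> (Eq t u) = Eq (ren_term \<rho> t) (ren_term \<rho> u)"
| "ren \<rho> (Rel r ts) = Rel r (map (ren_term \<rho>) ts)"
| "ren \<rho> (Neg \<phi>) = Neg (ren \<rho> \<phi>)"
| "ren \<rho> (Conj \<phi> \<psi>) = Conj (ren \<rho> \<phi>) (ren \<rho> \<psi>)"
| "ren \<rho> (Ex i \<phi>) = Ex (fresh \<rho> \<phi>) (ren (\<rho>(i := fresh \<rho> \<phi>)) \<phi>)"

lemma fresh_neq: "i \<in> free_vars \<phi> \<Longrightarrow> \<rho> i \<noteq> fresh \<rho> \<phi>"
proof -
  assume "i \<in> free_vars \<phi>"
  then have "\<rho> i \<le> Max (insert 0 (\<rho> ` free_vars \<phi>))"
    by (intro Max_ge) (auto simp: finite_free_vars)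
  then show ?thesis by (simp add: fresh_def)
qed

lemma term_val_ren: "term_val S s (ren_term \<rho> t) = term_val S (s \<circ> \<rho>) t"
proof (induction t)
  case (App f ts)
  then have "map (term_val S s \<circ> ren_term \<rho>) ts = map (term_val S (s \<circ> \<rho>)) ts"
    by (intro map_cong) (auto simp: comp_def)
  then show ?case by (simp only: ren_term.simps term_val.simps map_map)
qed simp

lemma sat_ren: "sat S s (ren \<rho> \<phi>) = sat S (s \<circ> \<rho>) \<phi>"
proof (induction \<phi> arbitrary: s \<rho>)
  case (Rel r ts)
  have "map (term_val S s \<circ> ren_term \<rho>) ts = map (term_val S (s \<circ> \<rho>)) ts"
    by (intro map_cong) (auto simp: term_val_ren comp_def)
  then show ?case by (simp only: ren.simps sat.simps map_map)
next
  case (Ex i \<phi>)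
  have "sat S (s(fresh \<rho> \<phi> := a)) (ren (\<rho>(i := fresh \<rho> \<phi>)) \<phi>) = sat S ((s \<circ> \<rho>)(i := a)) \<phi>" for a
    unfolding Ex.IH by (rule sat_cong) (auto dest: fresh_neq)
  then show ?case by (simp only: ren.simps sat.simps)
qed (auto simp: term_val_ren comp_def)

lemma term_vars_ren: "term_vars (ren_term \<rho> t) = \<rho> ` term_vars t"
  by (induction t) auto

lemma free_vars_ren: "free_vars (ren \<rho> \<phi>) \<subseteq> \<rho> ` free_vars \<phi>"
proof (induction \<phi> arbitrary: \<rho>)
  case (Ex i \<phi>)
  have "free_vars (ren (\<rho>(i := fresh \<rho> \<phi>)) \<phi>) \<subseteq> (\<rho>(i := fresh \<rho> \<phi>)) ` free_vars \<phi>" by (rule Ex.IH)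
  then show ?case by (auto split: if_splits)
next
  case (Conj \<phi> \<psi>)
  show ?case unfolding ren.simps free_vars.simps image_Un by (rule Un_mono[OF Conj.IH])
qed (auto simp: term_vars_ren)

lemma wf_term_ren: "wf_term L t \<Longrightarrow> wf_term L (ren_term \<rho> t)"
  by (induction t) auto

lemma wf_ren: "wf_form L \<phi> \<Longrightarrow> wf_form L (ren \<rho> \<phi>)"
  by (induction \<phi> arbitrary: \<rho>) (auto simp: wf_term_ren)

section \<open>Closure properties of definable relations\<close>

lemma holds_Neg [simp]: "holds S (Neg \<phi>) as \<longleftrightarrow> \<not> holds S \<phi> as"
  and holds_Conj [simp]: "holds S (Conj \<phi> \<psi>) as \<longleftrightarrow> holds S \<phi> as \<and> holds S \<psi> as"
  by (auto simp: holds_def)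

lemma forms_Neg [simp]: "Neg \<phi> \<in> forms L n \<longleftrightarrow> \<phi> \<in> forms L n"
  and forms_Conj [simp]: "Conj \<phi> \<psi> \<in> forms L n \<longleftrightarrow> \<phi> \<in> forms L n \<and> \<psi> \<in> forms L n"
  by (auto simp: forms_def)

lemma tuples_nth: "as \<in> tuples A n \<Longrightarrow> i < n \<Longrightarrow> as ! i \<in> A"
  unfolding tuples_def using nth_mem by blast

lemma tuples_map: "(\<And>i. i < n \<Longrightarrow> f i \<in> A) \<Longrightarrow> map f [0..<n] \<in> tuples A n"
  by (auto simp: tuples_def)

text \<open>Treating definability as a property of relations lets the formulas needed for saturation
  be obtained from closure rules instead of being written out.\<close>

definition definable :: "('f, 'r) lang \<Rightarrow> ('f, 'r, 'a) fo_struct \<Rightarrow> nat \<Rightarrow> ('a list \<Rightarrow> bool) \<Rightarrow> bool" where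
  "definable L S n R \<longleftrightarrow> (\<exists>\<phi>\<in>forms L n. \<forall>as\<in>tuples (univ S) n. holds S \<phi> as \<longleftrightarrow> R as)"

lemma definable_holds: "\<phi> \<in> forms L n \<Longrightarrow> definable L S n (holds S \<phi>)"
  unfolding definable_def by blast

lemma definable_cong:
  "definable L S n R \<Longrightarrow> (\<And>as. as \<in> tuples (univ S) n \<Longrightarrow> R as \<longleftrightarrow> Q as) \<Longrightarrow> definable L S n Q"
  unfolding definable_def by auto

lemma definable_not: "definable L S n R \<Longrightarrow> definable L S n (\<lambda>as. \<not> R as)"
  unfolding definable_def by (metis forms_Neg holds_Neg)

lemma definable_conj:
  "definable L S n R \<Longrightarrow> definable L S n Q \<Longrightarrow> definable L S n (\<lambda>as. R as \<and> Q as)"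
  unfolding definable_def by (metis forms_Conj holds_Conj)

lemma definable_True:
  assumes "lang_struct L S"
  shows "definable L S n (\<lambda>_. True)"
proof -
  \<comment> \<open>A sentence, so that it lies in \<open>forms L n\<close> also for
    \<open>n = 0\<close>; it is true because the universe is nonempty.\<close>
  define \<phi> :: "('a, 'b) fo_form" where "\<phi> = Ex 0 (Eq (Var 0) (Var 0))"
  have "\<phi> \<in> forms L n" "\<And>as. holds S \<phi> as"
    using assms by (auto simp: \<phi>_def forms_def holds_def lang_struct_def)
  then show ?thesis unfolding definable_def by blast
qed

lemma definable_ball:
  assumes "lang_struct L S" "finite I" "\<And>i. i \<in> I \<Longrightarrow> definable L S n (R i)"
  shows "definable L S n (\<lambda>as. \<forall>i\<in>I. R i as)"
  using assms(2,3)
proof (induction I rule: finite_induct)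
  case (insert x F)
  then have "definable L S n (\<lambda>as. R x as \<and> (\<forall>i\<in>F. R i as))" by (intro definable_conj) auto
  then show ?case by simp
qed (simp add: definable_True[OF assms(1)])

text \<open>Covers permuting, identifying and adding variables at once.\<close>

lemma definable_subst:
  assumes "definable L S n R" "\<And>i. i < n \<Longrightarrow> \<rho> i < N"
  shows "definable L S N (\<lambda>as. R (map (\<lambda>i. as ! \<rho> i) [0..<n]))"
proof -
  obtain \<phi> where \<phi>: "\<phi> \<in> forms L n" "\<And>as. as \<in> tuples (univ S) n \<Longrightarrow> holds S \<phi> as \<longleftrightarrow> R as"
    using assms(1) unfolding definable_def by blast
  have fv: "free_vars \<phi> \<subseteq> {..<n}" using \<phi>(1) by (auto simp: forms_def)
  have "ren \<rho> \<phi> \<in> forms L N"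
    using \<phi>(1) assms(2) free_vars_ren[of \<rho> \<phi>] by (force simp: forms_def wf_ren)
  moreover have "holds S (ren \<rho> \<phi>) as \<longleftrightarrow> R (map (\<lambda>i. as ! \<rho> i) [0..<n])"
    if as: "as \<in> tuples (univ S) N" for as
  proof -
    have "holds S (ren \<rho> \<phi>) as \<longleftrightarrow> sat S ((!) as \<circ> \<rho>) \<phi>" by (simp add: holds_def sat_ren)
    also have "\<dots> \<longleftrightarrow> holds S \<phi> (map (\<lambda>i. as ! \<rho> i) [0..<n])"
      unfolding holds_def using fv by (intro sat_cong) auto
    also have "\<dots> \<longleftrightarrow> R (map (\<lambda>i. as ! \<rho> i) [0..<n])"
      by (intro \<phi>(2) tuples_map tuples_nth[OF as] assms(2))
    finally show ?thesis .
  qed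
  ultimately show ?thesis unfolding definable_def by blast
qed

lemma definable_ex:
  assumes "definable L S (Suc n) R"
  shows "definable L S n (\<lambda>as. \<exists>b\<in>univ S. R (as @ [b]))"
proof -
  obtain \<phi> where \<phi>: "\<phi> \<in> forms L (Suc n)" "\<And>as. as \<in> tuples (univ S) (Suc n) \<Longrightarrow> holds S \<phi> as \<longleftrightarrow> R as"
    using assms(1) unfolding definable_def by blast
  have "Ex n \<phi> \<in> forms L n" using \<phi>(1) by (auto simp: forms_def less_Suc_eq)
  moreover have "holds S (Ex n \<phi>) as \<longleftrightarrow> (\<exists>b\<in>univ S. R (as @ [b]))"
    if as: "as \<in> tuples (univ S) n" for as
  proof -
    have "sat S (((!) as)(n := b)) \<phi> \<longleftrightarrow> holds S \<phi> (as @ [b])" for b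
      unfolding holds_def using \<phi>(1) as
      by (intro sat_cong) (auto simp: forms_def tuples_def nth_append less_Suc_eq)
    moreover have "holds S \<phi> (as @ [b]) \<longleftrightarrow> R (as @ [b])" if "b \<in> univ S" for b
      using as that by (intro \<phi>(2)) (auto simp: tuples_def)
    ultimately show ?thesis by (simp add: holds_def)
  qed
  ultimately show ?thesis unfolding definable_def by blast
qed

lemma tuples_0 [simp]: "tuples A 0 = {[]}"
  by (auto simp: tuples_def)

lemma tuples_append: "as \<in> tuples A n \<Longrightarrow> bs \<in> tuples A m \<Longrightarrow> as @ bs \<in> tuples A (n + m)"
  by (auto simp: tuples_def)

lemma tuples_Suc: "cs \<in> tuples A (Suc m) \<longleftrightarrow> (\<exists>bs\<in>tuples A m. \<exists>b\<in>A. cs = bs @ [b])"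
  by (cases cs rule: rev_cases) (auto simp: tuples_def)

lemma definable_ex_tuple:
  assumes "definable L S (n + m) R"
  shows "definable L S n (\<lambda>as. \<exists>bs\<in>tuples (univ S) m. R (as @ bs))"
  using assms
proof (induction m arbitrary: R)
  case 0
  then show ?case by simp
next
  case (Suc m)
  then have "definable L S (n + m) (\<lambda>as. \<exists>b\<in>univ S. R (as @ [b]))" by (intro definable_ex) simp
  from Suc.IH[OF this] show ?case
    by (rule definable_cong) (auto simp: tuples_Suc, metis append.assoc)
qed

section \<open>Saturation\<close>

lemma countable_ordLess:
  assumes "countable A" "natLeq <o \<kappa>"
  shows "|A| <o \<kappa>"
proof -
  have "|A| \<le>o natLeq" using assms(1)
    by (metis card_of_nat card_of_ordLeqI countable_def ordLeq_ordIso_trans subset_UNIV iso_tuple_UNIV_I)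
  then show ?thesis using assms(2) by (rule ordLeq_ordLess_trans)
qed

locale sat_struct =
  fixes L :: "('f, 'r) lang" and U :: "('f, 'r, 'u) fo_struct" and \<kappa> :: "'c rel"
  assumes struct: "lang_struct L U" and saturated: "saturated \<kappa> L U" and uncountable: "natLeq <o \<kappa>"
begin

abbreviation "V \<equiv> tuples (univ U)"

lemma realize_type:
  assumes "countable C" "C \<subseteq> univ U" "\<Gamma> \<subseteq> pforms L C k"
    and "\<And>F. finite F \<Longrightarrow> F \<subseteq> \<Gamma> \<Longrightarrow> \<exists>a\<in>V k. \<forall>(\<phi>, c)\<in>F. holds U \<phi> (a @ c)"
  shows "\<exists>a\<in>V k. \<forall>(\<phi>, c)\<in>\<Gamma>. holds U \<phi> (a @ c)"
proof -
  have "consistent U k \<Gamma>"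
    unfolding consistent_def solutions_def using assms(4) by (force split: prod.splits)
  then have "\<exists>a\<in>V k. \<forall>\<phi>\<in>\<Gamma>. a \<in> solutions U k \<phi>"
    using saturated countable_ordLess[OF assms(1) uncountable] assms(2,3)
    unfolding saturated_def by blast
  then show ?thesis by (force simp: solutions_def)
qed

text \<open>In \<open>pforms\<close> parameters come last, whereas here the parameters
  \<open>a\<close> stand first in \<open>\<theta>\<close>. Hence the formula with its two blocks
  exchanged, negated or not according to \<open>v a\<close>; countably many tuples form a small
  parameter set.\<close>

lemma realize_pattern:
  assumes \<theta>: "\<theta> \<in> forms L (k + m)" and A: "A \<subseteq> V k" "countable A"
    and fin: "\<And>F. finite F \<Longrightarrow> F \<subseteq> A \<Longrightarrow> \<exists>b\<in>V m. \<forall>a\<in>F. holds U \<theta> (a @ b) \<longleftrightarrow> v a"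
  shows "\<exists>b\<in>V m. \<forall>a\<in>A. holds U \<theta> (a @ b) \<longleftrightarrow> v a"
proof -
  have "definable L U (m + k) (\<lambda>w. holds U \<theta> (map (\<lambda>i. w ! (if i < k then m + i else i - k)) [0..<k + m]))"
    by (rule definable_subst[OF definable_holds[OF \<theta>]]) auto
  then have "definable L U (m + k) (\<lambda>w. holds U \<theta> (drop m w @ take m w))"
  proof (rule definable_cong)
    fix w assume "w \<in> V (m + k)"
    then have "map (\<lambda>i. w ! (if i < k then m + i else i - k)) [0..<k + m] = drop m w @ take m w"
      by (intro nth_equalityI) (auto simp: tuples_def nth_append)
    then show "holds U \<theta> (map (\<lambda>i. w ! (if i < k then m + i else i - k)) [0..<k + m]) =
        holds U \<theta> (drop m w @ take m w)" by simp
  qed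
  then obtain \<phi> where \<phi>: "\<phi> \<in> forms L (m + k)"
    "\<And>w. w \<in> V (m + k) \<Longrightarrow> holds U \<phi> w \<longleftrightarrow> holds U \<theta> (drop m w @ take m w)"
    unfolding definable_def by blast
  have \<phi>': "holds U \<phi> (b @ a) \<longleftrightarrow> holds U \<theta> (a @ b)" if "a \<in> V k" "b \<in> V m" for a b
    using \<phi>(2)[of "b @ a"] that by (auto simp: tuples_def)
  define g where "g a = (if v a then \<phi> else Neg \<phi>, a)" for a
  have "\<exists>b\<in>V m. \<forall>(\<phi>, c)\<in>g ` A. holds U \<phi> (b @ c)"
  proof (rule realize_type)
    show "countable (\<Union>a\<in>A. set a)" using A(2) by (auto intro: countable_finite)
    show "(\<Union>a\<in>A. set a) \<subseteq> univ U" using A(1) by (auto simp: tuples_def)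
    show "g ` A \<subseteq> pforms L (\<Union>a\<in>A. set a) m"
      using A(1) \<phi>(1) by (auto simp: pforms_def g_def tuples_def subset_iff)
    fix F assume "finite F" "F \<subseteq> g ` A"
    then obtain F' where F': "finite F'" "F' \<subseteq> A" "F = g ` F'" by (meson finite_subset_image)
    then obtain b where b: "b \<in> V m" "\<forall>a\<in>F'. holds U \<theta> (a @ b) \<longleftrightarrow> v a" using fin by blast
    have "holds U (fst (g a)) (b @ a)" if "a \<in> F'" for a
      using b that F'(2) A(1) \<phi>'[of a b] by (auto simp: g_def)
    then show "\<exists>a\<in>V m. \<forall>(\<phi>, c)\<in>F. holds U \<phi> (a @ c)"
      using b(1) F'(3) by (intro bexI[of _ b]) (auto simp: g_def)
  qed
  then obtain b where b: "b \<in> V m" "\<forall>(\<phi>, c)\<in>g ` A. holds U \<phi> (b @ c)" by blast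
  have "holds U \<theta> (a @ b) \<longleftrightarrow> v a" if "a \<in> A" for a
    using b that A(1) \<phi>'[of a b] by (auto simp: g_def split: if_splits)
  with b(1) show ?thesis by blast
qed

section \<open>The independence property\<close>

text \<open>Formulas act on flat lists, so \<open>n\<close> tuples of length \<open>k\<close> are
  stored as one list of length \<open>n * k\<close>.\<close>

definition block :: "nat \<Rightarrow> 'u list \<Rightarrow> nat \<Rightarrow> 'u list" where
  "block k vs i = map (\<lambda>l. vs ! (i * k + l)) [0..<k]"

definition shat :: "nat \<Rightarrow> nat \<Rightarrow> ('f, 'r) fo_form \<Rightarrow> nat \<Rightarrow> 'u list \<Rightarrow> bool" where
  "shat k m \<theta> n vs \<longleftrightarrow> (\<forall>E\<in>Pow {..<n}. \<exists>b\<in>V m. \<forall>i\<in>{..<n}. holds U \<theta> (block k vs i @ b) \<longleftrightarrow> i \<in> E)"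

lemma block_index: "i < n \<Longrightarrow> l < k \<Longrightarrow> i * k + l < n * (k :: nat)"
proof -
  assume "i < n" "l < k"
  then have "i * k + l < Suc i * k" by simp
  also have "\<dots> \<le> n * k" using \<open>i < n\<close> by (intro mult_le_mono1) simp
  finally show ?thesis .
qed

lemma block_append: "n * k \<le> length vs \<Longrightarrow> i < n \<Longrightarrow> block k (vs @ ws) i = block k vs i"
  using block_index[of i n _ k] by (fastforce simp: block_def nth_append)

lemma block_in: "vs \<in> V (n * k) \<Longrightarrow> i < n \<Longrightarrow> block k vs i \<in> V k"
  unfolding block_def by (intro tuples_map tuples_nth[of vs _ "n * k"]) (simp_all add: block_index)

lemma block_concat:
  assumes "\<And>x. x \<in> set xs \<Longrightarrow> length x = k" "i < length xs"
  shows "block k (concat xs) i = xs ! i"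
  using assms
proof (induction xs arbitrary: i)
  case (Cons x xs)
  have lx: "length x = k" using Cons.prems by auto
  show ?case
  proof (cases i)
    case 0
    then show ?thesis using lx by (auto simp: block_def nth_append intro!: nth_equalityI)
  next
    case (Suc i')
    have "block k (concat (x # xs)) (Suc i') = block k (concat xs) i'"
      using lx by (auto simp: block_def nth_append)
    then show ?thesis using Cons Suc by auto
  qed
qed simp

text \<open>Only finitely many patterns are involved, so the existence of all their witnesses is a
  first-order condition.\<close>

lemma definable_shat:
  assumes "\<theta> \<in> forms L (k + m)"
  shows "definable L U (n * k) (shat k m \<theta> n)"
proof -
  have 1: "definable L U (n * k + m) (\<lambda>w. holds U \<theta> (block k w i @ drop (n * k) w))" if "i < n" for i
  proof -
    have "definable L U (n * k + m)
       (\<lambda>w. holds U \<theta> (map (\<lambda>l. w ! (if l < k then i * k + l else n * k + (l - k))) [0..<k + m]))"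
      using block_index[OF that, of _ k] by (intro definable_subst[OF definable_holds[OF assms]]) (auto intro: trans_less_add1)
    then show ?thesis
    proof (rule definable_cong)
      fix w assume "w \<in> V (n * k + m)"
      then have "map (\<lambda>l. w ! (if l < k then i * k + l else n * k + (l - k))) [0..<k + m] =
          block k w i @ drop (n * k) w"
        by (intro nth_equalityI) (auto simp: tuples_def nth_append block_def)
      then show "holds U \<theta> (map (\<lambda>l. w ! (if l < k then i * k + l else n * k + (l - k))) [0..<k + m]) =
          holds U \<theta> (block k w i @ drop (n * k) w)" by simp
    qed
  qed
  have "definable L U (n * k + m) (\<lambda>w. holds U \<theta> (block k w i @ drop (n * k) w) \<longleftrightarrow> i \<in> E)"
    if "i < n" for i E
    using 1[OF that] definable_not[OF 1[OF that]] by (cases "i \<in> E") auto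
  then have "definable L U (n * k + m)
      (\<lambda>w. \<forall>i\<in>{..<n}. holds U \<theta> (block k w i @ drop (n * k) w) \<longleftrightarrow> i \<in> E)" for E
    by (intro definable_ball[OF struct]) auto
  from definable_ex_tuple[OF this]
  have "definable L U (n * k) (\<lambda>w. \<forall>E\<in>Pow {..<n}. \<exists>b\<in>V m.
      \<forall>i\<in>{..<n}. holds U \<theta> (block k (w @ b) i @ drop (n * k) (w @ b)) \<longleftrightarrow> i \<in> E)"
    by (intro definable_ball[OF struct]) auto
  then show ?thesis
  proof (rule definable_cong)
    fix w assume w: "w \<in> V (n * k)"
    then have "block k (w @ b) i @ drop (n * k) (w @ b) = block k w i @ b" if "i < n" for b i
      using that block_append[of n k w i b] by (simp add: tuples_def)
    then show "(\<forall>E\<in>Pow {..<n}. \<exists>b\<in>V m.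
      \<forall>i\<in>{..<n}. holds U \<theta> (block k (w @ b) i @ drop (n * k) (w @ b)) \<longleftrightarrow> i \<in> E) = shat k m \<theta> n w"
      by (simp add: shat_def)
  qed
qed

lemma shat_prefix:
  assumes "shat k m \<theta> n' (vs @ ws)" "n \<le> n'" "vs \<in> V (n * k)"
  shows "shat k m \<theta> n vs"
  unfolding shat_def
proof
  fix E assume "E \<in> Pow {..<n}"
  then have "E \<in> Pow {..<n'}" using assms(2) by auto
  then obtain b where b: "b \<in> V m" "\<forall>i\<in>{..<n'}. holds U \<theta> (block k (vs @ ws) i @ b) \<longleftrightarrow> i \<in> E"
    using assms(1) unfolding shat_def by blast
  have "block k (vs @ ws) i = block k vs i" if "i < n" for i
    using assms(3) that by (intro block_append) (auto simp: tuples_def)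
  then have "\<forall>i\<in>{..<n}. holds U \<theta> (block k vs i @ b) \<longleftrightarrow> i \<in> E"
    using b(2) assms(2) by (metis lessThan_iff order_less_le_trans)
  with b(1) show "\<exists>b\<in>V m. \<forall>i\<in>{..<n}. holds U \<theta> (block k vs i @ b) \<longleftrightarrow> i \<in> E" by blast
qed

text \<open>\<open>c\<close> begins shattered lists of every finite length. Unlike mere shattering,
  this property passes to some extension by one more tuple.\<close>

definition extendible :: "nat \<Rightarrow> nat \<Rightarrow> ('f, 'r) fo_form \<Rightarrow> nat \<Rightarrow> 'u list \<Rightarrow> bool" where
  "extendible k m \<theta> n c \<longleftrightarrow> c \<in> V (n * k) \<and> (\<forall>N. \<exists>es\<in>V (N * k). shat k m \<theta> (n + N) (c @ es))"

lemma tuples_split: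
  assumes "w \<in> tuples A (n + m)"
  obtains u v where "u \<in> tuples A n" "v \<in> tuples A m" "w = u @ v"
proof (rule that)
  show "take n w \<in> tuples A n" "drop n w \<in> tuples A m" "w = take n w @ drop n w"
    using assms set_take_subset[of n w] set_drop_subset[of n w] by (auto simp: tuples_def)
qed

text \<open>For each \<open>N\<close>, having a shattered continuation by \<open>N\<close> tuples is
  a first-order condition on \<open>x\<close> over the entries of \<open>c\<close>. A larger
  \<open>N\<close> implies the smaller ones by truncation, so the conditions are finitely
  satisfiable, and saturation yields one \<open>x\<close> for all \<open>N\<close>.\<close>

lemma extendible_step:
  assumes \<theta>: "\<theta> \<in> forms L (k + m)" and ext: "extendible k m \<theta> n c"
  shows "\<exists>x\<in>V k. extendible k m \<theta> (Suc n) (c @ x)"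
proof -
  have c: "c \<in> V (n * k)" using ext by (simp add: extendible_def)
  define P where "P N x \<longleftrightarrow> (\<exists>es\<in>V (N * k). shat k m \<theta> (Suc n + N) (c @ x @ es))" for N x
  have "\<exists>\<phi>\<in>forms L (k + n * k). \<forall>x\<in>V k. holds U \<phi> (x @ c) \<longleftrightarrow> P N x" for N
  proof -
    \<comment> \<open>The variable \<open>x\<close> has to precede the parameters \<open>c\<close>;
      \<open>\<rho>\<close> turns \<open>x @ c @ es\<close> back into
      \<open>c @ x @ es\<close>.\<close>
    define \<rho> where "\<rho> l = (if l < n * k then l + k else if l < n * k + k then l - n * k else l)" for l
    define M where "M = (Suc n + N) * k"
    have "definable L U (k + n * k + N * k) (\<lambda>w. shat k m \<theta> (Suc n + N) (map (\<lambda>l. w ! \<rho> l) [0..<M]))"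
      unfolding M_def by (intro definable_subst[OF definable_shat[OF \<theta>]]) (auto simp: \<rho>_def algebra_simps)
    from definable_ex_tuple[OF this]
    obtain \<phi> where \<phi>: "\<phi> \<in> forms L (k + n * k)" "\<And>w. w \<in> V (k + n * k) \<Longrightarrow> holds U \<phi> w \<longleftrightarrow>
       (\<exists>es\<in>V (N * k). shat k m \<theta> (Suc n + N) (map (\<lambda>l. (w @ es) ! \<rho> l) [0..<M]))"
      unfolding definable_def by blast
    have "holds U \<phi> (x @ c) \<longleftrightarrow> P N x" if x: "x \<in> V k" for x
    proof -
      have eq: "map (\<lambda>l. ((x @ c) @ es) ! \<rho> l) [0..<M] = c @ x @ es" if "es \<in> V (N * k)" for es
      proof (rule nth_equalityI)
        show "length (map (\<lambda>l. ((x @ c) @ es) ! \<rho> l) [0..<M]) = length (c @ x @ es)"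
          using x c that by (simp add: tuples_def M_def algebra_simps)
        fix i assume "i < length (map (\<lambda>l. ((x @ c) @ es) ! \<rho> l) [0..<M])"
        then show "map (\<lambda>l. ((x @ c) @ es) ! \<rho> l) [0..<M] ! i = (c @ x @ es) ! i"
          using x c that by (auto simp: tuples_def nth_append \<rho>_def add.commute)
      qed
      have "holds U \<phi> (x @ c) \<longleftrightarrow>
         (\<exists>es\<in>V (N * k). shat k m \<theta> (Suc n + N) (map (\<lambda>l. ((x @ c) @ es) ! \<rho> l) [0..<M]))"
        by (rule \<phi>(2)[OF tuples_append[OF x c]])
      also have "\<dots> \<longleftrightarrow> P N x" unfolding P_def by (intro bex_cong refl) (simp only: eq)
      finally show ?thesis .
    qed
    with \<phi>(1) show ?thesis by blast
  qed
  then obtain \<phi> where \<phi>: "\<And>N. \<phi> N \<in> forms L (k + n * k)"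
    "\<And>N x. x \<in> V k \<Longrightarrow> holds U (\<phi> N) (x @ c) \<longleftrightarrow> P N x" by metis
  have "\<exists>x\<in>V k. \<forall>(\<phi>, c)\<in>range (\<lambda>N. (\<phi> N, c)). holds U \<phi> (x @ c)"
  proof (rule realize_type)
    show "countable (set c)" by (rule countable_finite) simp
    show "set c \<subseteq> univ U" using c by (auto simp: tuples_def)
    show "range (\<lambda>N. (\<phi> N, c)) \<subseteq> pforms L (set c) k"
      using c \<phi>(1) by (auto simp: pforms_def tuples_def)
    fix F assume "finite F" "F \<subseteq> range (\<lambda>N. (\<phi> N, c))"
    then obtain I where I: "finite I" "F = (\<lambda>N. (\<phi> N, c)) ` I" by (meson finite_subset_image)
    define N0 where "N0 = Max (insert 0 I)"
    have N0: "N \<le> N0" if "N \<in> I" for N using I(1) that by (simp add: N0_def)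
    obtain es0 where es0: "es0 \<in> V (Suc N0 * k)" "shat k m \<theta> (n + Suc N0) (c @ es0)"
      using ext unfolding extendible_def by blast
    have "es0 \<in> V (k + N0 * k)" using es0(1) by simp
    then obtain x es where x: "x \<in> V k" "es \<in> V (N0 * k)" "es0 = x @ es" by (rule tuples_split)
    have "P N x" if "N \<in> I" for N
    proof -
      have "es \<in> V (N * k + (N0 - N) * k)" using x(2) N0[OF that] by (simp add: add_mult_distrib[symmetric])
      then obtain e1 e2 where e: "e1 \<in> V (N * k)" "es = e1 @ e2" by (rule tuples_split)
      have "c @ x @ e1 \<in> V (n * k + (k + N * k))" by (intro tuples_append c x e)
      then have 1: "c @ x @ e1 \<in> V ((Suc n + N) * k)" by (simp add: algebra_simps)
      have 2: "shat k m \<theta> (n + Suc N0) ((c @ x @ e1) @ e2)" using es0(2) x(3) e(2) by simp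
      have "Suc n + N \<le> n + Suc N0" using N0[OF that] by simp
      from shat_prefix[OF 2 this 1] have "shat k m \<theta> (Suc n + N) (c @ x @ e1)" .
      then show ?thesis unfolding P_def using e(1) by blast
    qed
    then show "\<exists>x\<in>V k. \<forall>(\<phi>, c)\<in>F. holds U \<phi> (x @ c)"
      using x(1) \<phi>(2) I(2) by (intro bexI[of _ x]) auto
  qed
  then obtain x where x: "x \<in> V k" "\<And>N. P N x" using \<phi>(2) by auto
  have "c @ x \<in> V (Suc n * k)" using tuples_append[OF c x(1)] by (simp add: add.commute)
  with x have "extendible k m \<theta> (Suc n) (c @ x)"
    unfolding extendible_def P_def by simp
  with x(1) show ?thesis by blast
qed

text \<open>Iterated extension gives an infinite sequence whose finite parts are all shattered; a
  second use of saturation finds a parameter for each infinite \<open>I\<close>.\<close>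

lemma extendible_imp_IP:
  assumes \<theta>: "\<theta> \<in> forms L (k + m)" and ext: "extendible k m \<theta> 0 []"
  shows "has_IP U k m \<theta>"
proof -
  have "\<exists>C. \<forall>n. extendible k m \<theta> n (C n) \<and> (\<exists>x\<in>V k. C (Suc n) = C n @ x)"
  proof (rule dependent_nat_choice)
    show "\<exists>c. extendible k m \<theta> 0 c" using ext by blast
    show "\<exists>y. extendible k m \<theta> (Suc n) y \<and> (\<exists>x\<in>V k. y = c @ x)" if "extendible k m \<theta> n c" for c n
      using extendible_step[OF \<theta> that] by blast
  qed
  then obtain C where C: "\<And>n. extendible k m \<theta> n (C n)" "\<And>n. \<exists>x\<in>V k. C (Suc n) = C n @ x" by blast
  have CV: "C n \<in> V (n * k)" for n using C(1) by (simp add: extendible_def)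
  have shat: "shat k m \<theta> n (C n)" for n
    using C(1)[of n] unfolding extendible_def by (auto dest!: spec[of _ 0])
  define a where "a i = block k (C (Suc i)) i" for i
  have block: "block k (C n) i = a i" if "i < n" for i n
    using that
  proof (induction n)
    case (Suc n)
    show ?case
    proof (cases "i = n")
      case False
      then have "i < n" using Suc.prems by simp
      moreover obtain x where "C (Suc n) = C n @ x" using C(2) by blast
      moreover have "n * k \<le> length (C n)" using CV[of n] by (simp add: tuples_def)
      ultimately show ?thesis using Suc.IH block_append by metis
    qed (simp add: a_def)
  qed simp
  have aV: "a i \<in> V k" for i unfolding a_def by (rule block_in[OF CV]) simp
  have pat: "\<exists>b\<in>V m. \<forall>i<n. holds U \<theta> (a i @ b) \<longleftrightarrow> i \<in> E" for n E
  proof -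
    have "E \<inter> {..<n} \<in> Pow {..<n}" by simp
    then obtain b where b: "b \<in> V m" "\<forall>i\<in>{..<n}. holds U \<theta> (block k (C n) i @ b) \<longleftrightarrow> i \<in> E \<inter> {..<n}"
      using shat[of n] unfolding shat_def by blast
    then have "\<forall>i<n. holds U \<theta> (a i @ b) \<longleftrightarrow> i \<in> E" using block by simp
    with b(1) show ?thesis by blast
  qed
  \<comment> \<open>The pattern \<open>{i}\<close> separates \<open>a i\<close> from the other
    points. Distinctness matters because \<open>realize_pattern\<close> prescribes truth values per
    tuple and not per index.\<close>
  have inj: "i = j" if "a i = a j" for i j
  proof -
    obtain b where "\<forall>l<Suc (max i j). holds U \<theta> (a l @ b) \<longleftrightarrow> l \<in> {i}" using pat by blast
    then have "holds U \<theta> (a i @ b)" and j: "holds U \<theta> (a j @ b) \<longleftrightarrow> j = i" by (auto simp: less_Suc_eq_le)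
    from this(1) have "holds U \<theta> (a j @ b)" unfolding \<open>a i = a j\<close> .
    then show "i = j" unfolding j by (rule sym)
  qed
  have "\<exists>b\<in>V m. \<forall>i. holds U \<theta> (a i @ b) \<longleftrightarrow> i \<in> I" for I
  proof -
    have "\<exists>b\<in>V m. \<forall>x\<in>range a. holds U \<theta> (x @ b) \<longleftrightarrow> x \<in> a ` I"
    proof (rule realize_pattern[OF \<theta>])
      fix F assume "finite F" "F \<subseteq> range a"
      then obtain J where J: "finite J" "F = a ` J" by (meson finite_subset_image)
      obtain n where n: "J \<subseteq> {..<n}" using J(1) unfolding finite_nat_iff_bounded by blast
      obtain b where b: "b \<in> V m" "\<forall>i<n. holds U \<theta> (a i @ b) \<longleftrightarrow> i \<in> I" using pat by blast
      have "holds U \<theta> (x @ b) \<longleftrightarrow> x \<in> a ` I" if "x \<in> F" for x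
      proof -
        obtain i where i: "x = a i" "i < n" using \<open>x \<in> F\<close> J(2) n by auto
        have "a i \<in> a ` I \<longleftrightarrow> i \<in> I" using inj by auto
        then show ?thesis using b(2) i by simp
      qed
      with b(1) show "\<exists>b\<in>V m. \<forall>x\<in>F. holds U \<theta> (x @ b) \<longleftrightarrow> x \<in> a ` I" by blast
    qed (use aV in auto)
    then obtain b where b: "b \<in> V m" "\<And>i. holds U \<theta> (a i @ b) \<longleftrightarrow> a i \<in> a ` I" by auto
    have "a i \<in> a ` I \<longleftrightarrow> i \<in> I" for i using inj by auto
    with b show ?thesis by auto
  qed
  then obtain b where "\<And>I. b I \<in> V m" "\<And>I i. holds U \<theta> (a i @ b I) \<longleftrightarrow> i \<in> I" by metis
  then show ?thesis unfolding has_IP_def using aV by blast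
qed

text \<open>By compactness, arbitrarily long finite shattered lists would yield the infinite one in
  \<open>has_IP\<close>.\<close>

lemma NIP_imp_vc_bounded:
  assumes \<theta>: "\<theta> \<in> forms L (k + m)" and nip: "\<not> has_IP U k m \<theta>"
  shows "\<exists>d. vc_bounded (\<lambda>a b. holds U \<theta> (a @ b)) (V m) (V k) d"
proof (rule ccontr)
  assume unb: "\<not> ?thesis"
  have "\<exists>es\<in>V (N * k). shat k m \<theta> N es" for N
  proof -
    have "\<not> vc_bounded (\<lambda>a b. holds U \<theta> (a @ b)) (V m) (V k) N" using unb by blast
    then obtain xs where xs: "set xs \<subseteq> V k" "length xs = N"
      "\<And>E. \<exists>b\<in>V m. \<forall>i<N. holds U \<theta> ((xs ! i) @ b) \<longleftrightarrow> i \<in> E"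
      unfolding vc_bounded_def by auto
    have len: "length x = k" if "x \<in> set xs" for x using xs(1) that by (auto simp: tuples_def)
    have "length (concat xs) = length xs * k"
      using len by (induction xs) auto
    then have "concat xs \<in> V (N * k)" using xs(1,2) by (auto simp: tuples_def)
    moreover have "shat k m \<theta> N (concat xs)"
      unfolding shat_def
    proof
      fix E
      obtain b where "b \<in> V m" "\<forall>i<N. holds U \<theta> ((xs ! i) @ b) \<longleftrightarrow> i \<in> E" using xs(3) by blast
      then show "\<exists>b\<in>V m. \<forall>i\<in>{..<N}. holds U \<theta> (block k (concat xs) i @ b) \<longleftrightarrow> i \<in> E"
        using block_concat[of xs k] len xs(2) by (intro bexI[of _ b]) simp_all
    qed
    ultimately show ?thesis by blast
  qed
  then have "extendible k m \<theta> 0 []" by (auto simp: extendible_def)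
  from extendible_imp_IP[OF \<theta> this] nip show False by simp
qed

end

section \<open>Countability\<close>

instance fo_term :: (countable) countable by countable_datatype
instance fo_form :: (countable, countable) countable by countable_datatype

lemma wf_term_set: "wf_term L t \<Longrightarrow> set_fo_term t \<subseteq> Funs L"
  by (induction t) auto

lemma wf_form_sets: "wf_form L \<phi> \<Longrightarrow> set1_fo_form \<phi> \<subseteq> Funs L \<and> set2_fo_form \<phi> \<subseteq> Rels L"
  by (induction \<phi>) (auto dest!: wf_term_set)

text \<open>The symbol types may be uncountable although \<open>L\<close> has countably many
  symbols; numbering these embeds the formulas into those over \<open>nat\<close>.\<close>

lemma countable_forms:
  fixes L :: "('f, 'r) lang"
  assumes "countable_lang L"
  shows "countable (forms L n)"
proof -
  define g where "g = map_fo_form (to_nat_on (Funs L)) (to_nat_on (Rels L))"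
  have inj: "inj_on (to_nat_on (Funs L)) (Funs L)" "inj_on (to_nat_on (Rels L)) (Rels L)"
    using assms by (auto simp: countable_lang_def)
  have "inj_on g (forms L n)"
  proof (rule inj_onI)
    fix \<phi> \<psi> assume "\<phi> \<in> forms L n" "\<psi> \<in> forms L n" and eq: "g \<phi> = g \<psi>"
    then have "set1_fo_form \<phi> \<subseteq> Funs L" "set2_fo_form \<phi> \<subseteq> Rels L"
      "set1_fo_form \<psi> \<subseteq> Funs L" "set2_fo_form \<psi> \<subseteq> Rels L"
      by (auto simp: forms_def dest!: wf_form_sets)
    then show "\<phi> = \<psi>"
      using eq inj unfolding g_def
      by (intro fo_form.inj_map_strong[of \<phi> \<psi> "to_nat_on (Funs L)" "to_nat_on (Funs L)"
            "to_nat_on (Rels L)" "to_nat_on (Rels L)"]) (auto dest: inj_onD)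
  qed
  then show ?thesis by (rule countable_image_inj_on[rotated]) (rule countableI_type)
qed

section \<open>Approximating measures by finite averages\<close>

text \<open>Cutting \<open>S0\<close> by the members of \<open>\<Phi>\<close> one after the other
  leaves cells; each cell of positive measure contains a point of \<open>X\<close>, which receives
  its whole mass.\<close>

lemma finitely_supported_measure:
  fixes \<nu> :: "'a set \<Rightarrow> real"
  assumes int: "\<And>S T. S \<in> \<A> \<Longrightarrow> T \<in> \<A> \<Longrightarrow> S \<inter> T \<in> \<A>"
    and diff: "\<And>S T. S \<in> \<A> \<Longrightarrow> T \<in> \<A> \<Longrightarrow> S - T \<in> \<A>"
    and nonneg: "\<And>S. S \<in> \<A> \<Longrightarrow> 0 \<le> \<nu> S"
    and split: "\<And>S T. S \<in> \<A> \<Longrightarrow> T \<in> \<A> \<Longrightarrow> \<nu> S = \<nu> (S \<inter> T) + \<nu> (S - T)"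
    and meets: "\<And>S. S \<in> \<A> \<Longrightarrow> 0 < \<nu> S \<Longrightarrow> \<exists>x\<in>X. x \<in> S"
    and "finite \<Phi>" "\<Phi> \<subseteq> \<A>" "S0 \<in> \<A>"
  shows "\<exists>F w. finite F \<and> F \<subseteq> X \<inter> S0 \<and> (\<forall>x. 0 \<le> w x) \<and> sum w F = \<nu> S0 \<and>
     (\<forall>S\<in>\<Phi>. sum w (F \<inter> S) = \<nu> (S0 \<inter> S))"
  using \<open>finite \<Phi>\<close> \<open>\<Phi> \<subseteq> \<A>\<close> \<open>S0 \<in> \<A>\<close>
proof (induction \<Phi> arbitrary: S0 rule: finite_induct)
  case empty
  show ?case
  proof (cases "0 < \<nu> S0")
    case True
    then obtain x where "x \<in> X" "x \<in> S0" using meets empty by blast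
    then show ?thesis using True by (intro exI[of _ "{x}"] exI[of _ "\<lambda>_. \<nu> S0"]) auto
  next
    case False
    then have "\<nu> S0 = 0" using nonneg[of S0] empty by auto
    then show ?thesis by (intro exI[of _ "{}"] exI[of _ "\<lambda>_. 0"]) auto
  qed
next
  case (insert S \<Phi>)
  have S: "S \<in> \<A>" "\<Phi> \<subseteq> \<A>" using insert.prems by auto
  obtain F1 w1 where 1: "finite F1" "F1 \<subseteq> X \<inter> (S0 \<inter> S)" "\<forall>x. 0 \<le> w1 x" "sum w1 F1 = \<nu> (S0 \<inter> S)"
    "\<forall>T\<in>\<Phi>. sum w1 (F1 \<inter> T) = \<nu> (S0 \<inter> S \<inter> T)"
    using insert.IH[OF S(2) int[OF insert.prems(2) S(1)]] by blast
  obtain F2 w2 where 2: "finite F2" "F2 \<subseteq> X \<inter> (S0 - S)" "\<forall>x. 0 \<le> w2 x" "sum w2 F2 = \<nu> (S0 - S)"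
    "\<forall>T\<in>\<Phi>. sum w2 (F2 \<inter> T) = \<nu> ((S0 - S) \<inter> T)"
    using insert.IH[OF S(2) diff[OF insert.prems(2) S(1)]] by blast
  \<comment> \<open>\<open>F1\<close> lies inside \<open>S\<close> and \<open>F2\<close> outside, so
    the two weights can be glued along \<open>S\<close>.\<close>
  define w where "w x = (if x \<in> S then w1 x else w2 x)" for x
  have sum: "sum w ((F1 \<union> F2) \<inter> T) = sum w1 (F1 \<inter> T) + sum w2 (F2 \<inter> T)" for T
  proof -
    have "sum w ((F1 \<union> F2) \<inter> T) = sum w (F1 \<inter> T) + sum w (F2 \<inter> T)"
      unfolding Int_Un_distrib2 using 1 2 by (intro sum.union_disjoint) auto
    also have "sum w (F1 \<inter> T) = sum w1 (F1 \<inter> T)"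
      using 1(2) by (intro sum.cong) (auto simp: w_def)
    also have "sum w (F2 \<inter> T) = sum w2 (F2 \<inter> T)"
      using 2(2) by (intro sum.cong) (auto simp: w_def)
    finally show ?thesis .
  qed
  show ?case
  proof (intro exI conjI)
    show "finite (F1 \<union> F2)" using 1 2 by simp
    show "F1 \<union> F2 \<subseteq> X \<inter> S0" using 1 2 by auto
    show "\<forall>x. 0 \<le> w x" using 1 2 by (simp add: w_def)
    show "sum w (F1 \<union> F2) = \<nu> S0"
      using sum[of UNIV] 1(4) 2(4) split[OF insert.prems(2) S(1)] by simp
    show "\<forall>T\<in>insert S \<Phi>. sum w ((F1 \<union> F2) \<inter> T) = \<nu> (S0 \<inter> T)"
    proof
      fix T assume "T \<in> insert S \<Phi>"
      then consider "T = S" | "T \<in> \<Phi>" by blast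
      then show "sum w ((F1 \<union> F2) \<inter> T) = \<nu> (S0 \<inter> T)"
      proof cases
        case 1
        have "F1 \<inter> S = F1" "F2 \<inter> S = {}" using \<open>F1 \<subseteq> _\<close> \<open>F2 \<subseteq> _\<close> by auto
        then show ?thesis using sum[of S] \<open>sum w1 F1 = _\<close> 1 by simp
      next
        case T: 2
        have "S0 \<inter> T \<inter> S = S0 \<inter> S \<inter> T" "S0 \<inter> T - S = (S0 - S) \<inter> T" by auto
        moreover have "\<nu> (S0 \<inter> T) = \<nu> (S0 \<inter> T \<inter> S) + \<nu> (S0 \<inter> T - S)"
          using T S insert.prems(2) by (intro split int) auto
        ultimately show ?thesis using sum[of T] 1(5) 2(5) T by simp
      qed
    qed
  qed
qed

lemma length_filter_replicates:
  assumes "distinct fs"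
  shows "length (filter P (concat (map (\<lambda>x. replicate (c x) x) fs))) = sum c (set fs \<inter> Collect P)"
  using assms
proof (induction fs)
  case (Cons x fs)
  then show ?case by (auto simp: Int_insert_left)
qed simp

lemma nat_ceiling_tendsto:
  fixes w :: real
  assumes "0 \<le> w"
  shows "(\<lambda>n. real (nat \<lceil>real n * w\<rceil>) / real n) \<longlonglongrightarrow> w"
proof (rule tendsto_sandwich)
  show "eventually (\<lambda>n. w \<le> real (nat \<lceil>real n * w\<rceil>) / real n) sequentially"
    using eventually_gt_at_top[of 0]
  proof eventually_elim
    case (elim n)
    have "real n * w \<le> real (nat \<lceil>real n * w\<rceil>)" by linarith
    then show ?case using elim by (simp add: field_simps)
  qed
  show "eventually (\<lambda>n. real (nat \<lceil>real n * w\<rceil>) / real n \<le> w + 1 / real n) sequentially"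
    using eventually_gt_at_top[of 0]
  proof eventually_elim
    case (elim n)
    have "0 \<le> real n * w" using assms by simp
    then have "real (nat \<lceil>real n * w\<rceil>) \<le> real n * w + 1" by linarith
    then show ?case using elim by (simp add: field_simps)
  qed
  show "(\<lambda>n. w + 1 / real n) \<longlonglongrightarrow> w" by real_asymp
qed simp

text \<open>Each point is repeated in proportion to its weight, rounded up. Rounding can make the
  length of the list differ from \<open>n\<close>, so the frequency is a quotient of two convergent
  sums.\<close>

lemma approximate_by_average:
  fixes w :: "'a \<Rightarrow> real"
  assumes F: "finite F" "\<And>x. 0 \<le> w x" "sum w F = 1" and "finite \<Phi>" "0 < e"
  obtains ys where "ys \<noteq> []" "set ys \<subseteq> F" "\<And>S. S \<in> \<Phi> \<Longrightarrow> \<bar>avg ys (\<lambda>x. x \<in> S) - sum w (F \<inter> S)\<bar> < e"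
proof -
  obtain fs where fs: "set fs = F" "distinct fs" using finite_distinct_list[OF F(1)] by blast
  define c where "c n x = nat \<lceil>real n * w x\<rceil>" for n x
  define ys where "ys n = concat (map (\<lambda>x. replicate (c n x) x) fs)" for n
  have lim: "(\<lambda>n. (\<Sum>x\<in>G. real (c n x) / real n)) \<longlonglongrightarrow> sum w G" for G
    unfolding c_def by (intro tendsto_sum nat_ceiling_tendsto F(2))
  have len: "length (filter P (ys n)) = sum (c n) (F \<inter> Collect P)" for n P
    unfolding ys_def using length_filter_replicates[OF fs(2)] fs(1) by blast
  have len': "length (ys n) = sum (c n) F" for n using len[of "\<lambda>_. True" n] by simp
  have avg: "avg (ys n) (\<lambda>x. x \<in> S) = (\<Sum>x\<in>F \<inter> S. real (c n x) / real n) / (\<Sum>x\<in>F. real (c n x) / real n)"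
    if "0 < n" for n S
    using that by (simp add: avg_def len len' sum_divide_distrib[symmetric])
  have "(\<lambda>n. (\<Sum>x\<in>F \<inter> S. real (c n x) / real n) / (\<Sum>x\<in>F. real (c n x) / real n)) \<longlonglongrightarrow>
      sum w (F \<inter> S) / sum w F" for S
    using F(3) by (intro tendsto_divide lim) auto
  then have "eventually (\<lambda>n. dist ((\<Sum>x\<in>F \<inter> S. real (c n x) / real n) / (\<Sum>x\<in>F. real (c n x) / real n))
      (sum w (F \<inter> S)) < e) sequentially" for S
    using \<open>0 < e\<close> F(3) by (auto dest: tendstoD)
  then have "eventually (\<lambda>n. \<forall>S\<in>\<Phi>. dist ((\<Sum>x\<in>F \<inter> S. real (c n x) / real n) / (\<Sum>x\<in>F. real (c n x) / real n))
      (sum w (F \<inter> S)) < e) sequentially"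
    by (intro eventually_ball_finite[OF \<open>finite \<Phi>\<close>]) auto
  moreover have "eventually (\<lambda>n. 0 < (\<Sum>x\<in>F. real (c n x) / real n)) sequentially"
    using order_tendstoD(1)[OF lim[of F], of 0] F(3) by simp
  ultimately have "eventually (\<lambda>n. (\<forall>S\<in>\<Phi>. \<bar>avg (ys n) (\<lambda>x. x \<in> S) - sum w (F \<inter> S)\<bar> < e) \<and> ys n \<noteq> []) sequentially"
    using eventually_gt_at_top[of 0]
  proof eventually_elim
    case (elim n)
    then have "ys n \<noteq> []" using len'[of n] by (auto simp flip: sum_divide_distrib of_nat_sum)
    then show ?case using elim avg[of n] by (simp add: dist_real_def)
  qed
  then obtain n where "\<forall>S\<in>\<Phi>. \<bar>avg (ys n) (\<lambda>x. x \<in> S) - sum w (F \<inter> S)\<bar> < e" "ys n \<noteq> []"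
    by (auto simp: eventually_sequentially)
  moreover have "set (ys n) \<subseteq> F" using fs(1) by (auto simp: ys_def)
  ultimately show ?thesis using that by blast
qed

text \<open>The approximations form a base of a proper filter, indexed by finite sets of conditions
  and error bounds; every ultrafilter refining it has these limits.\<close>

lemma ultrafilter_with_limits:
  fixes g :: "'i \<Rightarrow> 'y \<Rightarrow> real"
  assumes approx: "\<And>\<Phi> e. finite \<Phi> \<Longrightarrow> \<Phi> \<subseteq> P \<Longrightarrow> 0 < e \<Longrightarrow> \<exists>y\<in>Y. \<forall>i\<in>\<Phi>. \<bar>g i y - l i\<bar> < e"
  obtains D where "ultra D" "eventually (\<lambda>y. y \<in> Y) D" "\<And>i. i \<in> P \<Longrightarrow> (g i \<longlongrightarrow> l i) D"
proof -
  define I where "I = {\<Phi>. finite \<Phi> \<and> \<Phi> \<subseteq> P} \<times> {0 :: real<..}"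
  define S where "S = (\<lambda>(\<Phi>, e). {y\<in>Y. \<forall>i\<in>\<Phi>. \<bar>g i y - l i\<bar> < e})"
  define F where "F = (INF x\<in>I. principal (S x))"
  have ev: "eventually Q F \<longleftrightarrow> (\<exists>x\<in>I. eventually Q (principal (S x)))" for Q
    unfolding F_def
  proof (rule eventually_INF_base)
    show "I \<noteq> {}" by (auto simp: I_def intro!: exI[of _ "{}"] gt_ex)
    fix a b assume ab: "a \<in> I" "b \<in> I"
    define x where "x = (fst a \<union> fst b, min (snd a) (snd b))"
    have "x \<in> I" using ab by (auto simp: I_def x_def)
    moreover have "principal (S x) \<le> inf (principal (S a)) (principal (S b))"
      by (auto simp: S_def x_def split: prod.splits)
    ultimately show "\<exists>x\<in>I. principal (S x) \<le> inf (principal (S a)) (principal (S b))" by blast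
  qed
  have "F \<noteq> bot"
  proof
    assume "F = bot"
    then have "eventually (\<lambda>_. False) F" by simp
    then obtain x where x: "x \<in> I" "S x = {}" unfolding ev by (auto simp: eventually_principal)
    obtain \<Phi> e where "x = (\<Phi>, e)" by fastforce
    with x approx[of \<Phi> e] show False unfolding I_def S_def by blast
  qed
  then obtain D where D: "D \<le> F" "ultra D" by (rule ultrafilter_exists)
  show ?thesis
  proof (rule that[OF D(2)])
    have "eventually (\<lambda>y. y \<in> Y) F"
      unfolding ev by (rule bexI[of _ "({}, 1)"]) (auto simp: eventually_principal S_def I_def)
    then show "eventually (\<lambda>y. y \<in> Y) D" using D(1) by (rule filter_leD[rotated])
    fix i assume i: "i \<in> P"
    show "(g i \<longlongrightarrow> l i) D"
    proof (rule tendstoI)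
      fix e :: real assume "0 < e"
      then have "eventually (\<lambda>y. dist (g i y) (l i) < e) F"
        unfolding ev using i
        by (intro bexI[of _ "({i}, e)"]) (auto simp: eventually_principal S_def I_def dist_real_def)
      then show "eventually (\<lambda>y. dist (g i y) (l i) < e) D" using D(1) by (rule filter_leD[rotated])
    qed
  qed
qed

lemma fat_bounded_mono: "fat_bounded f B Y \<Longrightarrow> Z \<subseteq> Y \<Longrightarrow> fat_bounded f B Z"
  unfolding fat_bounded_def by (meson order_trans)

section \<open>Types and measures as limits\<close>

context sat_struct
begin

abbreviation "PF \<equiv> pforms L (univ U)"

definition freq :: "'u list list \<Rightarrow> ('f, 'r) fo_form \<times> 'u list \<Rightarrow> real" where
  "freq ys \<phi> = avg ys (\<lambda>a. holds U (fst \<phi>) (a @ snd \<phi>))"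

lemma mem_solutions: "a \<in> solutions U k \<phi> \<longleftrightarrow> a \<in> V k \<and> holds U (fst \<phi>) (a @ snd \<phi>)"
  by (cases \<phi>) (auto simp: solutions_def)

lemma mem_pforms: "(\<theta>, b) \<in> PF k \<longleftrightarrow> b \<in> V (length b) \<and> \<theta> \<in> forms L (k + length b)"
  by (auto simp: pforms_def tuples_def)

lemma Av_eq_freq:
  assumes "\<phi> \<in> PF k" "set ys \<subseteq> V k"
  shows "Av L U k ys \<phi> = freq ys \<phi>"
proof -
  have "{i. i < length ys \<and> ys ! i \<in> solutions U k \<phi>} =
      {i. i < length ys \<and> holds U (fst \<phi>) (ys ! i @ snd \<phi>)}"
    using assms(2) nth_mem by (auto simp: mem_solutions)
  then show ?thesis using assms(1) by (simp add: Av_def freq_def avg_def length_filter_conv_card)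
qed

lemma freq_singleton: "freq [a] \<phi> = of_bool (holds U (fst \<phi>) (a @ snd \<phi>))"
  by (simp add: freq_def avg_def)

text \<open>Both formulas are read over the joint parameter tuple \<open>b @ c\<close>, where the
  variables for \<open>c\<close> are shifted by the length of \<open>b\<close>.\<close>

lemma pforms_combine:
  assumes \<phi>: "\<phi> \<in> PF k" and \<psi>: "\<psi> \<in> PF k"
  shows "\<exists>\<xi>\<in>PF k. solutions U k \<xi> = solutions U k \<phi> \<inter> solutions U k \<psi>"
    and "\<exists>\<xi>\<in>PF k. solutions U k \<xi> = solutions U k \<phi> - solutions U k \<psi>"
proof -
  obtain \<theta> b \<eta> c where eq: "\<phi> = (\<theta>, b)" "\<psi> = (\<eta>, c)" by fastforce
  define l l' where "l = length b" "l' = length c"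
  have 0: "\<theta> \<in> forms L (k + l)" "\<eta> \<in> forms L (k + l')" "b \<in> V l" "c \<in> V l'"
    using \<phi> \<psi> unfolding eq mem_pforms l_l'_def by auto
  have 1: "definable L U (k + (l + l')) (\<lambda>w. holds U \<theta> (map (\<lambda>i. w ! i) [0..<k + l]))"
    by (rule definable_subst[OF definable_holds[OF 0(1)]]) auto
  have 2: "definable L U (k + (l + l'))
     (\<lambda>w. holds U \<eta> (map (\<lambda>i. w ! (if i < k then i else l + i)) [0..<k + l']))"
    by (rule definable_subst[OF definable_holds[OF 0(2)]]) auto
  have *: "\<exists>\<xi>\<in>PF k. solutions U k \<xi> = {a \<in> V k. Q (a @ (b @ c))}"
    if Q: "definable L U (k + (l + l')) Q" for Q
  proof -
    obtain \<xi> where \<xi>: "\<xi> \<in> forms L (k + (l + l'))" "\<forall>as\<in>V (k + (l + l')). holds U \<xi> as \<longleftrightarrow> Q as"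
      using Q unfolding definable_def by blast
    have "(\<xi>, b @ c) \<in> PF k" using 0 \<xi>(1) by (auto simp: mem_pforms l_l'_def tuples_def)
    moreover have "a @ (b @ c) \<in> V (k + (l + l'))" if "a \<in> V k" for a
      by (intro tuples_append that 0)
    then have "solutions U k (\<xi>, b @ c) = {a \<in> V k. Q (a @ (b @ c))}"
      using \<xi>(2) by (auto simp: mem_solutions)
    ultimately show ?thesis by blast
  qed
  have m1: "map (\<lambda>i. (a @ (b @ c)) ! i) [0..<k + l] = a @ b" if "a \<in> V k" for a
    using that by (intro nth_equalityI) (auto simp: tuples_def nth_append l_l'_def)
  have m2: "map (\<lambda>i. (a @ (b @ c)) ! (if i < k then i else l + i)) [0..<k + l'] = a @ c" if "a \<in> V k" for a
    using that by (intro nth_equalityI) (auto simp: tuples_def nth_append l_l'_def)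
  show "\<exists>\<xi>\<in>PF k. solutions U k \<xi> = solutions U k \<phi> \<inter> solutions U k \<psi>"
  proof -
    have "{a \<in> V k. holds U \<theta> (map (\<lambda>i. (a @ (b @ c)) ! i) [0..<k + l]) \<and>
       holds U \<eta> (map (\<lambda>i. (a @ (b @ c)) ! (if i < k then i else l + i)) [0..<k + l'])} =
       solutions U k \<phi> \<inter> solutions U k \<psi>"
      using m1 m2 by (auto simp: mem_solutions eq simp del: map_upt_eqI)
    with *[OF definable_conj[OF 1 2]] show ?thesis by simp
  qed
  show "\<exists>\<xi>\<in>PF k. solutions U k \<xi> = solutions U k \<phi> - solutions U k \<psi>"
  proof -
    have "{a \<in> V k. holds U \<theta> (map (\<lambda>i. (a @ (b @ c)) ! i) [0..<k + l]) \<and>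
       \<not> holds U \<eta> (map (\<lambda>i. (a @ (b @ c)) ! (if i < k then i else l + i)) [0..<k + l'])} =
       solutions U k \<phi> - solutions U k \<psi>"
      using m1 m2 by (auto simp: mem_solutions eq)
    with *[OF definable_conj[OF 1 definable_not[OF 2]]] show ?thesis by simp
  qed
qed

lemma pforms_full: "\<exists>\<phi>\<in>PF k. solutions U k \<phi> = V k"
proof -
  obtain \<phi> where "\<phi> \<in> forms L k" "\<forall>a\<in>V k. holds U \<phi> a"
    using definable_True[OF struct, of k] unfolding definable_def by blast
  then show ?thesis by (intro bexI[of _ "(\<phi>, [])"]) (auto simp: mem_solutions mem_pforms)
qed

section \<open>Finite approximations of measures, and types as measures\<close>

lemma keisler_measuresD:
  assumes "\<mu> \<in> keisler_measures L U k"
  shows "\<phi> \<in> PF k \<Longrightarrow> 0 \<le> \<mu> \<phi>"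
    and "\<phi> \<in> PF k \<Longrightarrow> solutions U k \<phi> = V k \<Longrightarrow> \<mu> \<phi> = 1"
    and "\<phi> \<in> PF k \<Longrightarrow> \<psi> \<in> PF k \<Longrightarrow> \<rho> \<in> PF k \<Longrightarrow> solutions U k \<phi> \<inter> solutions U k \<psi> = {} \<Longrightarrow>
       solutions U k \<rho> = solutions U k \<phi> \<union> solutions U k \<psi> \<Longrightarrow> \<mu> \<rho> = \<mu> \<phi> + \<mu> \<psi>"
    and "\<mu> \<in> extensional (PF k)"
  using assms unfolding keisler_measures_def by blast+

text \<open>Additivity applied to an empty definable set gives it measure 0; adjoining it to
  \<open>\<psi>\<close> compares the two formulas.\<close>

lemma keisler_cong:
  assumes \<mu>: "\<mu> \<in> keisler_measures L U k"
    and \<phi>: "\<phi> \<in> PF k" "\<psi> \<in> PF k" "solutions U k \<phi> = solutions U k \<psi>"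
  shows "\<mu> \<phi> = \<mu> \<psi>"
proof -
  obtain \<xi> where \<xi>: "\<xi> \<in> PF k" "solutions U k \<xi> = {}"
    using pforms_combine(2)[OF \<phi>(1,1)] by auto
  have "\<mu> \<xi> = \<mu> \<xi> + \<mu> \<xi>" using \<xi> by (intro keisler_measuresD(3)[OF \<mu>]) auto
  moreover have "\<mu> \<phi> = \<mu> \<psi> + \<mu> \<xi>" using \<xi> \<phi> by (intro keisler_measuresD(3)[OF \<mu>]) auto
  ultimately show ?thesis by simp
qed

lemma keisler_finite_support:
  assumes \<mu>: "\<mu> \<in> keisler_measures L U k" and fs: "measure_fin_sat L U A k \<mu>"
    and \<Phi>: "finite \<Phi>" "\<Phi> \<subseteq> PF k"
  shows "\<exists>F w. finite F \<and> F \<subseteq> tuples A k \<and> (\<forall>x. 0 \<le> w x) \<and> sum w F = 1 \<and>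
     (\<forall>\<phi>\<in>\<Phi>. sum w (F \<inter> solutions U k \<phi>) = \<mu> \<phi>)"
proof -
  define \<A> where "\<A> = solutions U k ` PF k"
  \<comment> \<open>The measure as a function of definable sets; by \<open>keisler_cong\<close> the
    chosen formula does not matter.\<close>
  define \<nu> where "\<nu> S = \<mu> (SOME \<phi>. \<phi> \<in> PF k \<and> solutions U k \<phi> = S)" for S
  have \<nu>: "\<nu> (solutions U k \<phi>) = \<mu> \<phi>" if "\<phi> \<in> PF k" for \<phi>
    unfolding \<nu>_def
    by (rule someI2[of _ \<phi>]) (use that in \<open>auto intro: keisler_cong[OF \<mu>]\<close>)
  have int: "S \<inter> T \<in> \<A>" "S - T \<in> \<A>" if "S \<in> \<A>" "T \<in> \<A>" for S T
  proof -
    obtain \<phi> \<psi> where \<phi>: "\<phi> \<in> PF k" "S = solutions U k \<phi>" and \<psi>: "\<psi> \<in> PF k" "T = solutions U k \<psi>"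
      using \<open>S \<in> \<A>\<close> \<open>T \<in> \<A>\<close> unfolding \<A>_def by blast
    show "S \<inter> T \<in> \<A>" using pforms_combine(1)[OF \<phi>(1) \<psi>(1)] unfolding \<A>_def \<phi>(2) \<psi>(2) by (metis imageI)
    show "S - T \<in> \<A>" using pforms_combine(2)[OF \<phi>(1) \<psi>(1)] unfolding \<A>_def \<phi>(2) \<psi>(2) by (metis imageI)
  qed
  have split: "\<nu> S = \<nu> (S \<inter> T) + \<nu> (S - T)" if ST: "S \<in> \<A>" "T \<in> \<A>" for S T
  proof -
    obtain \<phi> \<psi> \<xi> where *: "\<phi> \<in> PF k" "S = solutions U k \<phi>" "\<psi> \<in> PF k" "S \<inter> T = solutions U k \<psi>"
      "\<xi> \<in> PF k" "S - T = solutions U k \<xi>"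
      using int[OF ST] ST(1) unfolding \<A>_def by blast
    have "\<mu> \<phi> = \<mu> \<psi> + \<mu> \<xi>"
      using * by (intro keisler_measuresD(3)[OF \<mu>]) auto
    then show ?thesis using \<nu> * by metis
  qed
  have full: "V k \<in> \<A>" "\<nu> (V k) = 1"
  proof -
    obtain \<phi> where \<phi>: "\<phi> \<in> PF k" "solutions U k \<phi> = V k" using pforms_full by blast
    then show "V k \<in> \<A>" unfolding \<A>_def by (metis imageI)
    show "\<nu> (V k) = 1" using \<nu>[OF \<phi>(1)] keisler_measuresD(2)[OF \<mu> \<phi>] \<phi>(2) by simp
  qed
  have "\<exists>F w. finite F \<and> F \<subseteq> tuples A k \<inter> V k \<and> (\<forall>x. 0 \<le> w x) \<and> sum w F = \<nu> (V k) \<and>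
     (\<forall>S\<in>solutions U k ` \<Phi>. sum w (F \<inter> S) = \<nu> (V k \<inter> S))"
  proof (rule finitely_supported_measure[where \<A> = \<A>])
    show "0 \<le> \<nu> S" if "S \<in> \<A>" for S
      using that \<nu> keisler_measuresD(1)[OF \<mu>] by (auto simp: \<A>_def)
    show "\<exists>x\<in>tuples A k. x \<in> S" if "S \<in> \<A>" "0 < \<nu> S" for S
    proof -
      obtain \<phi> where "\<phi> \<in> PF k" "S = solutions U k \<phi>" using \<open>S \<in> \<A>\<close> unfolding \<A>_def by blast
      then show ?thesis using fs \<open>0 < \<nu> S\<close> \<nu>[of \<phi>] unfolding measure_fin_sat_def by simp
    qed
    show "solutions U k ` \<Phi> \<subseteq> \<A>" using \<Phi>(2) by (auto simp: \<A>_def)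
  qed (fact int split full(1) finite_imageI[OF \<Phi>(1)])+
  then obtain F w where Fw: "finite F" "F \<subseteq> tuples A k \<inter> V k" "\<forall>x. 0 \<le> w x" "sum w F = \<nu> (V k)"
     "\<forall>S\<in>solutions U k ` \<Phi>. sum w (F \<inter> S) = \<nu> (V k \<inter> S)" by blast
  have "sum w (F \<inter> solutions U k \<phi>) = \<mu> \<phi>" if "\<phi> \<in> \<Phi>" for \<phi>
  proof -
    have "V k \<inter> solutions U k \<phi> = solutions U k \<phi>" by (auto simp: mem_solutions)
    then show ?thesis using Fw(5) that \<nu>[of \<phi>] \<Phi>(2) by auto
  qed
  then show ?thesis using Fw full(2) by (intro exI[of _ F] exI[of _ w]) auto
qed

text \<open>In a finitely supported representation, a point of positive weight lies in every set of
  full weight and in no set of weight 0.\<close>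

lemma zero_one_measure_point:
  assumes \<mu>: "\<mu> \<in> keisler_measures L U k" and fs: "measure_fin_sat L U A k \<mu>"
    and \<Phi>: "finite \<Phi>" "\<Phi> \<subseteq> PF k" and zo: "\<And>\<phi>. \<phi> \<in> \<Phi> \<Longrightarrow> \<mu> \<phi> = 0 \<or> \<mu> \<phi> = 1"
  shows "\<exists>a\<in>tuples A k. \<forall>\<phi>\<in>\<Phi>. a \<in> solutions U k \<phi> \<longleftrightarrow> \<mu> \<phi> = 1"
proof -
  obtain F w where Fw: "finite F" "F \<subseteq> tuples A k" "\<forall>x. 0 \<le> w x" "sum w F = 1"
     "\<forall>\<phi>\<in>\<Phi>. sum w (F \<inter> solutions U k \<phi>) = \<mu> \<phi>"
    using keisler_finite_support[OF \<mu> fs \<Phi>] by blast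
  obtain a where a: "a \<in> F" "w a \<noteq> 0" using Fw(4) by (metis sum.neutral zero_neq_one)
  have pos: "sum w G \<noteq> 0" if "G \<subseteq> F" "a \<in> G" for G
    using that a(2) Fw(1,3) by (subst sum_nonneg_eq_0_iff) (auto intro: finite_subset)
  have "a \<in> solutions U k \<phi> \<longleftrightarrow> \<mu> \<phi> = 1" if \<phi>: "\<phi> \<in> \<Phi>" for \<phi>
  proof
    assume "a \<in> solutions U k \<phi>"
    then have "\<mu> \<phi> \<noteq> 0" using pos[of "F \<inter> solutions U k \<phi>"] a(1) Fw(5) \<phi> by auto
    then show "\<mu> \<phi> = 1" using zo[OF \<phi>] by blast
  next
    assume "\<mu> \<phi> = 1"
    then have "sum w (F - solutions U k \<phi>) = 0"
      using sum.Int_Diff[OF Fw(1), of w "solutions U k \<phi>"] Fw(4,5) \<phi> by simp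
    then show "a \<in> solutions U k \<phi>" using pos[of "F - solutions U k \<phi>"] a(1) by auto
  qed
  with a(1) Fw(2) show ?thesis by blast
qed

text \<open>Consistency speaks only about members of \<open>p\<close>; for a formula outside
  \<open>p\<close> its negation is such a member.\<close>

lemma global_type_decides:
  assumes p: "p \<in> global_types L U k" and F: "finite F" "F \<subseteq> PF k"
  shows "\<exists>a\<in>V k. \<forall>\<phi>\<in>F. \<phi> \<in> p \<longleftrightarrow> a \<in> solutions U k \<phi>"
proof -
  define N where "N \<phi> = (Neg (fst \<phi>), snd \<phi>)" for \<phi> :: "('f, 'r) fo_form \<times> 'u list"
  have N: "N \<phi> \<in> p" if "\<phi> \<in> F - p" for \<phi>
    using p that F(2) unfolding global_types_def N_def by (cases \<phi>) fastforce
  define G where "G = (F \<inter> p) \<union> N ` (F - p)"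
  have "finite G" "G \<subseteq> p" using F N by (auto simp: G_def)
  then obtain a where a: "a \<in> V k" "\<forall>\<phi>\<in>G. a \<in> solutions U k \<phi>"
    using p unfolding global_types_def consistent_def by blast
  have "\<phi> \<in> p \<longleftrightarrow> a \<in> solutions U k \<phi>" if "\<phi> \<in> F" for \<phi>
  proof (cases "\<phi> \<in> p")
    case True
    then show ?thesis using a(2) that by (auto simp: G_def)
  next
    case False
    then have "a \<in> solutions U k (N \<phi>)" using a(2) that by (auto simp: G_def)
    then show ?thesis using False by (simp add: mem_solutions N_def)
  qed
  with a(1) show ?thesis by blast
qed

text \<open>A type as a 0-1 valued measure, through which results on measures carry over.\<close>

definition type_measure :: "nat \<Rightarrow> (('f, 'r) fo_form \<times> 'u list) set \<Rightarrow> ('f, 'r) fo_form \<times> 'u list \<Rightarrow> real" where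
  "type_measure k p = (\<lambda>\<phi>\<in>PF k. of_bool (\<phi> \<in> p))"

lemma type_measure:
  assumes p: "p \<in> global_types L U k"
  shows "type_measure k p \<in> keisler_measures L U k"
proof -
  have add: "type_measure k p \<rho> = type_measure k p \<phi> + type_measure k p \<psi>"
    if PF: "\<phi> \<in> PF k" "\<psi> \<in> PF k" "\<rho> \<in> PF k"
      and dj: "solutions U k \<phi> \<inter> solutions U k \<psi> = {}"
      and un: "solutions U k \<rho> = solutions U k \<phi> \<union> solutions U k \<psi>" for \<phi> \<psi> \<rho>
  proof -
    have "\<exists>a\<in>V k. \<forall>\<xi>\<in>{\<phi>, \<psi>, \<rho>}. \<xi> \<in> p \<longleftrightarrow> a \<in> solutions U k \<xi>"
      using PF by (intro global_type_decides[OF p]) auto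
    then obtain a where a: "\<phi> \<in> p \<longleftrightarrow> a \<in> solutions U k \<phi>" "\<psi> \<in> p \<longleftrightarrow> a \<in> solutions U k \<psi>"
      "\<rho> \<in> p \<longleftrightarrow> a \<in> solutions U k \<rho>" by auto
    have "\<rho> \<in> p \<longleftrightarrow> \<phi> \<in> p \<or> \<psi> \<in> p" "\<not> (\<phi> \<in> p \<and> \<psi> \<in> p)"
      using dj a unfolding un by blast+
    then show ?thesis using PF by (auto simp: type_measure_def)
  qed
  have one: "type_measure k p \<phi> = 1" if \<phi>: "\<phi> \<in> PF k" "solutions U k \<phi> = V k" for \<phi>
  proof -
    have "\<exists>a\<in>V k. \<forall>\<xi>\<in>{\<phi>}. \<xi> \<in> p \<longleftrightarrow> a \<in> solutions U k \<xi>"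
      using \<phi> by (intro global_type_decides[OF p]) auto
    then show ?thesis using \<phi> by (auto simp: type_measure_def)
  qed
  show ?thesis
    unfolding keisler_measures_def using add one by (auto simp: type_measure_def)
qed

lemma global_type_subset: "p \<in> global_types L U k \<Longrightarrow> p \<subseteq> PF k"
  by (simp add: global_types_def)

lemma type_measure_fin_sat:
  assumes "p \<in> global_types L U k"
  shows "measure_fin_sat L U A k (type_measure k p) \<longleftrightarrow> type_fin_sat U A k p"
  using global_type_subset[OF assms]
  unfolding measure_fin_sat_def type_fin_sat_def type_measure_def by (auto simp: restrict_def)

end

locale nip_setting = sat_struct L U \<kappa>
  for L :: "('f, 'r) lang" and U :: "('f, 'r, 'u) fo_struct" and \<kappa> :: "'c rel" +
  fixes A :: "'u set" and k :: nat
  assumes A: "A \<subseteq> univ U" "A \<noteq> {}" "countable A"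
    and nip: "NIP L U" and countable_lang: "countable_lang L"
begin

abbreviation "X \<equiv> tuples A k"

lemma X: "X \<subseteq> V k" "countable X" "X \<noteq> {}"
proof -
  show "X \<subseteq> V k" using A(1) by (auto simp: tuples_def)
  have "X \<subseteq> lists A" by (auto simp: tuples_def)
  then show "countable X" using A(3) by (meson countable_lists countable_subset)
  obtain a where "a \<in> A" using A(2) by blast
  then have "replicate k a \<in> X" by (auto simp: tuples_def)
  then show "X \<noteq> {}" by blast
qed

abbreviation "samples \<equiv> {ys. ys \<noteq> [] \<and> set ys \<subseteq> X}"

lemma countable_samples: "countable samples"
proof -
  have "samples \<subseteq> lists X" by auto
  then show ?thesis using X(2) by (meson countable_lists countable_subset)
qed

lemma fat_bounded_samples:
  assumes "\<theta> \<in> forms L (k + m)"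
  shows "fat_bounded (\<lambda>b ys. avg ys (\<lambda>a. holds U \<theta> (a @ b))) (V m) samples"
proof -
  have "\<not> has_IP U k m \<theta>" using nip assms unfolding NIP_def by blast
  then obtain d where "vc_bounded (\<lambda>a b. holds U \<theta> (a @ b)) (V m) (V k) d"
    using NIP_imp_vc_bounded[OF assms] by blast
  from vc_bounded_imp_fat_bounded_avg[OF this] show ?thesis
    by (rule fat_bounded_mono) (use X(1) in auto)
qed

text \<open>The set \<open>Y\<close> of admissible samples is left open: all samples serve for
  measures, one-element lists for types.\<close>

lemma convergent_samples:
  assumes Y: "Y \<subseteq> samples"
    and approx: "\<And>\<Phi> e. finite \<Phi> \<Longrightarrow> \<Phi> \<subseteq> PF k \<Longrightarrow> 0 < e \<Longrightarrow> \<exists>y\<in>Y. \<forall>\<phi>\<in>\<Phi>. \<bar>freq y \<phi> - l \<phi>\<bar> < e"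
  obtains y :: "nat \<Rightarrow> 'u list list" where "\<And>n. y n \<in> Y" "\<And>\<phi>. \<phi> \<in> PF k \<Longrightarrow> (\<lambda>n. freq (y n) \<phi>) \<longlonglongrightarrow> l \<phi>"
proof -
  obtain D where D: "ultra D" "eventually (\<lambda>y. y \<in> Y) D"
    "\<And>\<phi>. \<phi> \<in> PF k \<Longrightarrow> ((\<lambda>y. freq y \<phi>) \<longlongrightarrow> l \<phi>) D"
    using ultrafilter_with_limits[of "PF k" Y "\<lambda>\<phi> y. freq y \<phi>" l] approx by blast
  \<comment> \<open>The component \<open>m\<close> fixes the length of the parameters, since one
    formula lies in \<open>forms L (k + m)\<close> for many \<open>m\<close>.\<close>
  define J where "J = (SIGMA m : UNIV. forms L (k + m))"
  obtain y :: "nat \<Rightarrow> 'u list list" where y: "\<And>n. y n \<in> Y"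
    "\<And>j b. j \<in> J \<Longrightarrow> b \<in> V (fst j) \<Longrightarrow> (\<lambda>n. avg (y n) (\<lambda>a. holds U (snd j) (a @ b))) \<longlonglongrightarrow> l (snd j, b)"
  proof (rule generic_sequence[OF D(1,2), where J = J and B = "\<lambda>j. V (fst j)" and l = "\<lambda>j b. l (snd j, b)" and
     f = "\<lambda>j b y. avg y (\<lambda>a. holds U (snd j) (a @ b))"])
    show "countable Y" using Y countable_samples by (rule countable_subset)
    show "countable J" unfolding J_def using countable_forms[OF countable_lang] by auto
    show "fat_bounded (\<lambda>b y. avg y (\<lambda>a. holds U (snd j) (a @ b))) (V (fst j)) Y" if "j \<in> J" for j
      using that by (intro fat_bounded_mono[OF fat_bounded_samples Y]) (auto simp: J_def)
    show "((\<lambda>y. avg y (\<lambda>a. holds U (snd j) (a @ b))) \<longlongrightarrow> l (snd j, b)) D" if "j \<in> J" "b \<in> V (fst j)" for j b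
    proof -
      have "(snd j, b) \<in> PF k" using that by (auto simp: J_def mem_pforms tuples_def)
      from D(3)[OF this] show ?thesis by (simp add: freq_def)
    qed
  qed blast
  show ?thesis
  proof (rule that[OF y(1)])
    fix \<phi> assume "\<phi> \<in> PF k"
    moreover obtain \<theta> b where \<phi>: "\<phi> = (\<theta>, b)" by fastforce
    ultimately show "(\<lambda>n. freq (y n) \<phi>) \<longlonglongrightarrow> l \<phi>"
      using y(2)[of "(length b, \<theta>)" b] by (simp add: J_def mem_pforms freq_def)
  qed
qed

lemma measure_limit:
  assumes \<mu>: "\<mu> \<in> keisler_measures L U k" "measure_fin_sat L U A k \<mu>"
  obtains y :: "nat \<Rightarrow> 'u list list" where "\<And>n. y n \<in> samples" "\<And>\<phi>. \<phi> \<in> PF k \<Longrightarrow> (\<lambda>n. freq (y n) \<phi>) \<longlonglongrightarrow> \<mu> \<phi>"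
proof (rule convergent_samples[of samples \<mu>])
  fix \<Phi> :: "(('f, 'r) fo_form \<times> 'u list) set" and e :: real
  assume \<Phi>: "finite \<Phi>" "\<Phi> \<subseteq> PF k" "0 < e"
  obtain F w where Fw: "finite F" "F \<subseteq> X" "\<forall>x. 0 \<le> w x" "sum w F = 1"
     "\<forall>\<phi>\<in>\<Phi>. sum w (F \<inter> solutions U k \<phi>) = \<mu> \<phi>"
    using keisler_finite_support[OF \<mu> \<Phi>(1,2)] by blast
  have w: "\<And>x. 0 \<le> w x" using Fw(3) by blast
  obtain ys where ys: "ys \<noteq> []" "set ys \<subseteq> F"
    "\<And>S. S \<in> solutions U k ` \<Phi> \<Longrightarrow> \<bar>avg ys (\<lambda>x. x \<in> S) - sum w (F \<inter> S)\<bar> < e"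
    using approximate_by_average[OF Fw(1) w Fw(4) finite_imageI[OF \<Phi>(1)] \<Phi>(3)] by metis
  have "avg ys (\<lambda>x. x \<in> solutions U k \<phi>) = freq ys \<phi>" for \<phi>
  proof -
    have "filter (\<lambda>x. x \<in> solutions U k \<phi>) ys = filter (\<lambda>a. holds U (fst \<phi>) (a @ snd \<phi>)) ys"
      using ys(2) Fw(2) X(1) by (intro filter_cong) (auto simp: mem_solutions)
    then show ?thesis by (simp add: avg_def freq_def)
  qed
  then have "\<bar>freq ys \<phi> - \<mu> \<phi>\<bar> < e" if "\<phi> \<in> \<Phi>" for \<phi>
    using ys(3)[of "solutions U k \<phi>"] Fw(5) that by auto
  moreover have "ys \<in> samples" using ys Fw(2) by auto
  ultimately show "\<exists>y\<in>samples. \<forall>\<phi>\<in>\<Phi>. \<bar>freq y \<phi> - \<mu> \<phi>\<bar> < e" by blast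
qed (use that in auto)

text \<open>A single point decides finitely many formulas exactly as \<open>p\<close> does, so the
  ultrafilter can live on one-element samples.\<close>

lemma type_limit:
  assumes p: "p \<in> global_types L U k" "type_fin_sat U A k p"
  obtains a :: "nat \<Rightarrow> 'u list" where "\<And>n. a n \<in> X"
    "\<And>\<phi>. \<phi> \<in> PF k \<Longrightarrow> (\<lambda>n. freq [a n] \<phi>) \<longlonglongrightarrow> of_bool (\<phi> \<in> p)"
proof -
  note \<mu> = type_measure[OF p(1)] p(2)[folded type_measure_fin_sat[OF p(1)]]
  obtain y :: "nat \<Rightarrow> 'u list list" where y: "\<And>n. y n \<in> (\<lambda>a. [a]) ` X"
    "\<And>\<phi>. \<phi> \<in> PF k \<Longrightarrow> (\<lambda>n. freq (y n) \<phi>) \<longlonglongrightarrow> of_bool (\<phi> \<in> p)"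
  proof (rule convergent_samples[of "(\<lambda>a. [a]) ` X" "\<lambda>\<phi>. of_bool (\<phi> \<in> p)"])
    fix \<Phi> :: "(('f, 'r) fo_form \<times> 'u list) set" and e :: real
    assume \<Phi>: "finite \<Phi>" "\<Phi> \<subseteq> PF k" "0 < e"
    have tm: "type_measure k p \<phi> = of_bool (\<phi> \<in> p)" if "\<phi> \<in> \<Phi>" for \<phi>
      using \<Phi>(2) that by (auto simp: type_measure_def)
    obtain a where a: "a \<in> X" "\<forall>\<phi>\<in>\<Phi>. a \<in> solutions U k \<phi> \<longleftrightarrow> type_measure k p \<phi> = 1"
      using zero_one_measure_point[OF \<mu> \<Phi>(1,2)] tm by auto
    have "holds U (fst \<phi>) (a @ snd \<phi>) \<longleftrightarrow> \<phi> \<in> p" if "\<phi> \<in> \<Phi>" for \<phi>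
      using a X(1) that tm[OF that] mem_solutions[of a k \<phi>] by auto
    then show "\<exists>y\<in>(\<lambda>a. [a]) ` X. \<forall>\<phi>\<in>\<Phi>. \<bar>freq y \<phi> - of_bool (\<phi> \<in> p)\<bar> < e"
      using a(1) \<Phi>(3) by (intro bexI[of _ "[a]"]) (auto simp: freq_singleton)
  qed (use that in auto)
  have "\<exists>a. a \<in> X \<and> y n = [a]" for n using y(1)[of n] by blast
  then obtain a where a: "\<And>n. a n \<in> X" "\<And>n. y n = [a n]" by metis
  show ?thesis by (rule that[OF a(1) y(2)[unfolded a(2)]])
qed

section \<open>Limit functions on local types\<close>

lemma local_type_iff:
  assumes "q \<in> local_types U A k m \<theta>" "realizes U m \<theta> b q" "a \<in> X"
  shows "(a, True) \<in> q \<longleftrightarrow> holds U \<theta> (a @ b)"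
proof -
  have "(a, True) \<in> q \<or> (a, False) \<in> q" using assms(1,3) by (simp add: local_types_def)
  moreover have "holds U \<theta> (a @ b) \<longleftrightarrow> v" if "(a, v) \<in> q" for v
    using assms(2) that by (auto simp: realizes_def)
  ultimately show ?thesis by blast
qed

text \<open>Local types are only finitely consistent by definition; saturation over the countable
  set \<open>X\<close> supplies a realization.\<close>

lemma local_type_realized:
  assumes \<theta>: "\<theta> \<in> forms L (k + m)" and q: "q \<in> local_types U A k m \<theta>"
  shows "\<exists>b. realizes U m \<theta> b q"
proof -
  have "\<exists>b\<in>V m. \<forall>a\<in>X. holds U \<theta> (a @ b) \<longleftrightarrow> (a, True) \<in> q"
  proof (rule realize_pattern[OF \<theta> X(1,2)])
    fix F assume F: "finite F" "F \<subseteq> X"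
    define G where "G = (\<lambda>a. (a, (a, True) \<in> q)) ` F"
    have "G \<subseteq> q"
    proof
      fix z assume "z \<in> G"
      then obtain a where "a \<in> F" "z = (a, (a, True) \<in> q)" by (auto simp: G_def)
      then show "z \<in> q" using q F(2) unfolding local_types_def by (cases "(a, True) \<in> q") auto
    qed
    then obtain b where "realizes U m \<theta> b G"
      using q F(1) unfolding local_types_def G_def by blast
    then show "\<exists>b\<in>V m. \<forall>a\<in>F. holds U \<theta> (a @ b) \<longleftrightarrow> (a, True) \<in> q"
      by (auto simp: realizes_def G_def)
  qed
  then obtain b where b: "b \<in> V m" "\<And>a. a \<in> X \<Longrightarrow> holds U \<theta> (a @ b) \<longleftrightarrow> (a, True) \<in> q" by blast
  have "holds U \<theta> (a @ b) \<longleftrightarrow> v" if av: "(a, v) \<in> q" for a v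
  proof -
    have "a \<in> X" using q av unfolding local_types_def by auto
    moreover have "\<not> ((a, True) \<in> q \<and> (a, False) \<in> q)"
    proof
      assume "(a, True) \<in> q \<and> (a, False) \<in> q"
      then have "finite {(a, True), (a, False)}" "{(a, True), (a, False)} \<subseteq> q" by auto
      then obtain b where "realizes U m \<theta> b {(a, True), (a, False)}"
        using q unfolding local_types_def by blast
      then show False by (auto simp: realizes_def)
    qed
    ultimately show ?thesis using b(2) av by (cases v) auto
  qed
  with b(1) have "realizes U m \<theta> b q" by (auto simp: realizes_def)
  then show ?thesis ..
qed

lemma topspace_local_type: "topspace (local_type_topology U A k m \<theta>) \<subseteq> local_types U A k m \<theta>"
  unfolding local_type_topology_def topology_generated_by_topspace by blast

text \<open>Fixing the truth values at the tuples in \<open>F\<close> gives an open neighbourhood on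
  which \<open>g\<close> is constant.\<close>

lemma continuous_finite_dependence:
  fixes g :: "('u list \<times> bool) set \<Rightarrow> real"
  assumes F: "finite F" "F \<subseteq> X"
    and dep: "\<And>q q'. (\<And>a. a \<in> F \<Longrightarrow> (a, True) \<in> q \<longleftrightarrow> (a, True) \<in> q') \<Longrightarrow> g q = g q'"
    and \<theta>: "\<theta> \<in> forms L (k + m)"
  shows "continuous_map (local_type_topology U A k m \<theta>) euclideanreal g"
proof -
  define Q where "Q = local_types U A k m \<theta>"
  define T where "T = local_type_topology U A k m \<theta>"
  have basic: "openin T {q \<in> Q. (a, v) \<in> q}" if "a \<in> X" for a v
    unfolding T_def Q_def local_type_topology_def using that by (intro topology_generated_by_Basis) blast
  have "openin T {q \<in> topspace T. g q \<in> W}" for W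
  proof (subst openin_subopen, intro ballI)
    fix q assume "q \<in> {q \<in> topspace T. g q \<in> W}"
    then have q: "q \<in> topspace T" "g q \<in> W" "q \<in> Q"
      using topspace_local_type by (auto simp: T_def Q_def)
    obtain b where b: "realizes U m \<theta> b q" using local_type_realized[OF \<theta>] q(3) by (auto simp: Q_def)
    define v where "v a \<longleftrightarrow> holds U \<theta> (a @ b)" for a
    define N where "N = (\<Inter>a\<in>F. {q \<in> Q. (a, v a) \<in> q}) \<inter> topspace T"
    have "openin T N"
      unfolding N_def
    proof (cases "F = {}")
      case False
      then show "openin T ((\<Inter>a\<in>F. {q \<in> Q. (a, v a) \<in> q}) \<inter> topspace T)"
        using F basic by (intro openin_Int openin_INT2) auto
    qed simp
    moreover have "q \<in> N"
    proof -
      have "(a, v a) \<in> q" if "a \<in> F" for a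
      proof -
        have "a \<in> X" using F(2) that by auto
        then have "(a, True) \<in> q \<or> (a, False) \<in> q" using q(3) by (auto simp: Q_def local_types_def)
        then show ?thesis using b unfolding realizes_def v_def by (cases "holds U \<theta> (a @ b)") auto
      qed
      then show ?thesis using q by (auto simp: N_def)
    qed
    moreover have geq: "g q' = g q" if "q' \<in> N" for q'
    proof (rule dep)
      fix a assume a: "a \<in> F"
      have q': "q' \<in> Q" "(a, v a) \<in> q'"
        using that a topspace_local_type by (auto simp: N_def T_def Q_def)
      obtain b' where b': "realizes U m \<theta> b' q'" using local_type_realized[OF \<theta>] q'(1) by (auto simp: Q_def)
      have "holds U \<theta> (a @ b') \<longleftrightarrow> v a" using b' q'(2) by (auto simp: realizes_def)
      then show "(a, True) \<in> q' \<longleftrightarrow> (a, True) \<in> q"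
        using local_type_iff[OF q'(1)[unfolded Q_def] b'] local_type_iff[OF q(3)[unfolded Q_def] b] a F(2)
        by (auto simp: v_def)
    qed
    moreover have "N \<subseteq> {q \<in> topspace T. g q \<in> W}"
    proof
      fix q' assume "q' \<in> N"
      moreover from this have "q' \<in> topspace T" unfolding N_def by blast
      ultimately show "q' \<in> {q \<in> topspace T. g q \<in> W}" using geq q(2) by simp
    qed
    ultimately show "\<exists>N. openin T N \<and> q \<in> N \<and> N \<subseteq> {q \<in> topspace T. g q \<in> W}" by blast
  qed
  then show ?thesis unfolding continuous_map_def T_def by auto
qed

lemma avg_cong: "(\<And>a. a \<in> set ys \<Longrightarrow> P a \<longleftrightarrow> Q a) \<Longrightarrow> avg ys P = avg ys Q"
  unfolding avg_def by (metis filter_cong)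

text \<open>The approximants come from \<open>track\<close> along a subsequence of uniformly bounded
  oscillation. Recording that \<open>g\<close> takes the value 0 or one of the averages lets the 0-1
  valued case be sharpened to equality.\<close>

lemma limit_function_exists:
  fixes ys :: "nat \<Rightarrow> 'u list list"
  assumes \<theta>: "\<theta> \<in> forms L (k + m)" and ys: "\<And>n. ys n \<in> samples"
    and conv: "\<And>b. b \<in> V m \<Longrightarrow> convergent (\<lambda>n. freq (ys n) (\<theta>, b))"
  obtains F where "limit_function U A k m \<theta> (\<lambda>n b. freq (ys n) (\<theta>, b)) F"
    "\<And>\<eta>. 0 < \<eta> \<Longrightarrow> \<exists>g. DBSC (local_type_topology U A k m \<theta>) g \<and>
       (\<forall>q\<in>topspace (local_type_topology U A k m \<theta>). \<bar>F q - g q\<bar> \<le> \<eta> \<and>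
          (g q = 0 \<or> (\<exists>n. g q = avg (ys n) (\<lambda>a. (a, True) \<in> q))))"
proof -
  define T where "T = local_type_topology U A k m \<theta>"
  define f where "f q n = avg (ys n) (\<lambda>a. (a, True) \<in> q)" for q n
  define F where "F q = lim (f q)" for q
  have f_eq: "f q n = freq (ys n) (\<theta>, b)" if "q \<in> local_types U A k m \<theta>" "realizes U m \<theta> b q" for q b n
    unfolding f_def freq_def using ys[of n] that
    by (intro avg_cong) (auto simp: local_type_iff)
  have f_lim: "f q \<longlonglongrightarrow> F q" if q: "q \<in> local_types U A k m \<theta>" for q
  proof -
    obtain b where b: "realizes U m \<theta> b q" using local_type_realized[OF \<theta> q] by blast
    then have "b \<in> V m" by (simp add: realizes_def)
    moreover have "f q = (\<lambda>n. freq (ys n) (\<theta>, b))" using f_eq[OF q b] by (rule ext)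
    ultimately have "convergent (f q)" using conv by simp
    then show ?thesis unfolding F_def by (simp add: convergent_LIMSEQ_iff)
  qed
  have lf: "limit_function U A k m \<theta> (\<lambda>n b. freq (ys n) (\<theta>, b)) F"
    unfolding limit_function_def
  proof (intro ballI conjI allI impI)
    fix q b assume q: "q \<in> local_types U A k m \<theta>" "realizes U m \<theta> b q"
    show "(\<lambda>n. freq (ys n) (\<theta>, b)) \<longlonglongrightarrow> F q"
      using f_lim[OF q(1)] unfolding f_eq[OF q, symmetric] .
  qed (rule local_type_realized[OF \<theta>])
  have approx: "\<exists>g. DBSC T g \<and> (\<forall>q\<in>topspace T. \<bar>F q - g q\<bar> \<le> \<eta> \<and>
          (g q = 0 \<or> (\<exists>n. g q = avg (ys n) (\<lambda>a. (a, True) \<in> q))))" if \<eta>: "0 < \<eta>" for \<eta> :: real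
  proof -
    \<comment> \<open>The grid is chosen so fine that a move of size \<open>\<eta>\<close> crosses a
      whole cell.\<close>
    obtain N :: nat where "3 / \<eta> < N" using reals_Archimedean2 by blast
    moreover have "0 < 3 / \<eta>" using \<eta> by simp
    ultimately have N0: "0 < real N" by linarith
    have "3 < real N * \<eta>" using \<open>3 / \<eta> < N\<close> \<eta> by (simp add: divide_less_eq)
    with N0 have N: "0 < N" "3 / real N \<le> \<eta>" by (auto simp: divide_le_eq mult.commute)
    define r s where "r j = real j / N" "s j = (real j + 1) / N" for j
    have rs: "r j < s j" for j using N by (auto simp: r_s_def divide_simps)
    obtain h :: "nat \<Rightarrow> nat" and E K where h: "strict_mono h"
      and om: "\<forall>b\<in>V m. \<forall>j<N. \<forall>ts. sorted_wrt (<) ts \<longrightarrow> length ts = K \<longrightarrow>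
       (\<exists>i<K. \<not> (if i \<in> E j then s j < avg (ys (h (ts ! i))) (\<lambda>a. holds U \<theta> (a @ b))
           else avg (ys (h (ts ! i))) (\<lambda>a. holds U \<theta> (a @ b)) < r j))"
      using subsequence_omitting_patterns[where N = N and r = r and s = s and y = ys, OF fat_bounded_samples[OF \<theta>] ys rs]
      by (elim exE conjE)
    \<comment> \<open>The subsequence depends on \<open>\<eta>\<close>, but its limit is still
      \<open>F q\<close> because the full sequence converges.\<close>
    define f' where "f' q n = f q (h n)" for q n
    \<comment> \<open>Independent of \<open>q\<close>, as DBSC requires of the bound on the
      variation.\<close>
    define c where "c = 2 * (N * K) + 2"
    have range: "0 \<le> f' q n" "f' q n \<le> 1" for q n by (auto simp: f'_def f_def avg_nonneg avg_le_1)
    have jumps: "finite (jumps \<eta> (f' q))" "card (jumps \<eta> (f' q)) \<le> c" if q: "q \<in> topspace T" for q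
    proof -
      have q': "q \<in> local_types U A k m \<theta>" using q topspace_local_type by (auto simp: T_def)
      obtain b where b: "realizes U m \<theta> b q" using local_type_realized[OF \<theta> q'] by blast
      then have bV: "b \<in> V m" by (simp add: realizes_def)
      have f'_eq: "f' q n = avg (ys (h n)) (\<lambda>a. holds U \<theta> (a @ b))" for n
        using f_eq[OF q' b] by (simp add: f'_def freq_def)
      have "\<exists>i<K. \<not> (if i \<in> E j then (real j + 1) / N < f' q (ts ! i) else f' q (ts ! i) < real j / N)"
        if "j < N" "sorted_wrt (<) ts" "length ts = K" for j ts
        using om[rule_format, OF bV that] unfolding f'_eq r_s_def .
      note le = card_jumps_le[OF range N this]
      show "finite (jumps \<eta> (f' q))" by (rule le(1))
      show "card (jumps \<eta> (f' q)) \<le> c" unfolding c_def by (rule le(2))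
    qed
    define P where "P q l \<longleftrightarrow> (\<lambda>n. track \<eta> (f' q) n) \<longlonglongrightarrow> l \<and> l \<in> insert 0 (range (f' q)) \<and>
      summable (\<lambda>n. \<bar>track \<eta> (f' q) (Suc n) - track \<eta> (f' q) n\<bar>) \<and>
      (\<Sum>n. \<bar>track \<eta> (f' q) (Suc n) - track \<eta> (f' q) n\<bar>) \<le> real c \<and>
      \<bar>F q - l\<bar> \<le> \<eta>" for q l
    have "\<exists>l. P q l" if q: "q \<in> topspace T" for q
    proof -
      have "q \<in> local_types U A k m \<theta>" using q topspace_local_type unfolding T_def by blast
      from LIMSEQ_subseq_LIMSEQ[OF f_lim[OF this] h]
      have "f' q \<longlonglongrightarrow> F q" unfolding f'_def comp_def .
      show ?thesis
      proof (rule track_convergence[OF range \<eta> jumps[OF q]])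
        fix l
        assume *: "(\<lambda>n. track \<eta> (f' q) n) \<longlonglongrightarrow> l" "l \<in> insert 0 (range (f' q))"
          "summable (\<lambda>n. \<bar>track \<eta> (f' q) (Suc n) - track \<eta> (f' q) n\<bar>)"
          "(\<Sum>n. \<bar>track \<eta> (f' q) (Suc n) - track \<eta> (f' q) n\<bar>) \<le> real c"
          "\<And>L. f' q \<longlonglongrightarrow> L \<Longrightarrow> \<bar>L - l\<bar> \<le> \<eta>"
        show "\<exists>l. P q l"
          unfolding P_def
          by (intro exI[of _ l] conjI) (fact * *(5)[OF \<open>f' q \<longlonglongrightarrow> F q\<close>])+
      qed
    qed
    then obtain g where g: "\<And>q. q \<in> topspace T \<Longrightarrow> P q (g q)" by metis
    have "DBSC T g"
      unfolding DBSC_def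
    proof (intro exI conjI allI ballI)
      fix n
      \<comment> \<open>The approximant with number \<open>n\<close> reads only the first
        \<open>n\<close> samples of the subsequence, hence finitely many tuples.\<close>
      show "continuous_map T euclideanreal (\<lambda>q. track \<eta> (f' q) n)"
        unfolding T_def
      proof (rule continuous_finite_dependence[OF _ _ _ \<theta>])
        show "finite (\<Union>i<n. set (ys (h i)))" by simp
        show "(\<Union>i<n. set (ys (h i))) \<subseteq> X" using ys by auto
        fix q q' assume "\<And>a. a \<in> (\<Union>i<n. set (ys (h i))) \<Longrightarrow> (a, True) \<in> q \<longleftrightarrow> (a, True) \<in> q'"
        then show "track \<eta> (f' q) n = track \<eta> (f' q') n"
          unfolding f'_def f_def by (intro track_cong avg_cong) auto
      qed
    next
      fix q assume "q \<in> topspace T"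
      note g = g[OF this, unfolded P_def]
      show "track \<eta> (f' q) 0 = 0" by simp
      show "(\<lambda>n. track \<eta> (f' q) n) \<longlonglongrightarrow> g q"
        "summable (\<lambda>n. \<bar>track \<eta> (f' q) (Suc n) - track \<eta> (f' q) n\<bar>)"
        "(\<Sum>n. \<bar>track \<eta> (f' q) (Suc n) - track \<eta> (f' q) n\<bar>) \<le> real c"
        using g by blast+
    qed
    moreover have "\<bar>F q - g q\<bar> \<le> \<eta> \<and> (g q = 0 \<or> (\<exists>n. g q = avg (ys n) (\<lambda>a. (a, True) \<in> q)))"
      if "q \<in> topspace T" for q
      using g[OF that] unfolding P_def f'_def f_def by auto
    ultimately show ?thesis by blast
  qed
  show ?thesis by (rule that[OF lf approx[unfolded T_def]])
qed

lemma DBSC_cong: "DBSC T f \<Longrightarrow> (\<And>x. x \<in> topspace T \<Longrightarrow> f x = g x) \<Longrightarrow> DBSC T g"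
  unfolding DBSC_def by simp

lemma Baire_half_limit:
  fixes ys :: "nat \<Rightarrow> 'u list list"
  assumes \<theta>: "\<theta> \<in> forms L (k + m)" and ys: "\<And>n. ys n \<in> samples"
    and conv: "\<And>b. b \<in> V m \<Longrightarrow> convergent (\<lambda>n. freq (ys n) (\<theta>, b))"
  shows "\<exists>F. limit_function U A k m \<theta> (\<lambda>n b. freq (ys n) (\<theta>, b)) F \<and>
      Baire_half (local_type_topology U A k m \<theta>) F"
proof -
  define T where "T = local_type_topology U A k m \<theta>"
  obtain F where F: "limit_function U A k m \<theta> (\<lambda>n b. freq (ys n) (\<theta>, b)) F"
    "\<And>\<eta>. 0 < \<eta> \<Longrightarrow> \<exists>g. DBSC T g \<and> (\<forall>q\<in>topspace T. \<bar>F q - g q\<bar> \<le> \<eta> \<and>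
          (g q = 0 \<or> (\<exists>n. g q = avg (ys n) (\<lambda>a. (a, True) \<in> q))))"
    using limit_function_exists[OF \<theta> ys conv] unfolding T_def by metis
  have "\<exists>g. DBSC T g \<and> (\<forall>q\<in>topspace T. \<bar>F q - g q\<bar> \<le> 1 / real (Suc n))" for n
    using F(2)[of "1 / real (Suc n)"] by auto
  then obtain g where g: "\<And>n. DBSC T (g n)" "\<And>n q. q \<in> topspace T \<Longrightarrow> \<bar>F q - g n q\<bar> \<le> 1 / real (Suc n)"
    by metis
  have "uniform_limit (topspace T) g F sequentially"
  proof (rule uniform_limitI)
    fix e :: real assume "0 < e"
    then have "eventually (\<lambda>n. 1 / real (Suc n) < e) sequentially"
      using order_tendstoD(2)[OF LIMSEQ_Suc[OF lim_1_over_n]] by (simp add: divide_inverse)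
    then show "eventually (\<lambda>n. \<forall>q\<in>topspace T. dist (g n q) (F q) < e) sequentially"
    proof eventually_elim
      case (elim n)
      then show ?case using g(2)[of _ n] by (auto simp: dist_real_def abs_minus_commute intro: order_le_less_trans)
    qed
  qed
  with g(1) F(1) show ?thesis unfolding Baire_half_def T_def by blast
qed

text \<open>Both the limit and the approximant for \<open>\<eta> = 1 / 2\<close> have only the
  values 0 and 1, so an error of at most \<open>1 / 2\<close> forces equality.\<close>

lemma DBSC_limit:
  fixes a :: "nat \<Rightarrow> 'u list"
  assumes \<theta>: "\<theta> \<in> forms L (k + m)" and a: "\<And>n. a n \<in> X"
    and conv: "\<And>b. b \<in> V m \<Longrightarrow> convergent (\<lambda>n. freq [a n] (\<theta>, b))"
  shows "\<exists>F. limit_function U A k m \<theta> (\<lambda>n b. freq [a n] (\<theta>, b)) F \<and>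
      DBSC (local_type_topology U A k m \<theta>) F"
proof -
  define T where "T = local_type_topology U A k m \<theta>"
  have ys: "[a n] \<in> samples" for n using a by auto
  obtain F where F: "limit_function U A k m \<theta> (\<lambda>n b. freq [a n] (\<theta>, b)) F"
    "\<And>\<eta>. 0 < \<eta> \<Longrightarrow> \<exists>g. DBSC T g \<and> (\<forall>q\<in>topspace T. \<bar>F q - g q\<bar> \<le> \<eta> \<and>
          (g q = 0 \<or> (\<exists>n. g q = avg [a n] (\<lambda>a. (a, True) \<in> q))))"
    using limit_function_exists[of \<theta> m "\<lambda>n. [a n]", OF \<theta> ys conv] unfolding T_def by metis
  obtain g where g: "DBSC T g" "\<And>q. q \<in> topspace T \<Longrightarrow> \<bar>F q - g q\<bar> \<le> 1 / 2 \<and>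
          (g q = 0 \<or> (\<exists>n. g q = avg [a n] (\<lambda>a. (a, True) \<in> q)))"
    using F(2)[of "1 / 2"] by auto
  have "g q = F q" if q: "q \<in> topspace T" for q
  proof -
    have "q \<in> local_types U A k m \<theta>" using q topspace_local_type by (auto simp: T_def)
    moreover from local_type_realized[OF \<theta> this] obtain b where "realizes U m \<theta> b q" by blast
    ultimately have lim: "(\<lambda>n. freq [a n] (\<theta>, b)) \<longlonglongrightarrow> F q"
      using F(1) unfolding limit_function_def by blast
    have "F q \<in> {0, 1}"
    proof (rule Lim_in_closed_set[OF _ _ _ lim])
      show "eventually (\<lambda>n. freq [a n] (\<theta>, b) \<in> {0, 1}) sequentially"
        by (intro always_eventually allI) (simp add: freq_singleton)
    qed (auto intro: finite_imp_closed)
    moreover have "g q \<in> {0, 1}" using g(2)[OF q] by (auto simp: avg_def)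
    ultimately show ?thesis using g(2)[OF q] by auto
  qed
  from DBSC_cong[OF g(1) this] F(1) show ?thesis unfolding T_def by blast
qed

end

section \<open>The spaces of types and measures\<close>

context sat_struct
begin

lemma pforms_Neg: "(\<theta>, b) \<in> PF k \<Longrightarrow> (Neg \<theta>, b) \<in> PF k"
  by (simp add: mem_pforms)

lemma global_type_Neg:
  assumes "p \<in> global_types L U k" "(\<theta>, b) \<in> PF k"
  shows "(Neg \<theta>, b) \<in> p \<longleftrightarrow> (\<theta>, b) \<notin> p"
proof -
  have "\<exists>a\<in>V k. \<forall>\<phi>\<in>{(\<theta>, b), (Neg \<theta>, b)}. \<phi> \<in> p \<longleftrightarrow> a \<in> solutions U k \<phi>"
    using pforms_Neg[OF assms(2)] assms(2) by (intro global_type_decides[OF assms(1)]) auto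
  then show ?thesis by (auto simp: mem_solutions)
qed

lemma topspace_global_types: "topspace (global_type_topology L U k) = global_types L U k"
proof -
  obtain \<theta> b where \<phi>: "(\<theta>, b) \<in> PF k" using pforms_full[of k] by (metis surj_pair)
  have "p \<in> \<Union>{{p \<in> global_types L U k. \<phi> \<in> p} |\<phi>. \<phi> \<in> PF k}" if p: "p \<in> global_types L U k" for p
  proof (cases "(\<theta>, b) \<in> p")
    case True
    then show ?thesis using p \<phi> by blast
  next
    case False
    then have "(Neg \<theta>, b) \<in> p" using global_type_Neg[OF p \<phi>] by simp
    then show ?thesis using p pforms_Neg[OF \<phi>] by blast
  qed
  then show ?thesis
    unfolding global_type_topology_def topology_generated_by_topspace by blast
qed

lemma openin_global_types:
  assumes "\<phi> \<in> PF k"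
  shows "openin (global_type_topology L U k) {p \<in> global_types L U k. \<phi> \<in> p}"
  unfolding global_type_topology_def using assms by (intro topology_generated_by_Basis) blast

lemma openin_global_types_not:
  assumes "\<phi> \<in> PF k"
  shows "openin (global_type_topology L U k) {p \<in> global_types L U k. \<phi> \<notin> p}"
proof -
  obtain \<theta> b where \<phi>: "\<phi> = (\<theta>, b)" by fastforce
  have "{p \<in> global_types L U k. \<phi> \<notin> p} = {p \<in> global_types L U k. (Neg \<theta>, b) \<in> p}"
    using global_type_Neg assms unfolding \<phi> by blast
  then show ?thesis using openin_global_types[OF pforms_Neg] assms unfolding \<phi> by simp
qed

lemma mem_global_tp: "a \<in> V k \<Longrightarrow> \<phi> \<in> PF k \<Longrightarrow> \<phi> \<in> global_tp L U a \<longleftrightarrow> holds U (fst \<phi>) (a @ snd \<phi>)"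
  by (cases \<phi>) (auto simp: global_tp_def tuples_def)

lemma global_tp_global_types:
  assumes a: "a \<in> V k"
  shows "global_tp L U a \<in> global_types L U k"
proof -
  have sub: "global_tp L U a \<subseteq> PF k" using a by (auto simp: global_tp_def tuples_def)
  moreover have "consistent U k (global_tp L U a)"
    unfolding consistent_def
  proof (intro allI impI)
    fix F assume F: "finite F \<and> F \<subseteq> global_tp L U a"
    have "a \<in> solutions U k \<phi>" if "\<phi> \<in> F" for \<phi>
      using F sub that a mem_global_tp[OF a, of \<phi>] by (auto simp: mem_solutions)
    then show "\<exists>a\<in>V k. \<forall>\<phi>\<in>F. a \<in> solutions U k \<phi>" using a by blast
  qed
  moreover have "(\<theta>, b) \<in> global_tp L U a \<or> (Neg \<theta>, b) \<in> global_tp L U a" if "(\<theta>, b) \<in> PF k" for \<theta> b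
    using mem_global_tp[OF a that] mem_global_tp[OF a pforms_Neg[OF that]] by simp
  ultimately show ?thesis by (auto simp: global_types_def)
qed

lemma freq_tendsto_of_bool:
  "(\<lambda>n. freq [a n] \<phi>) \<longlonglongrightarrow> of_bool P \<longleftrightarrow> eventually (\<lambda>n. holds U (fst \<phi>) (a n @ snd \<phi>) \<longleftrightarrow> P) sequentially"
proof
  assume lim: "(\<lambda>n. freq [a n] \<phi>) \<longlonglongrightarrow> of_bool P"
  have "eventually (\<lambda>n. dist (freq [a n] \<phi>) (of_bool P) < 1) sequentially"
    using lim by (rule tendstoD) simp
  then show "eventually (\<lambda>n. holds U (fst \<phi>) (a n @ snd \<phi>) \<longleftrightarrow> P) sequentially"
    by eventually_elim (auto simp: freq_singleton dist_real_def split: if_splits)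
next
  assume "eventually (\<lambda>n. holds U (fst \<phi>) (a n @ snd \<phi>) \<longleftrightarrow> P) sequentially"
  then have "eventually (\<lambda>n. freq [a n] \<phi> = of_bool P) sequentially"
    by eventually_elim (simp add: freq_singleton)
  then show "(\<lambda>n. freq [a n] \<phi>) \<longlonglongrightarrow> of_bool P" by (rule tendsto_eventually)
qed

text \<open>Convergence need only be tested on the generating sets, whose complements are open
  through negation. Convergence of truth values means being eventually constant.\<close>

lemma limitin_global_types:
  assumes a: "\<And>n. a n \<in> V k" and p: "p \<in> global_types L U k"
  shows "limitin (global_type_topology L U k) (\<lambda>n. global_tp L U (a n)) p sequentially \<longleftrightarrow>
    (\<forall>\<phi>\<in>PF k. (\<lambda>n. freq [a n] \<phi>) \<longlonglongrightarrow> of_bool (\<phi> \<in> p))"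
proof
  assume lim: "limitin (global_type_topology L U k) (\<lambda>n. global_tp L U (a n)) p sequentially"
  show "\<forall>\<phi>\<in>PF k. (\<lambda>n. freq [a n] \<phi>) \<longlonglongrightarrow> of_bool (\<phi> \<in> p)"
  proof
    fix \<phi> assume \<phi>: "\<phi> \<in> PF k"
    define W where "W = {r \<in> global_types L U k. \<phi> \<in> r \<longleftrightarrow> \<phi> \<in> p}"
    have "openin (global_type_topology L U k) W"
      using openin_global_types[OF \<phi>] openin_global_types_not[OF \<phi>]
      by (cases "\<phi> \<in> p") (simp_all add: W_def)
    moreover have "p \<in> W" using p by (simp add: W_def)
    ultimately have "eventually (\<lambda>n. global_tp L U (a n) \<in> W) sequentially"
      using lim unfolding limitin_def by blast
    then show "(\<lambda>n. freq [a n] \<phi>) \<longlonglongrightarrow> of_bool (\<phi> \<in> p)"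
      unfolding freq_tendsto_of_bool
      by eventually_elim (simp add: W_def mem_global_tp[OF a \<phi>])
  qed
next
  assume lim: "\<forall>\<phi>\<in>PF k. (\<lambda>n. freq [a n] \<phi>) \<longlonglongrightarrow> of_bool (\<phi> \<in> p)"
  have "eventually (\<lambda>n. global_tp L U (a n) \<in> W) sequentially"
    if "generate_topology_on {{p \<in> global_types L U k. \<phi> \<in> p} |\<phi>. \<phi> \<in> PF k} W" "p \<in> W" for W
    using that
  proof (induction rule: generate_topology_on.induct)
    case (Int W W')
    then show ?case by (auto intro: eventually_conj)
  next
    case (UN K)
    then obtain W where W: "W \<in> K" "p \<in> W" by blast
    then have "eventually (\<lambda>n. global_tp L U (a n) \<in> W) sequentially" using UN.IH by blast
    then show ?case by (rule eventually_mono) (use W in blast)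
  next
    case (Basis W)
    then obtain \<phi> where \<phi>: "\<phi> \<in> PF k" "W = {p \<in> global_types L U k. \<phi> \<in> p}" by blast
    then have "\<phi> \<in> p" using Basis.prems by simp
    have "eventually (\<lambda>n. holds U (fst \<phi>) (a n @ snd \<phi>) \<longleftrightarrow> \<phi> \<in> p) sequentially"
      using lim \<phi>(1) unfolding freq_tendsto_of_bool by blast
    then show ?case
      by eventually_elim (simp add: \<phi> \<open>\<phi> \<in> p\<close> global_tp_global_types[OF a] mem_global_tp[OF a])
  qed simp
  then show "limitin (global_type_topology L U k) (\<lambda>n. global_tp L U (a n)) p sequentially"
    unfolding limitin_def topspace_global_types
    using p unfolding global_type_topology_def openin_topology_generated_by_iff by blast
qed

lemma avg_add:
  assumes "\<And>a. a \<in> set ys \<Longrightarrow> R a \<longleftrightarrow> P a \<or> Q a" "\<And>a. a \<in> set ys \<Longrightarrow> \<not> (P a \<and> Q a)"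
  shows "avg ys R = avg ys P + avg ys Q"
proof -
  have "length (filter R ys) = length (filter P ys) + length (filter Q ys)"
    using assms by (induction ys) auto
  then show ?thesis by (simp add: avg_def add_divide_distrib)
qed

lemma Av_keisler:
  assumes ys: "ys \<noteq> []" "set ys \<subseteq> V k"
  shows "Av L U k ys \<in> keisler_measures L U k"
proof -
  have Av: "Av L U k ys \<phi> = avg ys (\<lambda>a. a \<in> solutions U k \<phi>)" if "\<phi> \<in> PF k" for \<phi>
    using that by (simp add: Av_def avg_def length_filter_conv_card)
  have add: "Av L U k ys \<rho> = Av L U k ys \<phi> + Av L U k ys \<psi>"
    if "\<phi> \<in> PF k" "\<psi> \<in> PF k" "\<rho> \<in> PF k" "solutions U k \<phi> \<inter> solutions U k \<psi> = {}"
      "solutions U k \<rho> = solutions U k \<phi> \<union> solutions U k \<psi>" for \<phi> \<psi> \<rho>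
    unfolding Av[OF that(1)] Av[OF that(2)] Av[OF that(3)] that(5)
    by (rule avg_add) (use that(4) in auto)
  have one: "Av L U k ys \<phi> = 1" if \<phi>: "\<phi> \<in> PF k" "solutions U k \<phi> = V k" for \<phi>
  proof -
    have "filter (\<lambda>a. a \<in> V k) ys = ys" using ys(2) by (auto simp: filter_id_conv)
    then show ?thesis using ys(1) by (simp add: Av[OF \<phi>(1)] \<phi>(2) avg_def)
  qed
  show ?thesis
    unfolding keisler_measures_def using add one Av avg_nonneg by (auto simp: Av_def)
qed

lemma limitin_keisler:
  assumes ys: "\<And>n. ys n \<noteq> []" "\<And>n. set (ys n) \<subseteq> V k" and \<mu>: "\<mu> \<in> keisler_measures L U k"
  shows "limitin (keisler_topology L U k) (\<lambda>n. Av L U k (ys n)) \<mu> sequentially \<longleftrightarrow>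
    (\<forall>\<phi>\<in>PF k. (\<lambda>n. freq (ys n) \<phi>) \<longlonglongrightarrow> \<mu> \<phi>)"
proof -
  have "Av L U k (ys n) \<in> keisler_measures L U k" for n using ys by (rule Av_keisler)
  moreover have "Av L U k (ys n) \<in> extensional (PF k)" for n by (simp add: Av_def)
  moreover have "\<mu> \<in> extensional (PF k)" using \<mu> by (rule keisler_measuresD(4))
  ultimately have "limitin (keisler_topology L U k) (\<lambda>n. Av L U k (ys n)) \<mu> sequentially \<longleftrightarrow>
      (\<forall>\<phi>\<in>PF k. (\<lambda>n. Av L U k (ys n) \<phi>) \<longlonglongrightarrow> \<mu> \<phi>)"
    using \<mu> unfolding keisler_topology_def limitin_subtopology limitin_componentwise
    by (auto simp: PiE_def)
  then show ?thesis using Av_eq_freq[OF _ ys(2)] by simp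
qed

end

section \<open>Compactness\<close>

lemma closedin_Ball:
  assumes "\<And>i. i \<in> I \<Longrightarrow> closedin T {x \<in> topspace T. Q i x}"
  shows "closedin T {x \<in> topspace T. \<forall>i\<in>I. Q i x}"
proof (cases "I = {}")
  case False
  then have "{x \<in> topspace T. \<forall>i\<in>I. Q i x} = (\<Inter>i\<in>I. {x \<in> topspace T. Q i x})" by blast
  then show ?thesis using False assms by (auto intro: closedin_Inter)
qed simp

lemma closedin_continuous_map_real:
  assumes "continuous_map T euclideanreal g" "closed C"
  shows "closedin T {x \<in> topspace T. g x \<in> C}"
  using assms by (intro closedin_continuous_map_preimage) auto

context nip_setting
begin

definition fs_measures :: "(('f, 'r) fo_form \<times> 'u list \<Rightarrow> real) set" where
  "fs_measures = {\<nu> \<in> keisler_measures L U k. measure_fin_sat L U A k \<nu>}"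

abbreviation "PT \<equiv> product_topology (\<lambda>_. euclideanreal) (PF k)"

lemma continuous_eval: "\<phi> \<in> PF k \<Longrightarrow> continuous_map PT euclideanreal (\<lambda>\<nu>. \<nu> \<phi>)"
  by (rule continuous_map_product_projection)

lemma keisler_le_1:
  assumes \<mu>: "\<mu> \<in> keisler_measures L U k" and \<phi>: "\<phi> \<in> PF k"
  shows "\<mu> \<phi> \<le> 1"
proof -
  obtain \<psi> where \<psi>: "\<psi> \<in> PF k" "solutions U k \<psi> = V k" using pforms_full by blast
  obtain \<xi> where \<xi>: "\<xi> \<in> PF k" "solutions U k \<xi> = solutions U k \<psi> - solutions U k \<phi>"
    using pforms_combine(2)[OF \<psi>(1) \<phi>] by blast
  have "solutions U k \<phi> \<subseteq> V k" by (auto simp: mem_solutions)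
  then have "\<mu> \<psi> = \<mu> \<phi> + \<mu> \<xi>"
    using \<psi> \<xi> \<phi> by (intro keisler_measuresD(3)[OF \<mu>]) auto
  then show ?thesis using keisler_measuresD(1)[OF \<mu> \<xi>(1)] keisler_measuresD(2)[OF \<mu> \<psi>] by simp
qed

text \<open>Each clause restricts finitely many coordinates to a closed set; finite satisfiability
  becomes measure at most 0 on the formulas without solutions in \<open>X\<close>.\<close>

lemma closedin_fs_measures: "closedin PT fs_measures"
proof -
  define I where "I = {(\<phi>, \<psi>, \<rho>). \<phi> \<in> PF k \<and> \<psi> \<in> PF k \<and> \<rho> \<in> PF k \<and>
      solutions U k \<phi> \<inter> solutions U k \<psi> = {} \<and> solutions U k \<rho> = solutions U k \<phi> \<union> solutions U k \<psi>}"
  define C1 where "C1 = {\<nu> \<in> topspace PT. \<forall>\<phi>\<in>PF k. \<nu> \<phi> \<in> {0..}}"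
  define C2 where "C2 = {\<nu> \<in> topspace PT. \<forall>\<phi>\<in>{\<phi> \<in> PF k. solutions U k \<phi> = V k}. \<nu> \<phi> \<in> {1}}"
  define C3 where "C3 = {\<nu> \<in> topspace PT. \<forall>x\<in>I. \<nu> (snd (snd x)) - \<nu> (fst x) - \<nu> (fst (snd x)) \<in> {0}}"
  define C4 where "C4 = {\<nu> \<in> topspace PT. \<forall>\<phi>\<in>{\<phi> \<in> PF k. \<not> (\<exists>a\<in>X. a \<in> solutions U k \<phi>)}. \<nu> \<phi> \<in> {..0}}"
  have "closedin PT C1"
    unfolding C1_def by (intro closedin_Ball closedin_continuous_map_real continuous_eval) auto
  moreover have "closedin PT C2"
    unfolding C2_def by (intro closedin_Ball closedin_continuous_map_real continuous_eval) auto
  moreover have "closedin PT C3"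
    unfolding C3_def
    by (intro closedin_Ball closedin_continuous_map_real continuous_map_diff continuous_eval)
      (auto simp: I_def)
  moreover have "closedin PT C4"
    unfolding C4_def by (intro closedin_Ball closedin_continuous_map_real continuous_eval) auto
  moreover have "fs_measures = C1 \<inter> C2 \<inter> C3 \<inter> C4"
  proof (intro subset_antisym subsetI)
    fix \<nu> assume "\<nu> \<in> fs_measures"
    then have \<nu>: "\<nu> \<in> keisler_measures L U k" "measure_fin_sat L U A k \<nu>" by (auto simp: fs_measures_def)
    note D = keisler_measuresD[OF \<nu>(1)]
    have top: "\<nu> \<in> topspace PT" using D(4) by (simp add: PiE_def)
    have "\<nu> \<in> C1" using D(1) top by (simp add: C1_def)
    moreover have "\<nu> \<in> C2" using D(2) top by (simp add: C2_def)
    moreover have "\<nu> \<in> C3" using D(3) top by (force simp: C3_def I_def)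
    moreover have "\<nu> \<in> C4"
      using \<nu>(2) top unfolding C4_def measure_fin_sat_def
      by (auto simp: not_less[symmetric])
    ultimately show "\<nu> \<in> C1 \<inter> C2 \<inter> C3 \<inter> C4" by blast
  next
    fix \<nu> assume \<nu>: "\<nu> \<in> C1 \<inter> C2 \<inter> C3 \<inter> C4"
    have "\<nu> \<in> extensional (PF k)" using \<nu> by (auto simp: C1_def PiE_def)
    moreover have "\<forall>\<phi>\<in>PF k. 0 \<le> \<nu> \<phi>" using \<nu> by (simp add: C1_def)
    moreover have "\<forall>\<phi>\<in>PF k. solutions U k \<phi> = V k \<longrightarrow> \<nu> \<phi> = 1" using \<nu> unfolding C2_def by blast
    moreover have "\<nu> \<rho> = \<nu> \<phi> + \<nu> \<psi>" if "(\<phi>, \<psi>, \<rho>) \<in> I" for \<phi> \<psi> \<rho>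
    proof -
      have "\<nu> (snd (snd (\<phi>, \<psi>, \<rho>))) - \<nu> (fst (\<phi>, \<psi>, \<rho>)) - \<nu> (fst (snd (\<phi>, \<psi>, \<rho>))) \<in> {0}"
        using \<nu> that unfolding C3_def by blast
      then show ?thesis by simp
    qed
    ultimately have "\<nu> \<in> keisler_measures L U k"
      unfolding keisler_measures_def I_def by simp
    moreover have "\<exists>a\<in>X. a \<in> solutions U k \<phi>" if "\<phi> \<in> PF k" "0 < \<nu> \<phi>" for \<phi>
    proof (rule ccontr)
      assume "\<not> ?thesis"
      then have "\<nu> \<phi> \<in> {..0}" using \<nu> that(1) unfolding C4_def by blast
      with that(2) show False by simp
    qed
    then have "measure_fin_sat L U A k \<nu>" by (simp add: measure_fin_sat_def)
    ultimately show "\<nu> \<in> fs_measures" by (simp add: fs_measures_def)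
  qed
  ultimately show ?thesis by (simp add: closedin_Int)
qed

lemma compactin_fs_measures: "compactin PT fs_measures"
proof (rule closed_compactin)
  show "compactin PT (\<Pi>\<^sub>E \<phi>\<in>PF k. {0..1 :: real})"
    by (simp add: compactin_PiE)
  show "fs_measures \<subseteq> (\<Pi>\<^sub>E \<phi>\<in>PF k. {0..1 :: real})"
    using keisler_measuresD(1,4) keisler_le_1 by (auto simp: fs_measures_def PiE_def)
qed (rule closedin_fs_measures)

abbreviation "MT \<equiv> subtopology (keisler_topology L U k) {\<nu>. measure_fin_sat L U A k \<nu>}"
abbreviation "TT \<equiv> subtopology (global_type_topology L U k) {r. type_fin_sat U A k r}"

lemma MT_eq: "MT = subtopology PT fs_measures"
  unfolding keisler_topology_def subtopology_subtopology fs_measures_def by (simp add: Int_def)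

lemma topspace_MT: "topspace MT = fs_measures"
  unfolding MT_eq using closedin_subset[OF closedin_fs_measures] by (auto simp: topspace_subtopology)

lemma compact_MT: "compact_space MT"
  unfolding MT_eq by (rule compact_space_subtopology[OF compactin_fs_measures])

lemma topspace_TT: "topspace TT = {p \<in> global_types L U k. type_fin_sat U A k p}"
  by (auto simp: topspace_global_types)

lemma type_measure_fs: "p \<in> topspace TT \<Longrightarrow> type_measure k p \<in> fs_measures"
  unfolding topspace_TT fs_measures_def using type_measure type_measure_fin_sat by blast

text \<open>The inverse of \<open>type_measure\<close>: any finitely many values of the measure are
  matched by one point, which gives consistency and completeness.\<close>

lemma zero_one_measure_type:
  assumes \<nu>: "\<nu> \<in> fs_measures" and zo: "\<And>\<phi>. \<phi> \<in> PF k \<Longrightarrow> \<nu> \<phi> = 0 \<or> \<nu> \<phi> = 1"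
  shows "{\<phi> \<in> PF k. \<nu> \<phi> = 1} \<in> topspace TT"
proof -
  define p where "p = {\<phi> \<in> PF k. \<nu> \<phi> = 1}"
  have pt: "\<exists>a\<in>X. \<forall>\<phi>\<in>F. a \<in> solutions U k \<phi> \<longleftrightarrow> \<nu> \<phi> = 1" if "finite F" "F \<subseteq> PF k" for F
    using \<nu> that zo by (intro zero_one_measure_point) (auto simp: fs_measures_def)
  have "consistent U k p"
    unfolding consistent_def
  proof (intro allI impI)
    fix F assume F: "finite F \<and> F \<subseteq> p"
    then obtain a where "a \<in> X" "\<forall>\<phi>\<in>F. a \<in> solutions U k \<phi> \<longleftrightarrow> \<nu> \<phi> = 1"
      using pt[of F] by (auto simp: p_def)
    then show "\<exists>a\<in>V k. \<forall>\<phi>\<in>F. a \<in> solutions U k \<phi>"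
      using F X(1) by (intro bexI[of _ a]) (auto simp: p_def)
  qed
  moreover have "(\<theta>, b) \<in> p \<or> (Neg \<theta>, b) \<in> p" if \<phi>: "(\<theta>, b) \<in> PF k" for \<theta> b
  proof -
    obtain a where "a \<in> X" "\<forall>\<phi>\<in>{(\<theta>, b), (Neg \<theta>, b)}. a \<in> solutions U k \<phi> \<longleftrightarrow> \<nu> \<phi> = 1"
      using pt[of "{(\<theta>, b), (Neg \<theta>, b)}"] \<phi> pforms_Neg[OF \<phi>] by auto
    then show ?thesis using \<phi> pforms_Neg[OF \<phi>] X(1) by (auto simp: p_def mem_solutions)
  qed
  ultimately have "p \<in> global_types L U k" by (auto simp: global_types_def p_def)
  moreover have "type_fin_sat U A k p"
    using \<nu> unfolding type_fin_sat_def p_def fs_measures_def measure_fin_sat_def by auto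
  ultimately show ?thesis by (simp add: topspace_global_types p_def)
qed

text \<open>The space is a continuous image of the 0-1 valued measures, a closed part of the compact
  space of finitely satisfiable measures.\<close>

lemma compact_TT: "compact_space TT"
proof -
  define Z where "Z = {\<nu> \<in> topspace PT. \<forall>\<phi>\<in>PF k. \<nu> \<phi> \<in> {0, 1}} \<inter> fs_measures"
  define d where "d \<nu> = {\<phi> \<in> PF k. \<nu> \<phi> = 1}" for \<nu> :: "('f, 'r) fo_form \<times> 'u list \<Rightarrow> real"
  have "closedin PT {\<nu> \<in> topspace PT. \<forall>\<phi>\<in>PF k. \<nu> \<phi> \<in> {0, 1}}"
    by (intro closedin_Ball closedin_continuous_map_real continuous_eval) auto
  then have "compactin PT Z"
    unfolding Z_def by (rule closed_Int_compactin) (rule compactin_fs_measures)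
  then have "compact_space (subtopology PT Z)" by (rule compact_space_subtopology)
  have Z: "topspace (subtopology PT Z) = Z"
    using compactin_subset_topspace[OF \<open>compactin PT Z\<close>] by (auto simp: topspace_subtopology)
  have dZ: "d \<nu> \<in> topspace TT" if "\<nu> \<in> Z" for \<nu>
    unfolding d_def using that by (intro zero_one_measure_type) (auto simp: Z_def)
  have "continuous_map (subtopology PT Z) (global_type_topology L U k) d"
    unfolding global_type_topology_def continuous_on_generated_topo_iff Z
  proof (intro conjI allI impI)
    fix W assume "W \<in> {{p \<in> global_types L U k. \<phi> \<in> p} |\<phi>. \<phi> \<in> PF k}"
    then obtain \<phi> where \<phi>: "\<phi> \<in> PF k" "W = {p \<in> global_types L U k. \<phi> \<in> p}" by blast
    \<comment> \<open>Among 0-1 valued measures the value 1 is singled out by an open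
      condition.\<close>
    have "openin PT {\<nu> \<in> topspace PT. \<nu> \<phi> \<in> {1 / 2<..}}"
      using continuous_eval[OF \<phi>(1)] by (rule openin_continuous_map_preimage) auto
    moreover have "d -` W \<inter> Z = {\<nu> \<in> topspace PT. \<nu> \<phi> \<in> {1 / 2<..}} \<inter> Z"
    proof (intro set_eqI iffI)
      fix \<nu> assume \<nu>: "\<nu> \<in> d -` W \<inter> Z"
      then show "\<nu> \<in> {\<nu> \<in> topspace PT. \<nu> \<phi> \<in> {1 / 2<..}} \<inter> Z"
        by (auto simp: \<phi>(2) d_def Z_def)
    next
      fix \<nu> assume \<nu>: "\<nu> \<in> {\<nu> \<in> topspace PT. \<nu> \<phi> \<in> {1 / 2<..}} \<inter> Z"
      then have "\<nu> \<phi> = 1" using \<phi>(1) by (force simp: Z_def)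
      then show "\<nu> \<in> d -` W \<inter> Z"
        using \<nu> dZ[of \<nu>] \<phi> by (simp add: topspace_global_types d_def)
    qed
    ultimately show "openin (subtopology PT Z) (d -` W \<inter> Z)"
      unfolding openin_subtopology by blast
  next
    have "\<Union>{{p \<in> global_types L U k. \<phi> \<in> p} |\<phi>. \<phi> \<in> PF k} = global_types L U k"
      using topspace_global_types unfolding global_type_topology_def topology_generated_by_topspace .
    then show "d ` Z \<subseteq> \<Union>{{p \<in> global_types L U k. \<phi> \<in> p} |\<phi>. \<phi> \<in> PF k}"
      using dZ by (auto simp: topspace_global_types)
  qed
  moreover have "compactin (subtopology PT Z) Z"
    using \<open>compact_space (subtopology PT Z)\<close> unfolding compact_space_def Z .
  ultimately have "compactin (global_type_topology L U k) (d ` Z)" by (rule image_compactin[rotated])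
  moreover have "d ` Z = topspace TT"
  proof (intro subset_antisym subsetI)
    fix p assume p: "p \<in> topspace TT"
    have "type_measure k p \<in> Z"
      using type_measure_fs[OF p] by (auto simp: Z_def type_measure_def)
    moreover have "d (type_measure k p) = p"
      using p global_type_subset[of p k] unfolding topspace_TT d_def type_measure_def by auto
    ultimately show "p \<in> d ` Z" by (metis imageI)
  qed (use dZ in auto)
  ultimately have "compactin (global_type_topology L U k) (topspace TT)" by simp
  then have "compact_space (subtopology (global_type_topology L U k) (topspace TT))"
    by (rule compact_space_subtopology)
  then show ?thesis unfolding topspace_subtopology subtopology_restrict .
qed

section \<open>Rosenthal compacta\<close>

lemma Polish_closed:
  fixes Z :: "(nat \<Rightarrow> real) set"
  assumes "closed Z"
  shows "Polish (top_of_set Z)"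
proof -
  obtain B :: "(nat \<Rightarrow> real) set set" where B: "countable B" "topological_basis B"
    using ex_countable_basis by blast
  have "second_countable (euclidean :: (nat \<Rightarrow> real) topology)"
    unfolding second_countable_def
  proof (intro exI conjI ballI allI impI)
    show "countable B" by (rule B)
    show "openin euclidean W" if "W \<in> B" for W
      using that B(2) by (simp add: topological_basis_open)
    show "\<exists>W\<in>B. x \<in> W \<and> W \<subseteq> O'" if "openin euclidean O' \<and> x \<in> O'" for O' x
      using that topological_basisE[OF B(2), of O' x] by (metis open_openin)
  qed
  then have "separable_space (top_of_set Z)"
    by (intro second_countable_imp_separable_space second_countable_subtopology)
  moreover have "completely_metrizable_space (top_of_set Z)"
    using assms by (intro completely_metrizable_space_closedin completely_metrizable_space_euclidean) auto
  ultimately show ?thesis by (simp add: Polish_def)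
qed

text \<open>A pair of a formula \<open>\<theta>\<close> (the \<open>j\<close>-th one in an enumeration) and a parameter \<open>b\<close> is coded by \<open>j\<close>
  followed by the truth values of \<open>\<theta>(a, b)\<close> for \<open>a\<close> in the countable set \<open>X\<close>. The codes form the
  disjoint union of the spaces of local types.\<close>

definition formula_index :: "(nat \<times> ('f, 'r) fo_form) set" where
  "formula_index = (SIGMA m : UNIV. forms L (k + m))"

definition nth_formula :: "nat \<Rightarrow> nat \<times> ('f, 'r) fo_form" where
  "nth_formula = from_nat_into formula_index"

definition nth_point :: "nat \<Rightarrow> 'u list" where
  "nth_point = from_nat_into X"

definition code :: "nat \<Rightarrow> 'u list \<Rightarrow> nat \<Rightarrow> real" where
  "code j b i = (case i of 0 \<Rightarrow> real j | Suc l \<Rightarrow> of_bool (holds U (snd (nth_formula j)) (nth_point l @ b)))"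

definition codes :: "(nat \<Rightarrow> real) set" where
  "codes = {code j b |j b. b \<in> V (fst (nth_formula j))}"

lemma nth_formula: "snd (nth_formula j) \<in> forms L (k + fst (nth_formula j))"
proof -
  have "definable L U (k + 0) (\<lambda>_. True)" by (rule definable_True[OF struct])
  then have "formula_index \<noteq> {}" unfolding formula_index_def definable_def by blast
  then have "nth_formula j \<in> formula_index" unfolding nth_formula_def by (rule from_nat_into)
  then show ?thesis by (auto simp: formula_index_def)
qed

lemma nth_formula_surj:
  assumes "\<theta> \<in> forms L (k + m)"
  obtains j where "nth_formula j = (m, \<theta>)"
proof -
  have "countable formula_index"
    unfolding formula_index_def using countable_forms[OF countable_lang] by auto
  moreover have "(m, \<theta>) \<in> formula_index" using assms by (simp add: formula_index_def)
  ultimately show ?thesis using that from_nat_into_surj unfolding nth_formula_def by metis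
qed

lemma nth_point: "nth_point l \<in> X" and nth_point_to_nat: "a \<in> X \<Longrightarrow> nth_point (to_nat_on X a) = a"
  using from_nat_into[OF X(3)] X(2) by (auto simp: nth_point_def)

lemma code_point:
  "a \<in> X \<Longrightarrow> code j b (Suc (to_nat_on X a)) = of_bool (holds U (snd (nth_formula j)) (a @ b))"
  by (simp add: code_def nth_point_to_nat)

lemma tendsto_coordinate:
  fixes f :: "nat \<Rightarrow> nat \<Rightarrow> real"
  assumes "f \<longlonglongrightarrow> l"
  shows "(\<lambda>n. f n i) \<longlonglongrightarrow> l i"
proof -
  have "continuous_on UNIV (\<lambda>x :: nat \<Rightarrow> real. x i)" by (rule continuous_on_product_coordinates)
  then have "isCont (\<lambda>x :: nat \<Rightarrow> real. x i) l" unfolding continuous_on_eq_continuous_at[OF open_UNIV] by blast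
  from isCont_tendsto_compose[OF this assms] show ?thesis .
qed

text \<open>Along a convergent sequence of codes the formula number and each truth value are
  eventually constant. Saturation realizes the limiting truth values by one parameter, so the limit
  is again a code.\<close>

lemma closed_codes: "closed codes"
  unfolding closed_sequential_limits
proof (intro allI impI, elim conjE)
  fix f l assume f: "\<forall>n. f n \<in> codes" and lim: "f \<longlonglongrightarrow> (l :: nat \<Rightarrow> real)"
  from f have "\<exists>j b. f n = code j b \<and> b \<in> V (fst (nth_formula j))" for n
    unfolding codes_def by blast
  then obtain j b where jb: "\<And>n. f n = code (j n) (b n)" "\<And>n. b n \<in> V (fst (nth_formula (j n)))"
    by metis
  note lim_i = tendsto_coordinate[OF lim]
  have "(\<lambda>n. real (j n)) \<longlonglongrightarrow> l 0" using lim_i[of 0] by (simp add: jb(1) code_def)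
  \<comment> \<open>Natural numbers at distance less than \<open>1 / 2\<close> from the same real
    coincide.\<close>
  then have "eventually (\<lambda>n. dist (real (j n)) (l 0) < 1 / 2) sequentially" by (rule tendstoD) simp
  then obtain n0 where n0: "\<And>n. n \<ge> n0 \<Longrightarrow> \<bar>real (j n) - l 0\<bar> < 1 / 2"
    by (auto simp: eventually_sequentially dist_real_def)
  define j0 where "j0 = j n0"
  have jn: "j n = j0" if "n \<ge> n0" for n
  proof -
    have "\<bar>real (j n) - real j0\<bar> < 1" using n0[OF that] n0[of n0] unfolding j0_def by linarith
    then show ?thesis by linarith
  qed
  define m \<theta> where "m = fst (nth_formula j0)" "\<theta> = snd (nth_formula j0)"
  have \<theta>: "\<theta> \<in> forms L (k + m)" unfolding m_\<theta>_def by (rule nth_formula)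
  define v where "v a \<longleftrightarrow> 1 / 2 < l (Suc (to_nat_on X a))" for a
  have ev: "eventually (\<lambda>n. holds U \<theta> (a @ b n) \<longleftrightarrow> v a) sequentially"
    and l_eq: "l (Suc (to_nat_on X a)) = of_bool (v a)" if a: "a \<in> X" for a
  proof -
    have "eventually (\<lambda>n. f n (Suc (to_nat_on X a)) = of_bool (holds U \<theta> (a @ b n))) sequentially"
      using eventually_ge_at_top[of n0]
      by eventually_elim (simp add: jb(1) code_point[OF a] jn m_\<theta>_def)
    then have l: "(\<lambda>n. of_bool (holds U \<theta> (a @ b n)) :: real) \<longlonglongrightarrow> l (Suc (to_nat_on X a))"
      using lim_i[of "Suc (to_nat_on X a)"] by (simp add: tendsto_cong)
    have "l (Suc (to_nat_on X a)) \<in> {0, 1}"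
      by (rule Lim_in_closed_set[OF _ _ _ l]) (auto intro: finite_imp_closed)
    then show "l (Suc (to_nat_on X a)) = of_bool (v a)" by (auto simp: v_def)
    then have "eventually (\<lambda>n. dist (of_bool (holds U \<theta> (a @ b n)) :: real) (of_bool (v a)) < 1) sequentially"
      using l by (intro tendstoD) auto
    then show "eventually (\<lambda>n. holds U \<theta> (a @ b n) \<longleftrightarrow> v a) sequentially"
      by eventually_elim (auto simp: dist_real_def split: if_splits)
  qed
  have "\<exists>b\<in>V m. \<forall>a\<in>X. holds U \<theta> (a @ b) \<longleftrightarrow> v a"
  proof (rule realize_pattern[OF \<theta> X(1,2)])
    fix F assume F: "finite F" "F \<subseteq> X"
    have "eventually (\<lambda>n. (\<forall>a\<in>F. holds U \<theta> (a @ b n) \<longleftrightarrow> v a) \<and> n0 \<le> n) sequentially"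
      using F ev by (intro eventually_conj eventually_ball_finite eventually_ge_at_top) auto
    then obtain n where "\<forall>a\<in>F. holds U \<theta> (a @ b n) \<longleftrightarrow> v a" "n0 \<le> n"
      by (auto simp: eventually_sequentially)
    moreover have "b n \<in> V m" using jb(2)[of n] jn[OF \<open>n0 \<le> n\<close>] by (simp add: m_\<theta>_def)
    ultimately show "\<exists>b\<in>V m. \<forall>a\<in>F. holds U \<theta> (a @ b) \<longleftrightarrow> v a" by blast
  qed
  then obtain c where c: "c \<in> V m" "\<And>a. a \<in> X \<Longrightarrow> holds U \<theta> (a @ c) \<longleftrightarrow> v a" by blast
  have "l i = code j0 c i" for i
  proof (cases i)
    case 0
    have "eventually (\<lambda>n. real (j n) = real j0) sequentially"
      using eventually_ge_at_top[of n0] by eventually_elim (simp add: jn)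
    then have "(\<lambda>n. real (j n)) \<longlonglongrightarrow> real j0" by (rule tendsto_eventually)
    from LIMSEQ_unique[OF this \<open>(\<lambda>n. real (j n)) \<longlonglongrightarrow> l 0\<close>] show ?thesis by (simp add: 0 code_def)
  next
    case (Suc i')
    define a where "a = nth_point i'"
    have a: "a \<in> X" unfolding a_def by (rule nth_point)
    \<comment> \<open>For finite \<open>X\<close> the enumeration repeats points, so the index
      \<open>i'\<close> may differ from \<open>to_nat_on X a\<close>.\<close>
    have "f n i = f n (Suc (to_nat_on X a))" for n
      unfolding jb(1) code_point[OF a] by (simp add: Suc code_def a_def)
    then have "l i = l (Suc (to_nat_on X a))"
      using lim_i[of i] lim_i[of "Suc (to_nat_on X a)"] by (simp add: LIMSEQ_unique)
    also have "\<dots> = of_bool (holds U \<theta> (a @ c))" using l_eq[OF a] c(2)[OF a] by simp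
    finally show ?thesis by (simp add: Suc code_def a_def m_\<theta>_def)
  qed
  then have "l = code j0 c" by (rule ext)
  then show "l \<in> codes" using c(1) unfolding codes_def m_\<theta>_def by blast
qed

text \<open>A code sees a parameter only through truth values on \<open>X\<close>, so several
  parameters may share it and one has to be chosen.\<close>

definition decode :: "(nat \<Rightarrow> real) \<Rightarrow> ('f, 'r) fo_form \<times> 'u list" where
  "decode z = (SOME \<phi>. \<exists>j. z = code j (snd \<phi>) \<and> snd \<phi> \<in> V (fst (nth_formula j)) \<and> fst \<phi> = snd (nth_formula j))"

lemma decode:
  assumes "z \<in> codes"
  obtains j where "z = code j (snd (decode z))" "snd (decode z) \<in> V (fst (nth_formula j))"
    "fst (decode z) = snd (nth_formula j)"
proof -
  obtain j b where "z = code j b" "b \<in> V (fst (nth_formula j))" using assms unfolding codes_def by blast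
  then have "\<exists>\<phi>. \<exists>j. z = code j (snd \<phi>) \<and> snd \<phi> \<in> V (fst (nth_formula j)) \<and> fst \<phi> = snd (nth_formula j)"
    by (intro exI[of _ "(snd (nth_formula j), b)"] exI[of _ j]) simp
  from someI_ex[OF this, folded decode_def] that show ?thesis by blast
qed

lemma decode_pforms: "z \<in> codes \<Longrightarrow> decode z \<in> PF k"
proof (erule decode)
  fix j assume "snd (decode z) \<in> V (fst (nth_formula j))" "fst (decode z) = snd (nth_formula j)"
  then show "decode z \<in> PF k"
    using nth_formula[of j] by (cases "decode z") (auto simp: mem_pforms tuples_def)
qed

lemma code_decode:
  assumes "z \<in> codes" "a \<in> X"
  shows "z (Suc (to_nat_on X a)) = of_bool (holds U (fst (decode z)) (a @ snd (decode z)))"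
  using decode[OF assms(1)] code_point[OF assms(2)] by metis

text \<open>The decoded pair has the same truth values on \<open>X\<close> as the original, and a
  finitely satisfiable measure, being a limit of averages over \<open>X\<close>, cannot tell them
  apart. So the choice in \<open>decode\<close> is harmless.\<close>

lemma fs_measure_code:
  assumes \<nu>: "\<nu> \<in> fs_measures" and \<phi>: "\<phi> \<in> PF k" and eq: "\<phi> = (\<theta>, b)"
    and j: "nth_formula j = (length b, \<theta>)"
  shows "\<nu> (decode (code j b)) = \<nu> \<phi>"
proof -
  have z: "code j b \<in> codes" using \<phi> j unfolding codes_def eq mem_pforms by force
  obtain y :: "nat \<Rightarrow> 'u list list" where y: "\<And>n. y n \<in> samples"
    "\<And>\<phi>. \<phi> \<in> PF k \<Longrightarrow> (\<lambda>n. freq (y n) \<phi>) \<longlonglongrightarrow> \<nu> \<phi>"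
    using measure_limit[of \<nu>] \<nu> by (auto simp: fs_measures_def)
  have "freq (y n) (decode (code j b)) = freq (y n) \<phi>" for n
    unfolding freq_def
  proof (rule avg_cong)
    fix a assume "a \<in> set (y n)"
    then have a: "a \<in> X" using y(1)[of n] by auto
    show "holds U (fst (decode (code j b))) (a @ snd (decode (code j b))) \<longleftrightarrow> holds U (fst \<phi>) (a @ snd \<phi>)"
      using code_decode[OF z a] unfolding code_point[OF a] by (simp only: of_bool_eq_iff j eq fst_conv snd_conv)
  qed
  then show ?thesis
    using y(2)[OF decode_pforms[OF z]] y(2)[OF \<phi>] by (simp add: LIMSEQ_unique)
qed

text \<open>The averages that converge to the measure are means of finitely many coordinates of the
  code, hence continuous.\<close>

lemma Baire_one_fs_measure:
  assumes \<nu>: "\<nu> \<in> fs_measures"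
  shows "(\<lambda>z\<in>codes. \<nu> (decode z)) \<in> Baire_one (top_of_set codes)"
proof -
  obtain y :: "nat \<Rightarrow> 'u list list" where y: "\<And>n. y n \<in> samples"
    "\<And>\<phi>. \<phi> \<in> PF k \<Longrightarrow> (\<lambda>n. freq (y n) \<phi>) \<longlonglongrightarrow> \<nu> \<phi>"
    using measure_limit[of \<nu>] \<nu> by (auto simp: fs_measures_def)
  define g where "g n z = (\<Sum>l<length (y n). z (Suc (to_nat_on X (y n ! l)))) / real (length (y n))"
    for n and z :: "nat \<Rightarrow> real"
  have cont: "continuous_map (top_of_set codes) euclideanreal (g n)" for n
    unfolding g_def continuous_map_iff_continuous
    by (intro continuous_intros continuous_on_subset[OF continuous_on_product_coordinates]) (use y(1)[of n] in auto)
  have "g n z = freq (y n) (decode z)" if z: "z \<in> codes" for n z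
  proof -
    have "y n ! l \<in> X" if "l < length (y n)" for l using y(1)[of n] nth_mem[OF that] by blast
    then have "(\<Sum>l<length (y n). z (Suc (to_nat_on X (y n ! l)))) =
      (\<Sum>l<length (y n). of_bool (holds U (fst (decode z)) ((y n ! l) @ snd (decode z))))"
      by (intro sum.cong refl code_decode[OF z]) simp
    then show ?thesis by (simp only: g_def freq_def avg_sum)
  qed
  then have "(\<lambda>n. g n z) \<longlonglongrightarrow> \<nu> (decode z)" if "z \<in> codes" for z
    using y(2)[OF decode_pforms[OF that]] that by simp
  then show ?thesis
    unfolding Baire_one_def using cont by (auto intro!: exI[of _ g])
qed

text \<open>Shared by types and measures. Values on codes determine a measure in
  \<open>fs_measures\<close>, and a continuous injection of a compact space into a Hausdorff space
  is a homeomorphism onto its image.\<close>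

lemma Rosenthal_compactum_embedding:
  fixes T :: "'x topology" and e :: "'x \<Rightarrow> ('f, 'r) fo_form \<times> 'u list \<Rightarrow> real"
  assumes T: "compact_space T" and e: "\<And>x. x \<in> topspace T \<Longrightarrow> e x \<in> fs_measures"
    and cont: "\<And>\<phi>. \<phi> \<in> PF k \<Longrightarrow> continuous_map T euclideanreal (\<lambda>x. e x \<phi>)"
    and inj: "inj_on e (topspace T)"
  shows "Rosenthal_compactum T"
proof -
  define \<Psi> where "\<Psi> x = (\<lambda>z\<in>codes. e x (decode z))" for x
  define PP where "PP = product_topology (\<lambda>_ :: nat \<Rightarrow> real. euclideanreal) codes"
  define K where "K = \<Psi> ` topspace T"
  have "continuous_map T euclideanreal (\<lambda>x. \<Psi> x z)" if "z \<in> codes" for z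
    using cont[OF decode_pforms[OF that]] that by (simp add: \<Psi>_def)
  then have \<Psi>: "continuous_map T PP \<Psi>"
    unfolding PP_def continuous_map_componentwise by (auto simp: \<Psi>_def)
  have comp: "compactin PP K"
    unfolding K_def using T by (intro image_compactin[OF _ \<Psi>]) (simp add: compact_space_def)
  have K: "K \<subseteq> Baire_one (top_of_set codes)"
    unfolding K_def \<Psi>_def using Baire_one_fs_measure e by blast
  have "e x = e x'" if x: "x \<in> topspace T" "x' \<in> topspace T" and eq: "\<Psi> x = \<Psi> x'" for x x'
  proof (rule extensionalityI)
    show "e x \<in> extensional (PF k)" "e x' \<in> extensional (PF k)"
      using e[OF x(1)] e[OF x(2)] by (auto simp: fs_measures_def keisler_measures_def)
    fix \<phi> assume \<phi>: "\<phi> \<in> PF k"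
    obtain \<theta> b where b: "\<phi> = (\<theta>, b)" by fastforce
    obtain j where j: "nth_formula j = (length b, \<theta>)"
      using \<phi> unfolding b mem_pforms by (blast elim: nth_formula_surj)
    define z where "z = code j b"
    have z: "z \<in> codes" using \<phi> j unfolding z_def codes_def b mem_pforms by force
    have "e x (decode z) = e x' (decode z)"
      using fun_cong[OF eq, of z] z by (simp add: \<Psi>_def)
    then show "e x \<phi> = e x' \<phi>"
      using fs_measure_code[OF e[OF x(1)] \<phi> b j] fs_measure_code[OF e[OF x(2)] \<phi> b j] by (simp add: z_def)
  qed
  then have inj\<Psi>: "inj_on \<Psi> (topspace T)"
    using inj unfolding inj_on_def by blast
  have "homeomorphic_map T (subtopology PP K) \<Psi>"
  proof (rule continuous_imp_homeomorphic_map)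
    show "continuous_map T (subtopology PP K) \<Psi>"
      using \<Psi> by (simp add: continuous_map_in_subtopology K_def)
    show "Hausdorff_space (subtopology PP K)"
      unfolding PP_def by (intro Hausdorff_space_subtopology) (simp add: Hausdorff_space_product_topology)
    show "\<Psi> ` topspace T = topspace (subtopology PP K)"
      using compactin_subset_topspace[OF comp] by (auto simp: K_def)
  qed (fact T inj\<Psi>)+
  then have "T homeomorphic_space subtopology PP K" by (rule homeomorphic_map_imp_homeomorphic_space)
  then show ?thesis
    unfolding Rosenthal_compactum_def using T Polish_closed[OF closed_codes] K comp
    by (intro conjI exI[of _ "top_of_set codes"] exI[of _ K]) (simp_all add: PP_def)
qed

lemma Rosenthal_measures: "Rosenthal_compactum MT"
proof (rule Rosenthal_compactum_embedding[where e = "\<lambda>\<nu>. \<nu>"])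
  show "compact_space MT" by (rule compact_MT)
  show "\<nu> \<in> fs_measures" if "\<nu> \<in> topspace MT" for \<nu> using that unfolding topspace_MT .
  show "continuous_map MT euclideanreal (\<lambda>\<nu>. \<nu> \<phi>)" if "\<phi> \<in> PF k" for \<phi>
    unfolding MT_eq by (intro continuous_map_from_subtopology continuous_eval that)
qed simp

lemma Rosenthal_types: "Rosenthal_compactum TT"
proof (rule Rosenthal_compactum_embedding[where e = "type_measure k"])
  show "compact_space TT" by (rule compact_TT)
  show "type_measure k p \<in> fs_measures" if "p \<in> topspace TT" for p using that by (rule type_measure_fs)
  show "continuous_map TT euclideanreal (\<lambda>p. type_measure k p \<phi>)" if \<phi>: "\<phi> \<in> PF k" for \<phi>
  proof (rule continuous_map_from_subtopology)
    show "continuous_map (global_type_topology L U k) euclideanreal (\<lambda>p. type_measure k p \<phi>)"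
      unfolding continuous_map_def
    proof (intro conjI allI impI)
      fix W :: "real set"
      \<comment> \<open>With only the values 0 and 1 possible, a preimage is a union of at most two
        clopen sets.\<close>
      have "{p \<in> topspace (global_type_topology L U k). type_measure k p \<phi> \<in> W} =
          (if 1 \<in> W then {p \<in> global_types L U k. \<phi> \<in> p} else {}) \<union>
          (if 0 \<in> W then {p \<in> global_types L U k. \<phi> \<notin> p} else {})"
        using \<phi> by (auto simp: topspace_global_types type_measure_def split: if_splits)
      then show "openin (global_type_topology L U k)
          {p \<in> topspace (global_type_topology L U k). type_measure k p \<phi> \<in> W}"
        using openin_global_types[OF \<phi>] openin_global_types_not[OF \<phi>] by (simp add: openin_Un)
    qed simp
  qed
  show "inj_on (type_measure k) (topspace TT)"
  proof (rule inj_onI)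
    fix p q assume pq: "p \<in> topspace TT" "q \<in> topspace TT" "type_measure k p = type_measure k q"
    have "p \<subseteq> PF k" "q \<subseteq> PF k" using pq(1,2) global_type_subset unfolding topspace_TT by blast+
    moreover have "\<phi> \<in> p \<longleftrightarrow> \<phi> \<in> q" if "\<phi> \<in> PF k" for \<phi>
      using fun_cong[OF pq(3), of \<phi>] that by (simp add: type_measure_def of_bool_eq_iff)
    ultimately show "p = q" by blast
  qed
qed

lemma limit_function_cong:
  assumes "\<And>n b. b \<in> V m \<Longrightarrow> g n b = g' n b" "limit_function U A k m \<theta> g F"
  shows "limit_function U A k m \<theta> g' F"
  using assms unfolding limit_function_def realizes_def by simp

end

theorem theoremA1:
  fixes L :: "('f, 'r) lang"
    and T :: "('f, 'r) fo_form set"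
    and \<kappa> :: "'c rel"
    and U M :: "('f, 'r, 'u) fo_struct"
    and k :: nat
    and p :: "(('f, 'r) fo_form \<times> 'u list) set"
    and \<mu> :: "('f, 'r) fo_form \<times> 'u list \<Rightarrow> real"
  assumes "countable_lang L"
    and "complete_theory L T"
    and "monster_model \<kappa> L T U"
    and "NIP L U"
    and "model_of L T M"
    and "elementary_submodel L M U"
    and "countable (univ M)"
    and "p \<in> global_types L U k"
    and "type_fin_sat U (univ M) k p"
    and "\<mu> \<in> keisler_measures L U k"
    and "measure_fin_sat L U (univ M) k \<mu>"
  shows
    "(\<exists>a :: nat \<Rightarrow> 'u list.
        (\<forall>n. a n \<in> tuples (univ M) k) \<and>
        limitin (global_type_topology L U k) (\<lambda>n. global_tp L U (a n)) p sequentially)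
     \<and>
     (\<exists>as :: nat \<Rightarrow> 'u list list.
        (\<forall>n. as n \<noteq> [] \<and> set (as n) \<subseteq> tuples (univ M) k) \<and>
        limitin (keisler_topology L U k) (\<lambda>n. Av L U k (as n)) \<mu> sequentially)
     \<and>
     (\<forall>a :: nat \<Rightarrow> 'u list.
        (\<forall>n. a n \<in> tuples (univ M) k) \<and>
        limitin (global_type_topology L U k) (\<lambda>n. global_tp L U (a n)) p sequentially \<longrightarrow>
        (\<forall>m. \<forall>\<theta>\<in>forms L (k + m).
           \<exists>F. limit_function U (univ M) k m \<theta> (\<lambda>n b. of_bool (holds U \<theta> (a n @ b))) F \<and>
               DBSC (local_type_topology U (univ M) k m \<theta>) F))
     \<and>
     (\<forall>as :: nat \<Rightarrow> 'u list list.
        (\<forall>n. as n \<noteq> [] \<and> set (as n) \<subseteq> tuples (univ M) k) \<and>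
        limitin (keisler_topology L U k) (\<lambda>n. Av L U k (as n)) \<mu> sequentially \<longrightarrow>
        (\<forall>m. \<forall>\<theta>\<in>forms L (k + m).
           \<exists>F. limit_function U (univ M) k m \<theta> (\<lambda>n b. Av L U k (as n) (\<theta>, b)) F \<and>
               Baire_half (local_type_topology U (univ M) k m \<theta>) F))
     \<and>
     Rosenthal_compactum
       (subtopology (global_type_topology L U k) {r. type_fin_sat U (univ M) k r})
     \<and>
     Rosenthal_compactum
       (subtopology (keisler_topology L U k) {\<nu>. measure_fin_sat L U (univ M) k \<nu>})"
proof -
  have "lang_struct L M" "lang_struct L U" "univ M \<subseteq> univ U"
    using assms(6) by (auto simp: elementary_submodel_def)
  moreover have "univ M \<noteq> {}" using \<open>lang_struct L M\<close> by (simp add: lang_struct_def)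
  moreover have "saturated \<kappa> L U" "natLeq <o \<kappa>" using assms(3) by (auto simp: monster_model_def)
  ultimately interpret nip_setting L U \<kappa> "univ M" k
    using assms(1,4,7) by unfold_locales
  have pf: "(\<theta>, b) \<in> PF k" if "\<theta> \<in> forms L (k + m)" "b \<in> V m" for \<theta> b m
    using that by (auto simp: mem_pforms tuples_def)
  \<comment> \<open>Both kinds of convergence reduce to that of \<open>freq\<close> on each formula,
    the form in which samples are handled.\<close>
  have types: "limitin (global_type_topology L U k) (\<lambda>n. global_tp L U (a n)) p sequentially \<longleftrightarrow>
      (\<forall>\<phi>\<in>PF k. (\<lambda>n. freq [a n] \<phi>) \<longlonglongrightarrow> of_bool (\<phi> \<in> p))"
    if "\<And>n. a n \<in> X" for a
    using that X(1) assms(8) by (intro limitin_global_types) auto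
  have measures: "limitin (keisler_topology L U k) (\<lambda>n. Av L U k (as n)) \<mu> sequentially \<longleftrightarrow>
      (\<forall>\<phi>\<in>PF k. (\<lambda>n. freq (as n) \<phi>) \<longlonglongrightarrow> \<mu> \<phi>)"
    if "\<And>n. as n \<in> samples" for as
    using that X(1) assms(10) by (intro limitin_keisler) auto
  show ?thesis
  proof (intro conjI allI ballI impI)
    obtain a where a: "\<And>n. a n \<in> X" "\<And>\<phi>. \<phi> \<in> PF k \<Longrightarrow> (\<lambda>n. freq [a n] \<phi>) \<longlonglongrightarrow> of_bool (\<phi> \<in> p)"
      using type_limit[OF assms(8,9)] by blast
    then show "\<exists>a. (\<forall>n. a n \<in> X) \<and>
        limitin (global_type_topology L U k) (\<lambda>n. global_tp L U (a n)) p sequentially"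
      using types[of a] by blast
  next
    obtain y :: "nat \<Rightarrow> 'u list list" where y: "\<And>n. y n \<in> samples"
      "\<And>\<phi>. \<phi> \<in> PF k \<Longrightarrow> (\<lambda>n. freq (y n) \<phi>) \<longlonglongrightarrow> \<mu> \<phi>"
      using measure_limit[OF assms(10,11)] by blast
    then show "\<exists>as. (\<forall>n. as n \<noteq> [] \<and> set (as n) \<subseteq> X) \<and>
        limitin (keisler_topology L U k) (\<lambda>n. Av L U k (as n)) \<mu> sequentially"
      using measures[of y] by blast
  next
    fix a m \<theta>
    assume a: "(\<forall>n. a n \<in> X) \<and>
        limitin (global_type_topology L U k) (\<lambda>n. global_tp L U (a n)) p sequentially"
      and \<theta>: "\<theta> \<in> forms L (k + m)"
    have "convergent (\<lambda>n. freq [a n] (\<theta>, b))" if "b \<in> V m" for b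
      using a types[of a] pf[OF \<theta> that] unfolding convergent_def by blast
    then obtain F where F: "limit_function U (univ M) k m \<theta> (\<lambda>n b. freq [a n] (\<theta>, b)) F"
      "DBSC (local_type_topology U (univ M) k m \<theta>) F"
      using DBSC_limit[OF \<theta>, of a] a by blast
    then show "\<exists>F. limit_function U (univ M) k m \<theta> (\<lambda>n b. of_bool (holds U \<theta> (a n @ b))) F \<and>
               DBSC (local_type_topology U (univ M) k m \<theta>) F"
      by (auto simp: freq_singleton)
  next
    fix as :: "nat \<Rightarrow> 'u list list" and m \<theta>
    assume as: "(\<forall>n. as n \<noteq> [] \<and> set (as n) \<subseteq> X) \<and>
        limitin (keisler_topology L U k) (\<lambda>n. Av L U k (as n)) \<mu> sequentially"
      and \<theta>: "\<theta> \<in> forms L (k + m)"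
    have "convergent (\<lambda>n. freq (as n) (\<theta>, b))" if "b \<in> V m" for b
      using as measures[of as] pf[OF \<theta> that] unfolding convergent_def by blast
    then obtain F where F: "limit_function U (univ M) k m \<theta> (\<lambda>n b. freq (as n) (\<theta>, b)) F"
      "Baire_half (local_type_topology U (univ M) k m \<theta>) F"
      using Baire_half_limit[OF \<theta>, of as] as by blast
    have "freq (as n) (\<theta>, b) = Av L U k (as n) (\<theta>, b)" if "b \<in> V m" for n b
      using as X(1) by (intro Av_eq_freq[symmetric] pf[OF \<theta> that]) auto
    from limit_function_cong[OF this F(1)] F(2)
    show "\<exists>F. limit_function U (univ M) k m \<theta> (\<lambda>n b. Av L U k (as n) (\<theta>, b)) F \<and>
               Baire_half (local_type_topology U (univ M) k m \<theta>) F" by blast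
  qed (fact Rosenthal_types Rosenthal_measures)+
qed

end
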